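(* Let $A$ be a von Neumann algebra and $a\in A_{sa}$. The natural transformation $\underline{\delta^{o}(a)}:\underline{\Sigma}\to\underline{\mathbb{R}}_{l}$ in $[\mathcal{C}^{op},\mathbf{Set}]$, given by $$\underline{\delta^{o}(a)}_{C}:\Sigma_{C}\to\mathrm{OR}(\downarrow C,\mathbb{R}),\qquad \underline{\delta^{o}(a)}_{C}(\lambda)(D)=\lambda(\delta^{o}(a)_{D})\quad(D\subseteq C),$$ is a continuous map of internal topological spaces in $[\mathcal{C}^{op},\mathbf{Set}]$.
   Context: $\mathcal{C}$ is the poset (under inclusion) of abelian von Neumann subalgebras of $A$ (containing the unit of $A$); $\downarrow C=\{D\in\mathcal{C}\mid D\subseteq C\}$; $\mathcal{C}_{\downarrow}$ is $\mathcal{C}$ with the topology of downward closed subsets, so $[\mathcal{C}^{op},\mathbf{Set}]\cong Sh(\mathcal{C}_{\downarrow})$. $\Sigma_C$ is the Gelfand spectrum of $C$. The spectral presheaf $\underline{\Sigma}$ is $C\mapsto\Sigma_C$, with restriction maps $\lambda\mapsto\lambda|_D$ for $D\subseteq C$. $\mathrm{OR}(P,\mathbb{R})$ is the set of order-reversing functions $P\to\mathbb{R}$; $\underline{\mathbb{R}}_l$ is the presheaf $C\mapsto\mathrm{OR}(\downarrow C,\mathbb{R})$ with restriction $s\mapsto s|_{\downarrow D}$. Spectral order: for $a,b\in A_{sa}$ with spectral resolutions $(e^a_x)$, $(e^b_x)$, $a\leq_s b$ iff $e^a_x\geq e^b_x$ for all $x\in\mathbb{R}$. Outer daseinisation: $\delta^o(a)_C=\bigwedge\{b\in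 C_{sa}\mid b\geq_s a\}$. Internal topologies: a presheaf $\underline{X}$ corresponds to the étale bundle $p:X=\coprod_{C}\underline{X}(C)\to\mathcal{C}_{\downarrow}$, where $U\subseteq X$ is étale open iff $(C,x)\in U$ and $D\subseteq C$ imply $(D,x|_D)\in U$. Internal topologies on $\underline{X}$ correspond to topologies on $X$ coarser than the étale topology for which $p$ is continuous. A natural transformation $\underline{X}\to\underline{Y}$ is an internally continuous map iff the induced function $X\to Y$ over $\mathcal{C}_{\downarrow}$ is continuous for these coarser topologies. The internal topology on $\underline{\Sigma}$ corresponds to the topology on $\coprod_C\Sigma_C$ whose opens are the étale opens $U$ such that $U\cap\Sigma_C$ is open in $\Sigma_C$ for every $C$. The internal topology on $\underline{\mathbb{R}}_l$ corresponds to the topology on $\{(C,s)\mid C\in\mathcal{C},\ s\in\mathrm{OR}(\downarrow C,\mathbb{R})\}$ generated by the sets $U_{x,C}=\{(D,s)\mid D\subseteq C,\ s(D)>x\}$, $C\in\mathcal{C}$, $x\in\mathbb{R}$. *)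

theory Defs
  imports "HOL-Analysis.Analysis"
begin

section \<open>Operators on a complex Hilbert space\<close>

text \<open>The inner product is conjugate linear in its first argument.\<close>

class complex_hilbert_space = real_inner + complete_space +
  fixes scaleC :: "complex \<Rightarrow> 'a \<Rightarrow> 'a"  (infixr \<open>*\<^sub>C\<close> 75)
    and cinner :: "'a \<Rightarrow> 'a \<Rightarrow> complex"
  assumes scaleC_add_right: "c *\<^sub>C (x + y) = c *\<^sub>C x + c *\<^sub>C y"
    and scaleC_add_left: "(c + d) *\<^sub>C x = c *\<^sub>C x + d *\<^sub>C x"
    and scaleC_scaleC: "c *\<^sub>C d *\<^sub>C x = (c * d) *\<^sub>C x"
    and scaleR_scaleC: "r *\<^sub>R x = complex_of_real r *\<^sub>C x"
    and cinner_commute: "cinner x y = cnj (cinner y x)"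
    and cinner_add_right: "cinner x (y + z) = cinner x y + cinner x z"
    and cinner_scaleC_right: "cinner x (c *\<^sub>C y) = c * cinner x y"
    and inner_cinner: "inner x y = Re (cinner x y)"

instantiation complex :: complex_hilbert_space
begin

definition scaleC_complex :: "complex \<Rightarrow> complex \<Rightarrow> complex"
  where "scaleC_complex c x = c * x"

definition cinner_complex :: "complex \<Rightarrow> complex \<Rightarrow> complex"
  where "cinner_complex x y = cnj x * y"

instance
  by standard
    (simp_all add: scaleC_complex_def cinner_complex_def algebra_simps scaleR_conv_of_real
      inner_complex_def)

end

text \<open>
  The type \<open>'h \<Rightarrow>\<^sub>L 'h\<close> consists of the bounded \<^emph>\<open>real\<close>-linear operators with the operator norm;
  the bounded operators of the complex Hilbert space are those that commute with \<^term>\<open>scaleC c\<close>.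
\<close>

definition cblinops :: "('h::complex_hilbert_space \<Rightarrow>\<^sub>L 'h) set"
  where "cblinops = {T. \<forall>c x. blinfun_apply T (c *\<^sub>C x) = c *\<^sub>C blinfun_apply T x}"

definition scalar_op :: "complex \<Rightarrow> ('h::complex_hilbert_space \<Rightarrow>\<^sub>L 'h)"
  where "scalar_op c = Blinfun (scaleC c)"

definition adjoint_op :: "('h::complex_hilbert_space \<Rightarrow>\<^sub>L 'h) \<Rightarrow> ('h \<Rightarrow>\<^sub>L 'h)"
  where "adjoint_op T =
    (THE S. \<forall>x y. cinner (blinfun_apply S x) y = cinner x (blinfun_apply T y))"

definition commutant :: "('h::complex_hilbert_space \<Rightarrow>\<^sub>L 'h) set \<Rightarrow> ('h \<Rightarrow>\<^sub>L 'h) set"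
  where "commutant M = {S \<in> cblinops. \<forall>T\<in>M. S o\<^sub>L T = T o\<^sub>L S}"

definition unital_star_algebra :: "('h::complex_hilbert_space \<Rightarrow>\<^sub>L 'h) set \<Rightarrow> bool"
  where "unital_star_algebra M \<longleftrightarrow>
    M \<subseteq> cblinops \<and> id_blinfun \<in> M \<and>
    (\<forall>S\<in>M. \<forall>T\<in>M. S + T \<in> M \<and> S o\<^sub>L T \<in> M) \<and>
    (\<forall>c. \<forall>T\<in>M. scalar_op c o\<^sub>L T \<in> M) \<and>
    (\<forall>T\<in>M. adjoint_op T \<in> M)"

definition von_neumann_algebra :: "('h::complex_hilbert_space \<Rightarrow>\<^sub>L 'h) set \<Rightarrow> bool"
  where "von_neumann_algebra M \<longleftrightarrow> unital_star_algebra M \<and> commutant (commutant M) = M"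

definition self_adjoints :: "('h::complex_hilbert_space \<Rightarrow>\<^sub>L 'h) set \<Rightarrow> ('h \<Rightarrow>\<^sub>L 'h) set"
  where "self_adjoints M = {T \<in> M. adjoint_op T = T}"

definition op_le :: "('h::complex_hilbert_space \<Rightarrow>\<^sub>L 'h) \<Rightarrow> ('h \<Rightarrow>\<^sub>L 'h) \<Rightarrow> bool"
  where "op_le S T \<longleftrightarrow> (\<forall>x. cinner x (blinfun_apply (T - S) x) \<in> \<real>\<^sub>\<ge>\<^sub>0)"

definition projections :: "('h::complex_hilbert_space \<Rightarrow>\<^sub>L 'h) set"
  where "projections = {P \<in> self_adjoints cblinops. P o\<^sub>L P = P}"


section \<open>Spectral order and outer daseinisation\<close>

text \<open>
  A bounded, right-continuous resolution of the identity; right continuity is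
  \<open>e x = \<Sqinter>y>x. e y\<close> in the lattice of projections.
\<close>

definition resolution_of_identity :: "(real \<Rightarrow> ('h::complex_hilbert_space \<Rightarrow>\<^sub>L 'h)) \<Rightarrow> bool"
  where "resolution_of_identity e \<longleftrightarrow>
    (\<forall>x. e x \<in> projections) \<and>
    (\<forall>x y. x \<le> y \<longrightarrow> op_le (e x) (e y)) \<and>
    (\<forall>x. \<forall>P\<in>projections. (\<forall>y>x. op_le P (e y)) \<longrightarrow> op_le P (e x)) \<and>
    (\<exists>K. (\<forall>x. x < - K \<longrightarrow> e x = 0) \<and> (\<forall>x\<ge>K. e x = id_blinfun))"

text \<open>
  \<open>a = \<integral>x de\<^sub>x\<close> as a norm limit of Riemann-Stieltjes sums. The range of integration has to
  reach down to a point where \<open>e\<close> vanishes, so that a jump of \<open>e\<close> at the bottom of the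
  spectrum is counted.
\<close>

definition stieltjes_integral_id ::
    "(real \<Rightarrow> ('h::complex_hilbert_space \<Rightarrow>\<^sub>L 'h)) \<Rightarrow> ('h \<Rightarrow>\<^sub>L 'h) \<Rightarrow> bool"
  where "stieltjes_integral_id e a \<longleftrightarrow>
    (\<forall>\<epsilon>>0. \<exists>\<delta>>0. \<forall>(n::nat) (x::nat \<Rightarrow> real) (t::nat \<Rightarrow> real).
       e (x 0) = 0 \<and> e (x n) = id_blinfun \<and>
       (\<forall>i<n. x i \<le> t i \<and> t i \<le> x (Suc i) \<and> x (Suc i) - x i < \<delta>)
       \<longrightarrow> norm (a - (\<Sum>i<n. t i *\<^sub>R (e (x (Suc i)) - e (x i)))) < \<epsilon>)"

definition spectral_resolution ::
    "('h::complex_hilbert_space \<Rightarrow>\<^sub>L 'h) \<Rightarrow> real \<Rightarrow> ('h \<Rightarrow>\<^sub>L 'h)"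
  where "spectral_resolution a = (THE e. resolution_of_identity e \<and> stieltjes_integral_id e a)"

definition spectral_le :: "('h::complex_hilbert_space \<Rightarrow>\<^sub>L 'h) \<Rightarrow> ('h \<Rightarrow>\<^sub>L 'h) \<Rightarrow> bool"
  where "spectral_le a b \<longleftrightarrow> (\<forall>x. op_le (spectral_resolution b x) (spectral_resolution a x))"

text \<open>The infimum is the greatest lower bound in the poset of self-adjoint elements of \<open>C\<close>.\<close>

definition outer_das ::
    "('h::complex_hilbert_space \<Rightarrow>\<^sub>L 'h) \<Rightarrow> ('h \<Rightarrow>\<^sub>L 'h) set \<Rightarrow> ('h \<Rightarrow>\<^sub>L 'h)"
  where "outer_das a C =
    (let S = {b \<in> self_adjoints C. spectral_le a b}
     in THE d. d \<in> self_adjoints C \<and> (\<forall>b\<in>S. spectral_le d b) \<and>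
          (\<forall>c\<in>self_adjoints C. (\<forall>b\<in>S. spectral_le c b) \<longrightarrow> spectral_le c d))"


section \<open>Presheaves on a poset and internal topologies\<close>

text \<open>\<open>restr F C D\<close> is the restriction map from \<open>C\<close> to \<open>D \<le> C\<close>.\<close>

record ('p, 'x) presheaf =
  sections :: "'p \<Rightarrow> 'x set"
  restr :: "'p \<Rightarrow> 'p \<Rightarrow> 'x \<Rightarrow> 'x"

definition is_presheaf :: "'p::order set \<Rightarrow> ('p, 'x) presheaf \<Rightarrow> bool"
  where "is_presheaf P F \<longleftrightarrow>
    (\<forall>C\<in>P. \<forall>D\<in>P. D \<le> C \<longrightarrow> restr F C D ` sections F C \<subseteq> sections F D) \<and>
    (\<forall>C\<in>P. \<forall>x\<in>sections F C. restr F C C x = x) \<and>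
    (\<forall>C\<in>P. \<forall>D\<in>P. \<forall>E\<in>P. E \<le> D \<and> D \<le> C \<longrightarrow>
       (\<forall>x\<in>sections F C. restr F D E (restr F C D x) = restr F C E x))"

definition natural_transformation ::
    "'p::order set \<Rightarrow> ('p, 'x) presheaf \<Rightarrow> ('p, 'y) presheaf \<Rightarrow> ('p \<Rightarrow> 'x \<Rightarrow> 'y) \<Rightarrow> bool"
  where "natural_transformation P F G \<eta> \<longleftrightarrow>
    is_presheaf P F \<and> is_presheaf P G \<and>
    (\<forall>C\<in>P. \<eta> C ` sections F C \<subseteq> sections G C) \<and>
    (\<forall>C\<in>P. \<forall>D\<in>P. D \<le> C \<longrightarrow>
       (\<forall>x\<in>sections F C. \<eta> D (restr F C D x) = restr G C D (\<eta> C x)))"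

definition downset_topology :: "'p::order set \<Rightarrow> 'p topology"
  where "downset_topology P = topology (\<lambda>U. U \<subseteq> P \<and> (\<forall>C\<in>U. \<forall>D\<in>P. D \<le> C \<longrightarrow> D \<in> U))"

definition total_space :: "'p::order set \<Rightarrow> ('p, 'x) presheaf \<Rightarrow> ('p \<times> 'x) set"
  where "total_space P F = Sigma P (sections F)"

definition etale_open :: "'p::order set \<Rightarrow> ('p, 'x) presheaf \<Rightarrow> ('p \<times> 'x) set \<Rightarrow> bool"
  where "etale_open P F U \<longleftrightarrow>
    U \<subseteq> total_space P F \<and> (\<forall>(C, x)\<in>U. \<forall>D\<in>P. D \<le> C \<longrightarrow> (D, restr F C D x) \<in> U)"

definition internal_topology ::
    "'p::order set \<Rightarrow> ('p, 'x) presheaf \<Rightarrow> ('p \<times> 'x) topology \<Rightarrow> bool"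
  where "internal_topology P F T \<longleftrightarrow>
    topspace T = total_space P F \<and>
    (\<forall>U. openin T U \<longrightarrow> etale_open P F U) \<and>
    continuous_map T (downset_topology P) fst"

definition internally_continuous ::
    "'p::order set \<Rightarrow> ('p, 'x) presheaf \<Rightarrow> ('p \<times> 'x) topology \<Rightarrow>
     ('p, 'y) presheaf \<Rightarrow> ('p \<times> 'y) topology \<Rightarrow> ('p \<Rightarrow> 'x \<Rightarrow> 'y) \<Rightarrow> bool"
  where "internally_continuous P F S G T \<eta> \<longleftrightarrow>
    internal_topology P F S \<and> internal_topology P G T \<and>
    natural_transformation P F G \<eta> \<and>
    continuous_map S T (\<lambda>(C, x). (C, \<eta> C x))"

lemma istopology_downset:
  "istopology (\<lambda>U. U \<subseteq> P \<and> (\<forall>C\<in>U. \<forall>D\<in>P. D \<le> C \<longrightarrow> D \<in> U))"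
  unfolding istopology_def by blast

lemma etale_open_Int: "etale_open P F U \<Longrightarrow> etale_open P F V \<Longrightarrow> etale_open P F (U \<inter> V)"
  unfolding etale_open_def by blast

lemma etale_open_Union: "(\<And>U. U \<in> \<U> \<Longrightarrow> etale_open P F U) \<Longrightarrow> etale_open P F (\<Union>\<U>)"
  unfolding etale_open_def by blast


section \<open>The spectral presheaf and the presheaf of lower reals\<close>

definition contexts ::
    "('h::complex_hilbert_space \<Rightarrow>\<^sub>L 'h) set \<Rightarrow> ('h \<Rightarrow>\<^sub>L 'h) set set"
  where "contexts A =
    {C. von_neumann_algebra C \<and> C \<subseteq> A \<and> (\<forall>S\<in>C. \<forall>T\<in>C. S o\<^sub>L T = T o\<^sub>L S)}"

definition down ::
    "('h::complex_hilbert_space \<Rightarrow>\<^sub>L 'h) set \<Rightarrow> ('h \<Rightarrow>\<^sub>L 'h) set \<Rightarrow> ('h \<Rightarrow>\<^sub>L 'h) set set"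
  where "down A C = {D \<in> contexts A. D \<subseteq> C}"

text \<open>
  Nonzero multiplicative linear functionals on \<open>C\<close>, as functions extended by
  \<^term>\<open>undefined\<close> outside \<open>C\<close>, with the weak-* topology.
\<close>

definition gelfand_spectrum ::
    "('h::complex_hilbert_space \<Rightarrow>\<^sub>L 'h) set \<Rightarrow> (('h \<Rightarrow>\<^sub>L 'h) \<Rightarrow> complex) set"
  where "gelfand_spectrum C =
    {\<omega> \<in> extensional C.
       (\<forall>S\<in>C. \<forall>T\<in>C. \<omega> (S + T) = \<omega> S + \<omega> T \<and> \<omega> (S o\<^sub>L T) = \<omega> S * \<omega> T) \<and>
       (\<forall>c. \<forall>T\<in>C. \<omega> (scalar_op c o\<^sub>L T) = c * \<omega> T) \<and>
       (\<exists>T\<in>C. \<omega> T \<noteq> 0)}"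

definition gelfand_topology ::
    "('h::complex_hilbert_space \<Rightarrow>\<^sub>L 'h) set \<Rightarrow> (('h \<Rightarrow>\<^sub>L 'h) \<Rightarrow> complex) topology"
  where "gelfand_topology C =
    subtopology (product_topology (\<lambda>_. euclidean) C) (gelfand_spectrum C)"

definition spectral_presheaf ::
    "(('h::complex_hilbert_space \<Rightarrow>\<^sub>L 'h) set, ('h \<Rightarrow>\<^sub>L 'h) \<Rightarrow> complex) presheaf"
  where "spectral_presheaf =
    \<lparr>sections = gelfand_spectrum, restr = (\<lambda>C D \<omega>. restrict \<omega> D)\<rparr>"

definition spectral_topology ::
    "('h::complex_hilbert_space \<Rightarrow>\<^sub>L 'h) set \<Rightarrow>
     (('h \<Rightarrow>\<^sub>L 'h) set \<times> (('h \<Rightarrow>\<^sub>L 'h) \<Rightarrow> complex)) topology"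
  where "spectral_topology A = topology (\<lambda>U.
    etale_open (contexts A) spectral_presheaf U \<and>
    (\<forall>C\<in>contexts A. openin (gelfand_topology C) {\<omega>. (C, \<omega>) \<in> U}))"

lemma istopology_spectral:
  "istopology (\<lambda>U. etale_open (contexts A) spectral_presheaf U \<and>
    (\<forall>C\<in>contexts A. openin (gelfand_topology C) {\<omega>. (C, \<omega>) \<in> U}))"
proof -
  have Int: "{\<omega>. (C, \<omega>) \<in> U \<inter> V} = {\<omega>. (C, \<omega>) \<in> U} \<inter> {\<omega>. (C, \<omega>) \<in> V}"
    and Union: "{\<omega>. (C, \<omega>) \<in> \<Union>\<U>} = (\<Union>U\<in>\<U>. {\<omega>. (C, \<omega>) \<in> U})"
    for C :: "('a \<Rightarrow>\<^sub>L 'a) set" and U V :: "(('a \<Rightarrow>\<^sub>L 'a) set \<times> (('a \<Rightarrow>\<^sub>L 'a) \<Rightarrow> complex)) set" and \<U>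
    by auto
  show ?thesis
    unfolding istopology_def Int Union
    by (auto intro!: etale_open_Int etale_open_Union)
qed

definition order_reversing :: "'p::order set \<Rightarrow> ('p \<Rightarrow> real) set"
  where "order_reversing P = {s \<in> extensional P. antimono_on P s}"

definition lower_reals ::
    "('h::complex_hilbert_space \<Rightarrow>\<^sub>L 'h) set \<Rightarrow>
     (('h \<Rightarrow>\<^sub>L 'h) set, ('h \<Rightarrow>\<^sub>L 'h) set \<Rightarrow> real) presheaf"
  where "lower_reals A =
    \<lparr>sections = (\<lambda>C. order_reversing (down A C)), restr = (\<lambda>C D s. restrict s (down A D))\<rparr>"

definition lower_topology ::
    "('h::complex_hilbert_space \<Rightarrow>\<^sub>L 'h) set \<Rightarrow>
     (('h \<Rightarrow>\<^sub>L 'h) set \<times> (('h \<Rightarrow>\<^sub>L 'h) set \<Rightarrow> real)) topology"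
  where "lower_topology A = topology_generated_by
    {{(D, s). D \<in> down A C \<and> s \<in> order_reversing (down A D) \<and> s D > x} | x C. C \<in> contexts A}"

text \<open>
  Characters take real values on self-adjoint elements; \<^term>\<open>Re\<close> only adjusts the type.
\<close>

definition das_transformation ::
    "('h::complex_hilbert_space \<Rightarrow>\<^sub>L 'h) set \<Rightarrow> ('h \<Rightarrow>\<^sub>L 'h) \<Rightarrow>
     ('h \<Rightarrow>\<^sub>L 'h) set \<Rightarrow> (('h \<Rightarrow>\<^sub>L 'h) \<Rightarrow> complex) \<Rightarrow> ('h \<Rightarrow>\<^sub>L 'h) set \<Rightarrow> real"
  where "das_transformation A a C \<omega> = (\<lambda>D\<in>down A C. Re (\<omega> (outer_das a D)))"

end

theory Submission
  imports Defs
begin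

text \<open>
  Everything rests on the spectral theorem for a bounded self-adjoint operator \<open>a\<close>. For
  \<open>T \<ge> 0\<close> symmetric and \<open>r \<ge> 0\<close>, the vectors \<open>v\<close> with \<open>norm (T\<^sup>n v) \<le> r\<^sup>n norm v\<close> for all \<open>n\<close>
  form a closed subspace, because the sequence \<open>norm (T\<^sup>n v)\<close> is log-convex. Invariance under
  everything that commutes with \<open>T\<close> is immediate, so the projections onto these subspaces, for
  \<open>T = a + norm a\<close>, belong to every von Neumann algebra containing \<open>a\<close>, and they are the
  spectral resolution of \<open>a\<close>.

  For a von Neumann algebra \<open>M\<close>, the vectors whose orbit under the commutant of \<open>M\<close> stays in the
  range of \<open>e\<^sup>a\<^sub>x\<close> form the range of the largest projection in \<open>M\<close> below \<open>e\<^sup>a\<^sub>x\<close>. These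
  projections are again a spectral resolution, and the operator they integrate to is the least
  element of \<open>M\<close> above \<open>a\<close> in the spectral order, hence the outer daseinisation. It decreases
  as \<open>M\<close> grows.

  A character takes the values 0 and 1 on projections and is bounded by the norm, so it is real on
  self-adjoint elements and monotone for the spectral order by approximation with Riemann sums.
  Hence the preimage of a generator \<open>U\<^sub>x\<^sub>,\<^sub>C\<close> is etale open, and it is weak-* open on each fibre
  because it is given there by evaluation at a single operator.
\<close>


section \<open>Geometry of real Hilbert spaces\<close>

text \<open>\<open>adjoint_op\<close>, \<open>spectral_resolution\<close> and
  \<open>outer_das\<close> are definite descriptions, so each needs existence and uniqueness before
  it can be used. Uniqueness of the spectral resolution is hard to read off from Riemann-Stieltjes
  sums; \<open>spectral_bounds\<close> replaces the integral by inequalities on the range and on the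
  kernel of each \<open>e x\<close>, and these pin \<open>e\<close> down. The crux is the inequality
  on the kernel: \<open>T \<ge> r\<close> on the orthogonal complement of the spectral subspace for
  \<open>r\<close>. After scaling to \<open>r = 1\<close> the operators
  \<open>1 / (1 + T ^ (2 n))\<close> act as smooth cut-offs at 1; that they make a vector of this
  complement small is a weak compactness statement, obtained from nested closed convex sets. The
  analysis runs over the real inner product. Complex linearity is recovered from commutation: scalar
  multiplications commute with \<open>a\<close>, hence preserve its spectral subspaces. Projections
  are compared through their ranges, so that order, right continuity and the spectral order are all
  inclusions of closed subspaces, which survive when every range is cut down to
  \<open>M\<close>.\<close>

text \<open>Stands in for weak compactness: vectors of nearly minimal norm in \<open>K n\<close>
  form a Cauchy sequence. For a constant sequence of sets it yields the projection theorem.\<close>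

lemma nested_closed_convex:
  fixes K :: "nat \<Rightarrow> 'a::{real_inner,complete_space} set"
  assumes closed: "\<And>n. closed (K n)" and convex: "\<And>n. convex (K n)"
    and decr: "\<And>m n. m \<le> n \<Longrightarrow> K n \<subseteq> K m"
    and bounded: "\<And>n. \<exists>x\<in>K n. norm x \<le> B"
  obtains x where "\<And>n. x \<in> K n" and "\<And>y. (\<And>n. y \<in> K n) \<Longrightarrow> norm x \<le> norm y"
proof -
  define d where "d n = Inf ((\<lambda>x. (norm x)\<^sup>2) ` K n)" for n
  have bdd: "bdd_below ((\<lambda>x. (norm x)\<^sup>2) ` K n)" for n
    by (rule bdd_belowI[of _ 0]) auto
  have ne: "K n \<noteq> {}" for n
    using bounded[of n] by auto
  have d_le: "d n \<le> (norm x)\<^sup>2" if "x \<in> K n" for x n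
    unfolding d_def by (rule cInf_lower) (use that bdd in auto)
  have d_bound: "d n \<le> B\<^sup>2" for n
  proof -
    obtain x where x: "x \<in> K n" "norm x \<le> B"
      using bounded by blast
    have "(norm x)\<^sup>2 \<le> B\<^sup>2"
      using x(2) by (intro power_mono) auto
    with d_le[OF x(1)] show ?thesis by linarith
  qed
  have d_mono: "d m \<le> d n" if "m \<le> n" for m n
    unfolding d_def by (rule cInf_superset_mono) (use ne bdd decr[OF that] in auto)
  define r where "r n = 1 / real (Suc n)" for n
  have r_pos: "r n > 0" for n
    by (simp add: r_def)
  have "\<exists>x. \<forall>n. x n \<in> K n \<and> (norm (x n))\<^sup>2 < d n + r n"
  proof (rule choice, rule allI)
    fix n
    have "Inf ((\<lambda>x. (norm x)\<^sup>2) ` K n) < d n + r n"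
      using r_pos[of n] unfolding d_def by simp
    then show "\<exists>x. x \<in> K n \<and> (norm x)\<^sup>2 < d n + r n"
      using cInf_less_iff[of "(\<lambda>x. (norm x)\<^sup>2) ` K n"] ne bdd by auto
  qed
  then obtain x where x: "\<And>n. x n \<in> K n" and x_less: "\<And>n. (norm (x n))\<^sup>2 < d n + r n"
    by blast
  \<comment> \<open>Parallelogram law; the midpoint of \<open>x m\<close> and \<open>x n\<close>
    lies in \<open>K m\<close>, so its squared norm is at least \<open>d m\<close>.\<close>
  have dist: "(norm (x m - x n))\<^sup>2 \<le> 2 * (d n - d m) + 2 * r m + 2 * r n" if "m \<le> n" for m n
  proof -
    have "x n \<in> K m"
      using x decr[OF that] by blast
    then have "(1/2) *\<^sub>R x m + (1/2) *\<^sub>R x n \<in> K m"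
      using convexD[OF convex[of m] x[of m], of "x n" "1/2" "1/2"] by simp
    from d_le[OF this] have "d m \<le> (norm ((1/2) *\<^sub>R (x m + x n)))\<^sup>2"
      by (simp add: scaleR_add_right)
    then have mid: "4 * d m \<le> (norm (x m + x n))\<^sup>2"
      by (simp add: power2_eq_square)
    have "(norm (x m - x n))\<^sup>2 = 2 * (norm (x m))\<^sup>2 + 2 * (norm (x n))\<^sup>2 - (norm (x m + x n))\<^sup>2"
      by (simp add: power2_norm_eq_inner inner_simps inner_commute)
    also have "\<dots> \<le> 2 * (d m + r m) + 2 * (d n + r n) - 4 * d m"
      using mid x_less[of m] x_less[of n] unfolding distrib_left by linarith
    finally show ?thesis by (simp add: algebra_simps)
  qed
  have "norm (d n) \<le> \<bar>d 0\<bar> + B\<^sup>2" for n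
    using d_bound[of n] d_mono[OF le0, of n] zero_le_power2[of B]
    unfolding real_norm_def by (intro abs_leI) linarith+
  then have "convergent d"
    using d_mono by (intro Bseq_mono_convergent BseqI') blast+
  then have Cd: "Cauchy d"
    by (simp add: Cauchy_convergent_iff)
  have "Cauchy x"
  proof (rule metric_CauchyI)
    fix e :: real assume "e > 0"
    \<comment> \<open>Each of the three terms in \<open>dist\<close> will be below a quarter of the
      squared tolerance.\<close>
    then have e: "e\<^sup>2 / 8 > 0" by simp
    obtain M where M: "\<And>m n. m \<ge> M \<Longrightarrow> n \<ge> M \<Longrightarrow> dist (d m) (d n) < e\<^sup>2 / 8"
      using metric_CauchyD[OF Cd e] by blast
    obtain N where N: "1 / real (Suc N) < e\<^sup>2 / 8"
      using nat_approx_posE[OF e] by metis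
    have half: "dist (x m) (x n) < e" if "m \<ge> max M N" "m \<le> n" for m n
    proof -
      have "r m \<le> 1 / Suc N" "r n \<le> 1 / Suc N"
        using that by (auto simp: field_simps r_def)
      moreover have "\<bar>d m - d n\<bar> < e\<^sup>2 / 8"
        using M[of m n] that by (simp add: dist_real_def)
      then have "d n - d m < e\<^sup>2 / 8"
        by linarith
      ultimately have "(norm (x m - x n))\<^sup>2 < e\<^sup>2"
        using dist[OF that(2)] N e unfolding right_diff_distrib by linarith
      then show ?thesis
        using \<open>e > 0\<close> using power2_less_imp_less[of "norm (x m - x n)" e] by (simp add: dist_norm)
    qed
    show "\<exists>M. \<forall>m\<ge>M. \<forall>n\<ge>M. dist (x m) (x n) < e"
    proof (intro exI allI impI)
      fix m n assume "m \<ge> max M N" "n \<ge> max M N"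
      then show "dist (x m) (x n) < e"
        using half[of m n] half[of n m] by (cases "m \<le> n") (auto simp: dist_commute)
    qed
  qed
  then obtain l where l: "x \<longlonglongrightarrow> l"
    using Cauchy_convergent convergent_def by blast
  show thesis
  proof
    show "l \<in> K n" for n
    proof (rule closed_sequentially[OF closed])
      show "x (k + n) \<in> K n" for k
        using x[of "k + n"] decr[of n "k + n"] by auto
      show "(\<lambda>k. x (k + n)) \<longlonglongrightarrow> l"
        using l by (rule LIMSEQ_ignore_initial_segment)
    qed
    fix y assume y: "\<And>n. y \<in> K n"
    have "(norm l)\<^sup>2 \<le> (norm y)\<^sup>2 + 0"
    proof (rule LIMSEQ_le)
      show "(\<lambda>n. (norm (x n))\<^sup>2) \<longlonglongrightarrow> (norm l)\<^sup>2"
        by (intro tendsto_intros l)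
      show "(\<lambda>n. (norm y)\<^sup>2 + r n) \<longlonglongrightarrow> (norm y)\<^sup>2 + 0"
        using LIMSEQ_inverse_real_of_nat unfolding r_def by (intro tendsto_intros) (simp add: inverse_eq_divide)
      show "\<exists>N. \<forall>n\<ge>N. (norm (x n))\<^sup>2 \<le> (norm y)\<^sup>2 + r n"
      proof (intro exI allI impI)
        show "(norm (x n))\<^sup>2 \<le> (norm y)\<^sup>2 + r n" for n
          using x_less[of n] d_le[OF y, of n] by linarith
      qed
    qed
    then show "norm l \<le> norm y"
      using power2_le_imp_le[of "norm l" "norm y"] by simp
  qed
qed

text \<open>\<open>y\<close> makes \<open>x - y\<close> a vector of minimal norm in the coset of
  \<open>x\<close>. Moving along \<open>z\<close> by the optimal multiple \<open>t\<close> cannot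
  shorten it further, which forces orthogonality.\<close>

lemma orthogonal_decomposition:
  fixes V :: "'a::{real_inner,complete_space} set"
  assumes "closed V" "subspace V"
  obtains y where "y \<in> V" and "\<And>z. z \<in> V \<Longrightarrow> inner (x - y) z = 0"
proof -
  let ?K = "(\<lambda>y. x - y) ` V"
  have K: "?K = (\<lambda>z. x + z) ` V"
    using subspace_neg[OF assms(2)] by (force simp: image_iff)
  have 1: "closed ?K"
    unfolding K using assms(1) by (rule closed_translation)
  have 2: "convex ?K"
    unfolding K using subspace_imp_convex[OF assms(2)] by (rule convex_translation)
  have 3: "\<exists>z\<in>?K. norm z \<le> norm x"
    using subspace_0[OF assms(2)] by force
  obtain w where w: "w \<in> ?K" and min: "\<And>y. y \<in> ?K \<Longrightarrow> norm w \<le> norm y"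
    by (rule nested_closed_convex[of "\<lambda>_. ?K", OF 1 2 order_refl 3]) blast
  from w obtain y where y: "y \<in> V" "w = x - y" by auto
  show thesis
  proof
    show "y \<in> V" by fact
    fix z assume z: "z \<in> V"
    show "inner (x - y) z = 0"
    proof (cases "z = 0")
      case False
      define t where "t = inner w z / inner z z"
      have "y + t *\<^sub>R z \<in> V"
        using y z assms(2) by (simp add: subspace_add subspace_scale)
      then have "norm w \<le> norm (w - t *\<^sub>R z)"
        by (intro min) (auto simp: y(2) algebra_simps intro!: image_eqI)
      then have "inner w w \<le> inner (w - t *\<^sub>R z) (w - t *\<^sub>R z)"
        by (simp add: norm_le)
      also have "\<dots> = inner w w - (inner w z)\<^sup>2 / inner z z"
        using False by (simp add: t_def inner_simps inner_commute power2_eq_square)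
      finally have "(inner w z)\<^sup>2 / inner z z \<le> 0" by simp
      then have "inner w z = 0"
        using False by (simp add: divide_le_0_iff)
          (metis inner_gt_zero_iff not_le)
      then show ?thesis by (simp add: y)
    qed simp
  qed
qed

lemma Riesz_representation:
  fixes f :: "'a::{real_inner,complete_space} \<Rightarrow> real"
  assumes "bounded_linear f"
  obtains v where "\<And>x. f x = inner v x"
proof (cases "\<forall>x. f x = 0")
  case True
  then show thesis using that[of 0] by simp
next
  case False
  then obtain x where x: "f x \<noteq> 0" by blast
  interpret f: bounded_linear f by fact
  have "subspace {y. f y = 0}"
    by (auto simp: subspace_def f.add f.scale f.zero)
  moreover have "closed {y. f y = 0}"
    by (intro closed_Collect_eq f.continuous_on continuous_intros)
  ultimately obtain y where y: "f y = 0" and orth: "\<And>z. f z = 0 \<Longrightarrow> inner (x - y) z = 0"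
    using orthogonal_decomposition[of "{y. f y = 0}" x] by auto
  define w where "w = x - y"
  have fw: "f w \<noteq> 0"
    using x y by (simp add: w_def f.diff)
  then have "w \<noteq> 0"
    using f.zero by auto
  show thesis
  proof (rule that)
    fix z
    have "f (z - (f z / f w) *\<^sub>R w) = 0"
      using fw by (simp add: f.diff f.scale)
    from orth[OF this] have "inner w z = (f z / f w) * inner w w"
      by (simp add: w_def[symmetric] inner_simps)
    then show "f z = inner ((f w / inner w w) *\<^sub>R w) z"
      using fw \<open>w \<noteq> 0\<close> by simp
  qed
qed

text \<open>Only the real inner product enters; \<open>cinner_adjoint\<close> shows that for
  complex-linear \<open>T\<close> the same operator is the complex adjoint.\<close>

lemma adjoint_exists:
  fixes T :: "'a::{real_inner,complete_space} \<Rightarrow>\<^sub>L 'a"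
  obtains S :: "'a \<Rightarrow>\<^sub>L 'a" where "\<And>x y. inner (S x) y = inner x (T y)"
proof -
  have "\<exists>v. \<forall>y. inner x (T y) = inner v y" for x
  proof -
    have "bounded_linear (\<lambda>y. inner x (T y))"
      by (intro bounded_linear_intros)
    from Riesz_representation[OF this] show ?thesis by blast
  qed
  then obtain S where S: "\<And>x y. inner (S x) y = inner x (T y)"
    by metis
  have "bounded_linear S"
  proof (rule bounded_linear_intro)
    show "S (x + y) = S x + S y" for x y
      by (rule vector_eq_rdot[THEN iffD1]) (simp add: S inner_simps)
    show "S (r *\<^sub>R x) = r *\<^sub>R S x" for r x
      by (rule vector_eq_rdot[THEN iffD1]) (simp add: S inner_simps)
    show "norm (S x) \<le> norm x * norm T" for x
    proof (cases "S x = 0")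
      case False
      have "norm (S x) * norm (S x) = inner x (T (S x))"
        using S[of x "S x"] by (metis power2_norm_eq_inner power2_eq_square)
      also have "\<dots> \<le> norm x * (norm T * norm (S x))"
        by (meson norm_blinfun norm_cauchy_schwarz order_trans mult_left_mono norm_ge_zero)
      finally show ?thesis using False by simp
    qed simp
  qed
  then show thesis
    using that[of "Blinfun S"] S by (simp add: bounded_linear_Blinfun_apply)
qed

text \<open>The Lax-Milgram argument: coercivity bounds \<open>R\<close> from below, so its range is
  closed, and a vector \<open>w\<close> orthogonal to the range vanishes because it is orthogonal to
  \<open>R w\<close>. Applied to \<open>1 + T ^ (2 n)\<close> and to
  \<open>1 - T / \<omega> T\<close>.\<close>

lemma coercive_inverse:
  fixes R :: "'a::{real_inner,complete_space} \<Rightarrow>\<^sub>L 'a"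
  assumes "c > 0" and coercive: "\<And>x. c * (norm x)\<^sup>2 \<le> inner x (R x)"
  obtains Q :: "'a \<Rightarrow>\<^sub>L 'a" where "\<And>x. Q (R x) = x" and "\<And>x. R (Q x) = x"
proof -
  have below: "c * norm x \<le> norm (R x)" for x
  proof (cases "x = 0")
    case False
    have "norm x * (c * norm x) = c * (norm x)\<^sup>2"
      by (simp add: power2_eq_square)
    also have "\<dots> \<le> norm x * norm (R x)"
      using coercive norm_cauchy_schwarz by (rule order_trans)
    finally show ?thesis using False by simp
  qed simp
  have "complete (range R)"
    using \<open>c > 0\<close> below
    by (intro complete_isometric_image[of c]) (auto simp: blinfun.bounded_linear_right complete_UNIV)
  then have "closed (range R)"
    by (rule complete_imp_closed)
  moreover have "subspace (range R)"
    by (intro linear_subspace_image subspace_UNIV)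
      (simp add: blinfun.bounded_linear_right bounded_linear.linear)
  ultimately have surj: "\<exists>x. R x = y" for y
  proof -
    obtain z where z: "z \<in> range R" and orth: "\<And>w. w \<in> range R \<Longrightarrow> inner (y - z) w = 0"
      using orthogonal_decomposition \<open>closed _\<close> \<open>subspace _\<close> by metis
    have "c * (norm (y - z))\<^sup>2 \<le> 0"
      using coercive[of "y - z"] orth by simp
    then have "y = z"
      using \<open>c > 0\<close> by (simp add: mult_le_0_iff)
    with z show ?thesis by auto
  qed
  have inj: "x = y" if "R x = R y" for x y
    using below[of "x - y"] that \<open>c > 0\<close> by (simp add: blinfun.diff_right mult_le_0_iff)
  obtain Q where Q: "\<And>y. R (Q y) = y"
    using surj by metis
  have "bounded_linear Q"
  proof (rule bounded_linear_intro)
    show "Q (x + y) = Q x + Q y" for x y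
      by (rule inj) (simp add: Q blinfun.add_right)
    show "Q (r *\<^sub>R x) = r *\<^sub>R Q x" for r x
      by (rule inj) (simp add: Q blinfun.scaleR_right)
    show "norm (Q x) \<le> norm x * (1 / c)" for x
      using below[of "Q x"] \<open>c > 0\<close> by (simp add: Q field_simps)
  qed
  then show thesis
    using that[of "Blinfun Q"] Q inj by (metis bounded_linear_Blinfun_apply)
qed

definition symmetric_op :: "('a::real_inner \<Rightarrow>\<^sub>L 'a) \<Rightarrow> bool"
  where "symmetric_op T \<longleftrightarrow> (\<forall>x y. inner (T x) y = inner x (T y))"

lemma symmetric_opD: "symmetric_op T \<Longrightarrow> inner (T x) y = inner x (T y)"
  by (simp add: symmetric_op_def)

text \<open>By polarisation of the form at \<open>x\<close> and the multiple of \<open>T x\<close> that has the norm of \<open>x\<close>.\<close>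

lemma norm_le_quadratic_form:
  fixes T :: "'a::real_inner \<Rightarrow>\<^sub>L 'a"
  assumes T: "symmetric_op T" and V: "subspace V" "\<And>x. x \<in> V \<Longrightarrow> T x \<in> V"
    and form: "\<And>x. x \<in> V \<Longrightarrow> \<bar>inner (T x) x\<bar> \<le> c * (norm x)\<^sup>2" and "x \<in> V"
  shows "norm (T x) \<le> c * norm x"
proof (cases "T x = 0")
  case True
  show ?thesis
  proof (cases "x = 0")
    case False
    then have "c \<ge> 0"
      using form[OF \<open>x \<in> V\<close>] True by (simp add: zero_le_mult_iff)
    then show ?thesis using True by simp
  qed simp
next
  case False
  then have "x \<noteq> 0" by auto
  define y where "y = (norm x / norm (T x)) *\<^sub>R T x"
  have y: "y \<in> V"
    using V \<open>x \<in> V\<close> by (simp add: y_def subspace_scale)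
  have ny: "norm y = norm x"
    using False by (simp add: y_def)
  have "inner (T x) y = norm x * norm (T x)"
    using False by (simp add: y_def power2_norm_eq_inner[symmetric] power2_eq_square)
  then have "4 * (norm x * norm (T x)) = inner (T (x + y)) (x + y) - inner (T (x - y)) (x - y)"
    using symmetric_opD[OF T, of y x]
    by (simp add: blinfun.add_right blinfun.diff_right inner_simps inner_commute)
  also have "\<dots> \<le> c * (norm (x + y))\<^sup>2 + c * (norm (x - y))\<^sup>2"
    using form[of "x + y"] form[of "x - y"] V \<open>x \<in> V\<close> y
    by (simp add: subspace_add subspace_diff abs_le_iff)
  also have "\<dots> = c * (2 * (norm x)\<^sup>2 + 2 * (norm y)\<^sup>2)"
    by (simp add: power2_norm_eq_inner inner_simps inner_commute algebra_simps)
  also have "\<dots> = 4 * (norm x * (c * norm x))"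
    by (simp add: ny power2_eq_square algebra_simps)
  finally show ?thesis
    using \<open>x \<noteq> 0\<close> by simp
qed


section \<open>Log-convex sequences\<close>

definition log_convex :: "(nat \<Rightarrow> real) \<Rightarrow> bool"
  where "log_convex s \<longleftrightarrow> (\<forall>n. 0 \<le> s n \<and> (s (Suc n))\<^sup>2 \<le> s n * s (Suc (Suc n)))"

lemma log_convexD:
  assumes "log_convex s"
  shows "0 \<le> s n" "(s (Suc n))\<^sup>2 \<le> s n * s (Suc (Suc n))"
  using assms by (auto simp: log_convex_def)

lemma log_convex_divide_power:
  assumes "log_convex s" "q > 0"
  shows "log_convex (\<lambda>n. s n / q ^ n)"
  unfolding log_convex_def
proof (intro allI conjI)
  fix n
  show "0 \<le> s n / q ^ n"
    using assms by (simp add: log_convexD)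
  have "(s (Suc n) / q ^ Suc n)\<^sup>2 = (s (Suc n))\<^sup>2 / (q ^ n * q ^ Suc (Suc n))"
    by (simp add: power_divide power2_eq_square)
  also have "\<dots> \<le> s n * s (Suc (Suc n)) / (q ^ n * q ^ Suc (Suc n))"
    using assms(2) log_convexD(2)[OF assms(1), of n] by (intro divide_right_mono) auto
  finally show "(s (Suc n) / q ^ Suc n)\<^sup>2 \<le> s n / q ^ n * (s (Suc (Suc n)) / q ^ Suc (Suc n))"
    by simp
qed

text \<open>The quotients \<open>s (Suc n) / s n\<close> cannot decrease where they are defined, so
  one quotient below 1 forces all earlier ones below 1; hence the downward induction.\<close>

lemma log_convex_less:
  assumes s: "log_convex s" and "s (Suc n) < s n" "k \<le> n"
  shows "s (Suc k) < s k"
  using \<open>k \<le> n\<close>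
proof (induction rule: inc_induct)
  case base
  show ?case by fact
next
  case (step k)
  have pos: "0 < s (Suc k)"
    using step.IH log_convexD(1)[OF s, of "Suc (Suc k)"] by linarith
  have "s (Suc k) * s (Suc k) \<le> s k * s (Suc (Suc k))"
    using log_convexD(2)[OF s, of k] by (simp add: power2_eq_square)
  moreover have "s k \<noteq> 0"
    using calculation pos by (auto simp: mult_le_0_iff)
  then have "s k > 0"
    using log_convexD(1)[OF s, of k] by simp
  ultimately have "s (Suc k) * s (Suc k) < s k * s (Suc k)"
    using step.IH by (smt (verit) mult_strict_left_mono)
  then show ?case using pos by simp
qed

text \<open>A descent at \<open>n\<close> would by \<open>log_convex_less\<close> be a descent at
  every earlier index, leaving \<open>s n\<close> strictly below \<open>s 0\<close> because
  \<open>n > 0\<close>.\<close>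

lemma log_convex_le_Suc:
  assumes s: "log_convex s" and "s 0 \<le> s n" "n > 0"
  shows "s n \<le> s (Suc n)"
proof (rule ccontr)
  assume "\<not> ?thesis"
  then have less: "s (Suc k) < s k" if "k \<le> n" for k
    using log_convex_less[OF s _ that] by simp
  have "s k < s 0" if "0 < k" "k \<le> n" for k
    using that
  proof (induction k)
    case (Suc k)
    then show ?case
      using less[of k] by (cases "k = 0") auto
  qed simp
  from this[of n] show False using assms by simp
qed

lemma log_convex_le_mono:
  assumes s: "log_convex s" and "s 0 \<le> s n" "n > 0" "n \<le> m"
  shows "s n \<le> s m"
  using \<open>n \<le> m\<close>
proof (induction rule: dec_induct)
  case (step m)
  then show ?case
    using log_convex_le_Suc[OF s, of m] assms by linarith
qed simp

lemma log_convex_le_max: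
  assumes s: "log_convex s" and "k \<le> n"
  shows "s k \<le> max (s 0) (s n)"
  using log_convex_le_mono[OF s, of k n] assms by (cases "k = 0"; cases "s 0 \<le> s k") (auto simp: le_max_iff_disj)

text \<open>An arbitrary constant \<open>C\<close> improves to \<open>s 0\<close>. Dividing by
  \<open>q ^ n\<close> with \<open>q\<close> slightly above \<open>r\<close> keeps log-convexity; a
  quotient above the initial one could never decay again, yet the quotients are bounded by
  \<open>C * (r / q) ^ m\<close>.\<close>

lemma log_convex_geometric_bound:
  assumes s: "log_convex s" and "r \<ge> 0" and bound: "\<And>n. s n \<le> C * r ^ n"
  shows "s n \<le> r ^ n * s 0"
proof (rule ccontr)
  assume less: "\<not> ?thesis"
  then have "n > 0" by (cases n) auto
  have "(\<lambda>q. q ^ n * s 0) \<midarrow>r\<rightarrow> r ^ n * s 0"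
    by (intro tendsto_intros)
  then have "((\<lambda>q. q ^ n * s 0) \<longlongrightarrow> r ^ n * s 0) (at_right r)"
    by (rule tendsto_within_subset) simp
  then have "\<forall>\<^sub>F q in at_right r. q ^ n * s 0 < s n"
    using less by (intro order_tendstoD) auto
  then obtain q where q: "q > r" "q ^ n * s 0 < s n"
    using eventually_happens'[OF _ eventually_conj[OF _ eventually_at_right_less]]
    by (metis trivial_limit_at_right_real)
  then have "q > 0" using \<open>r \<ge> 0\<close> by simp
  let ?t = "\<lambda>n. s n / q ^ n"
  have t: "log_convex ?t"
    using s \<open>q > 0\<close> by (rule log_convex_divide_power)
  have tn: "?t 0 < ?t n"
    using q \<open>q > 0\<close> by (simp add: field_simps)
  have "(\<lambda>m. C * (r / q) ^ m) \<longlonglongrightarrow> C * 0"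
    using q \<open>r \<ge> 0\<close> by (intro tendsto_intros LIMSEQ_power_zero) auto
  moreover have "?t n \<le> C * (r / q) ^ m" if "m \<ge> n" for m
  proof -
    have "?t n \<le> ?t m"
      using log_convex_le_mono[OF t less_imp_le[OF tn] \<open>n > 0\<close> that] .
    also have "\<dots> \<le> C * r ^ m / q ^ m"
      using bound[of m] \<open>q > 0\<close> by (simp add: divide_right_mono)
    finally show ?thesis by (simp add: power_divide)
  qed
  ultimately have "?t n \<le> C * 0"
    by (intro LIMSEQ_le_const) blast+
  then show False
    using tn log_convexD(1)[OF t, of 0] by simp
qed


section \<open>Spectral subspaces of a positive operator\<close>

text \<open>For symmetric \<open>T\<close> and \<open>r \<ge> 0\<close> this is the range of the
  spectral projection for \<open>[- r, r]\<close>, which for \<open>T \<ge> 0\<close> is that for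
  \<open>[0, r]\<close>. For negative \<open>r\<close> the condition at \<open>n = 1\<close> leaves
  only 0.\<close>

definition spectral_subspace :: "('a::real_inner \<Rightarrow>\<^sub>L 'a) \<Rightarrow> real \<Rightarrow> 'a set"
  where "spectral_subspace T r = {v. \<forall>n. norm ((blinfun_apply T ^^ n) v) \<le> r ^ n * norm v}"

lemma funpow_blinfun_add:
  fixes T :: "'a::real_normed_vector \<Rightarrow>\<^sub>L 'a"
  shows "(blinfun_apply T ^^ n) (v + w) = (blinfun_apply T ^^ n) v + (blinfun_apply T ^^ n) w"
  by (induction n) (auto simp: blinfun.add_right)

lemma funpow_blinfun_scaleR:
  fixes T :: "'a::real_normed_vector \<Rightarrow>\<^sub>L 'a"
  shows "(blinfun_apply T ^^ n) (c *\<^sub>R v) = c *\<^sub>R (blinfun_apply T ^^ n) v"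
  by (induction n) (auto simp: blinfun.scaleR_right)

lemma continuous_on_funpow_blinfun:
  fixes T :: "'a::real_normed_vector \<Rightarrow>\<^sub>L 'a"
  shows "continuous_on A (blinfun_apply T ^^ n)"
proof (induction n)
  case (Suc n)
  have "continuous_on A (\<lambda>v. T ((blinfun_apply T ^^ n) v))"
    by (intro continuous_intros Suc)
  then show ?case by (simp add: o_def)
qed (simp add: id_def)

lemma funpow_blinfun_commute:
  fixes T :: "'a::real_normed_vector \<Rightarrow>\<^sub>L 'a"
  assumes "\<And>v. S (blinfun_apply T v) = blinfun_apply T (S v)"
  shows "S ((blinfun_apply T ^^ n) v) = (blinfun_apply T ^^ n) (S v)"
  by (induction n) (simp_all add: assms)

lemma symmetric_funpow:
  assumes "symmetric_op T"
  shows "inner ((blinfun_apply T ^^ n) x) y = inner x ((blinfun_apply T ^^ n) y)"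
  by (induction n arbitrary: x y)
    (auto simp: symmetric_opD[OF assms] simp flip: funpow_swap1)

lemma log_convex_norm_funpow:
  assumes "symmetric_op T"
  shows "log_convex (\<lambda>n. norm ((blinfun_apply T ^^ n) v))"
  unfolding log_convex_def
proof (intro allI conjI)
  fix n
  let ?w = "(blinfun_apply T ^^ n) v"
  have "(norm (T ?w))\<^sup>2 = inner ?w (T (T ?w))"
    by (simp add: power2_norm_eq_inner symmetric_opD[OF assms])
  also have "\<dots> \<le> norm ?w * norm (T (T ?w))"
    by (rule norm_cauchy_schwarz)
  finally show "(norm ((blinfun_apply T ^^ Suc n) v))\<^sup>2
      \<le> norm ?w * norm ((blinfun_apply T ^^ Suc (Suc n)) v)"
    by simp
qed simp

lemma positive_op_Cauchy_Schwarz: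
  assumes "symmetric_op T" and pos: "\<And>x. 0 \<le> inner (T x) x"
  shows "(inner (T x) y)\<^sup>2 \<le> inner (T x) x * inner (T y) y"
proof -
  let ?a = "inner (T y) y" and ?b = "inner (T x) y" and ?c = "inner (T x) x"
  have form: "0 \<le> ?c + 2 * t * ?b + t\<^sup>2 * ?a" for t
    using pos[of "x + t *\<^sub>R y"] symmetric_opD[OF assms(1), of y x]
    by (simp add: blinfun.add_right blinfun.scaleR_right inner_simps inner_commute
        power2_eq_square algebra_simps)
  show ?thesis
  proof (cases "?a = 0")
    case True
    have "?b = 0"
    proof (rule ccontr)
      assume "?b \<noteq> 0"
      \<comment> \<open>With \<open>?a = 0\<close> the form is affine in \<open>t\<close>; this
        \<open>t\<close> gives it the value -1.\<close>
      then show False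
        using form[of "- (?c + 1) / (2 * ?b)"] True by (simp add: field_simps)
    qed
    then show ?thesis using True by simp
  next
    case False
    then have "?a > 0" using pos[of y] by simp
    have "0 \<le> ?c - ?b\<^sup>2 / ?a"
      using form[of "- ?b / ?a"] False by (simp add: field_simps power2_eq_square)
    then show ?thesis
      using \<open>?a > 0\<close> by (simp add: field_simps)
  qed
qed

text \<open>Three consecutive moments starting at an even index obey Cauchy-Schwarz for the inner
  product; starting at an odd index they obey it for the form of \<open>T\<close>, which requires
  positivity.\<close>

lemma log_convex_inner_funpow:
  assumes T: "symmetric_op T" and pos: "\<And>x. 0 \<le> inner (T x) x"
  shows "log_convex (\<lambda>n. inner ((blinfun_apply T ^^ n) v) v)"
proof -
  let ?P = "\<lambda>n. (blinfun_apply T ^^ n)"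
  have add: "inner (?P (m + n) v) v = inner (?P m v) (?P n v)" for m n
    using symmetric_funpow[OF T, of n "?P m v" v]
    by (simp add: funpow_add[of n m, simplified add.commute])
  have even: "inner (?P (m + m) v) v = (norm (?P m v))\<^sup>2" for m
    by (simp add: add power2_norm_eq_inner)
  have odd: "inner (?P (Suc (m + m)) v) v = inner (T (?P m v)) (?P m v)" for m
    using add[of "Suc m" m] by simp
  have ev_or: "(\<exists>m. n = m + m) \<or> (\<exists>m. n = Suc (m + m))" for n
    by presburger
  show ?thesis
    unfolding log_convex_def
  proof (intro allI conjI)
    fix n
    show "0 \<le> inner (?P n v) v"
      using ev_or[of n] even odd pos by auto
    show "(inner (?P (Suc n) v) v)\<^sup>2 \<le> inner (?P n v) v * inner (?P (Suc (Suc n)) v) v"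
      using ev_or[of n]
    proof (elim disjE exE)
      fix m assume n: "n = m + m"
      have "Suc (Suc n) = Suc m + Suc m" by (simp add: n)
      moreover have "(inner (T (?P m v)) (?P m v))\<^sup>2 \<le> (norm (T (?P m v)) * norm (?P m v))\<^sup>2"
        by (simp add: power_mono abs_le_square_iff[symmetric] abs_mult Cauchy_Schwarz_ineq2)
      ultimately show ?thesis
        by (simp only: n even odd) (simp add: power_mult_distrib mult.commute)
    next
      fix m assume n: "n = Suc (m + m)"
      have "Suc n = Suc m + Suc m" "Suc (Suc n) = Suc (Suc m + Suc m)" by (simp_all add: n)
      then show ?thesis
        using positive_op_Cauchy_Schwarz[OF T pos, of "?P m v" "T (?P m v)"]
        by (simp only: n even odd power2_norm_eq_inner) (simp add: power2_eq_square)
    qed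
  qed
qed

lemma spectral_subspace_neg:
  assumes "r < 0"
  shows "spectral_subspace T r = {0}"
proof -
  have "v = 0" if "v \<in> spectral_subspace T r" for v
  proof -
    have "0 \<le> r * norm v"
      using that[unfolded spectral_subspace_def] norm_ge_zero[of "T v"]
      by (metis (mono_tags, lifting) funpow_0 funpow_simps_right(2) mem_Collect_eq o_apply
          order_trans power_one_right One_nat_def)
    then show ?thesis using assms by (simp add: zero_le_mult_iff)
  qed
  moreover have "0 \<in> spectral_subspace T r"
    using funpow_blinfun_scaleR[of _ T 0 0] by (simp add: spectral_subspace_def)
  ultimately show ?thesis by blast
qed

text \<open>By \<open>log_convex_geometric_bound\<close> the constant is free. This is why the
  spectral subspace is closed under sums and under operators commuting with \<open>T\<close>,
  although the defining bound carries the constant \<open>norm v\<close>.\<close>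

lemma spectral_subspaceI:
  assumes "symmetric_op T" "r \<ge> 0" "\<And>n. norm ((blinfun_apply T ^^ n) v) \<le> C * r ^ n"
  shows "v \<in> spectral_subspace T r"
  using log_convex_geometric_bound[OF log_convex_norm_funpow[OF assms(1)] assms(2,3)]
  by (simp add: spectral_subspace_def)

lemma spectral_subspaceD:
  "v \<in> spectral_subspace T r \<Longrightarrow> norm ((blinfun_apply T ^^ n) v) \<le> r ^ n * norm v"
  by (simp add: spectral_subspace_def)

lemma closed_spectral_subspace: "closed (spectral_subspace T r)"
  unfolding spectral_subspace_def
  by (intro closed_Collect_all closed_Collect_le continuous_intros continuous_on_funpow_blinfun)

lemma subspace_spectral_subspace:
  assumes T: "symmetric_op T"
  shows "subspace (spectral_subspace T r)"
proof (cases "r < 0")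
  case False
  then have r: "r \<ge> 0" by simp
  have "v + w \<in> spectral_subspace T r"
    if "v \<in> spectral_subspace T r" "w \<in> spectral_subspace T r" for v w
  proof (rule spectral_subspaceI[OF T r])
    fix n
    show "norm ((blinfun_apply T ^^ n) (v + w)) \<le> (norm v + norm w) * r ^ n"
      using spectral_subspaceD[OF that(1), of n] spectral_subspaceD[OF that(2), of n]
      by (simp add: funpow_blinfun_add algebra_simps norm_triangle_le)
  qed
  moreover have "c *\<^sub>R v \<in> spectral_subspace T r" if "v \<in> spectral_subspace T r" for c v
    using that by (simp add: spectral_subspace_def funpow_blinfun_scaleR mult.left_commute mult_left_mono)
  moreover have "0 \<in> spectral_subspace T r"
    using funpow_blinfun_scaleR[of _ T 0 0] by (simp add: spectral_subspace_def)
  ultimately show ?thesis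
    by (simp add: subspace_def)
qed (simp add: spectral_subspace_neg)

lemma spectral_subspace_invariant:
  assumes T: "symmetric_op T" and comm: "\<And>v. blinfun_apply S (blinfun_apply T v) = T (S v)"
    and v: "v \<in> spectral_subspace T r"
  shows "S v \<in> spectral_subspace T r"
proof (cases "r < 0")
  case False
  show ?thesis
  proof (rule spectral_subspaceI[OF T])
    fix n
    have "norm ((blinfun_apply T ^^ n) (S v)) \<le> norm S * norm ((blinfun_apply T ^^ n) v)"
      by (simp add: norm_blinfun flip: funpow_blinfun_commute[of S T, OF comm])
    also have "\<dots> \<le> norm S * (r ^ n * norm v)"
      by (intro mult_left_mono spectral_subspaceD v) simp
    finally show "norm ((blinfun_apply T ^^ n) (S v)) \<le> (norm S * norm v) * r ^ n"
      by (simp add: algebra_simps)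
  qed (use False in simp)
next
  case True
  then show ?thesis using v by (simp add: spectral_subspace_neg)
qed

lemma bounded_linear_funpow_blinfun:
  fixes T :: "'a::real_normed_vector \<Rightarrow>\<^sub>L 'a"
  shows "bounded_linear (blinfun_apply T ^^ n)"
proof (induction n)
  case (Suc n)
  show ?case
    using bounded_linear_compose[OF blinfun.bounded_linear_right Suc] by (simp add: o_def)
qed (simp add: id_def bounded_linear_ident)

text \<open>
  The vectors \<open>u = (1 + T\<^sup>2\<^sup>n)\<inverse> v\<close> satisfy \<open>norm (T\<^sup>k u) \<le> norm v\<close> for \<open>k \<le> n\<close>. If they did
  not become small, the nested sets of such vectors would have a common point, which
  lies in the spectral subspace although it is not orthogonal to \<open>v\<close>.
\<close>

lemma damped_vector_small:
  fixes T :: "'a::{real_inner,complete_space} \<Rightarrow>\<^sub>L 'a"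
  assumes T: "symmetric_op T"
    and orth: "\<And>w. w \<in> spectral_subspace T 1 \<Longrightarrow> inner w v = 0" and "\<epsilon> > 0"
  obtains n u where "n > 0" "u + (blinfun_apply T ^^ (n + n)) u = v" "(norm u)\<^sup>2 < \<epsilon>"
proof -
  let ?P = "\<lambda>n. blinfun_apply T ^^ n"
  have even: "inner x (?P (n + n) x) = (norm (?P n x))\<^sup>2" for n x
    by (simp add: funpow_add power2_norm_eq_inner symmetric_funpow[OF T])
  have "\<exists>u. u + ?P (n + n) u = v" for n
  proof -
    define R where "R = Blinfun (\<lambda>x. x + ?P (n + n) x)"
    have R: "R x = x + ?P (n + n) x" for x
      unfolding R_def
      by (subst bounded_linear_Blinfun_apply)
        (intro bounded_linear_add bounded_linear_ident bounded_linear_funpow_blinfun, simp)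
    have "1 * (norm x)\<^sup>2 \<le> inner x (R x)" for x
      by (simp add: R inner_add_right even power2_norm_eq_inner)
    then obtain Q :: "'a \<Rightarrow>\<^sub>L 'a" where "\<And>x. R (Q x) = x"
      using coercive_inverse[of 1 R] by (metis zero_less_one)
    then show ?thesis using R by metis
  qed
  then obtain u where u: "\<And>n. u n + ?P (n + n) (u n) = v"
    by metis
  \<comment> \<open>Inner product of the equation for \<open>u n\<close> with \<open>u n\<close>
    itself.\<close>
  have sum: "(norm (u n))\<^sup>2 + (norm (?P n (u n)))\<^sup>2 = inner (u n) v" for n
    by (simp add: inner_add_right even power2_norm_eq_inner flip: u[of n])
  have u_le: "norm (u n) \<le> norm v" for n
  proof -
    have "norm (u n) * norm (u n) \<le> norm (u n) * norm v"
      using sum[of n] norm_cauchy_schwarz[of "u n" v] zero_le_power2[of "norm (?P n (u n))"]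
      unfolding power2_eq_square by linarith
    then show ?thesis
      by (cases "norm (u n) = 0") auto
  qed
  have Pu_le: "norm (?P n (u n)) \<le> norm v" for n
  proof (rule power2_le_imp_le)
    have "norm (u n) * norm v \<le> norm v * norm v"
      using u_le by (intro mult_right_mono) auto
    then show "(norm (?P n (u n)))\<^sup>2 \<le> (norm v)\<^sup>2"
      using sum[of n] norm_cauchy_schwarz[of "u n" v] zero_le_power2[of "norm (u n)"]
      unfolding power2_eq_square by linarith
  qed simp
  have bound: "norm (?P k (u n)) \<le> norm v" if "k \<le> n" for k n
    using log_convex_le_max[OF log_convex_norm_funpow[OF T] that, of "u n"] u_le[of n] Pu_le[of n]
    by simp
  have "\<exists>n>0. inner (u n) v < \<epsilon>"
  proof (rule ccontr)
    assume "\<not> ?thesis"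
    then have large: "\<epsilon> \<le> inner (u n) v" if "n > 0" for n
      using that by (meson not_le)
    define K where "K n = {w. (\<forall>k\<le>n. norm (?P k w) \<le> norm v) \<and> \<epsilon> \<le> inner w v}" for n
    have 1: "closed (K n)" for n
      unfolding K_def
      by (intro closed_Collect_conj closed_Collect_all closed_Collect_imp closed_Collect_le
          continuous_intros continuous_on_funpow_blinfun open_Collect_const)
    have 2: "convex (K n)" for n
    proof (rule convexI)
      fix w z and s t :: real
      assume w: "w \<in> K n" and z: "z \<in> K n" and st: "0 \<le> s" "0 \<le> t" "s + t = 1"
      have "norm (?P k (s *\<^sub>R w + t *\<^sub>R z)) \<le> norm v" if "k \<le> n" for k
      proof -
        have "norm (?P k (s *\<^sub>R w + t *\<^sub>R z)) \<le> s * norm (?P k w) + t * norm (?P k z)"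
          using st by (simp add: funpow_blinfun_add funpow_blinfun_scaleR norm_triangle_le)
        also have "\<dots> \<le> s * norm v + t * norm v"
          using w z st that by (intro add_mono mult_left_mono) (auto simp: K_def)
        also have "\<dots> = norm v"
          using st(3) by (simp flip: distrib_right)
        finally show ?thesis .
      qed
      moreover have "\<epsilon> \<le> inner (s *\<^sub>R w + t *\<^sub>R z) v"
      proof -
        have "\<epsilon> = s * \<epsilon> + t * \<epsilon>"
          using st(3) by (simp flip: distrib_right)
        also have "\<dots> \<le> s * inner w v + t * inner z v"
          using w z st by (intro add_mono mult_left_mono) (auto simp: K_def)
        finally show ?thesis by (simp add: inner_simps)
      qed
      ultimately show "s *\<^sub>R w + t *\<^sub>R z \<in> K n"
        by (simp add: K_def)
    qed
    have 3: "K n \<subseteq> K m" if "m \<le> n" for m n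
      using that by (auto simp: K_def)
    have 4: "\<exists>w\<in>K n. norm w \<le> norm v" for n
    proof
      \<comment> \<open>\<open>Suc n\<close> because \<open>large\<close> speaks of positive indices
        only.\<close>
      show "u (Suc n) \<in> K n"
        using bound large[of "Suc n"] by (simp add: K_def)
    qed (rule u_le)
    obtain w where w: "\<And>n. w \<in> K n"
    proof (rule nested_closed_convex[of K, OF 1 2 3 4])
      fix w assume "\<And>n. w \<in> K n"
      then show thesis by (rule that)
    qed
    have "w \<in> spectral_subspace T 1"
      using w by (intro spectral_subspaceI[OF T, of _ _ "norm v"]) (auto simp: K_def)
    with orth[OF this] w[of 0] \<open>\<epsilon> > 0\<close> show False
      by (simp add: K_def)
  qed
  then obtain n where "n > 0" and n: "inner (u n) v < \<epsilon>" by blast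
  moreover have "(norm (u n))\<^sup>2 < \<epsilon>"
    using sum[of n] n zero_le_power2[of "norm (?P n (u n))"] by linarith
  ultimately show thesis using that u by blast
qed

text \<open>For \<open>w = v - u j = T ^ m (u j)\<close> the numbers \<open>(norm w)\<^sup>2\<close>
  and \<open>inner (T w) w\<close> are the moments of \<open>u j\<close> at the consecutive indices
  \<open>2 * m\<close> and \<open>2 * m + 1\<close>. As \<open>u j\<close> is short, the moment at
  \<open>2 * m\<close> is at least the one at 0, and log-convexity makes the next one at least as
  large. Finally \<open>u j\<close> tends to 0.\<close>

lemma spectral_subspace_one_orthogonal:
  fixes T :: "'a::{real_inner,complete_space} \<Rightarrow>\<^sub>L 'a"
  assumes T: "symmetric_op T" and pos: "\<And>x. 0 \<le> inner (T x) x"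
    and orth: "\<And>w. w \<in> spectral_subspace T 1 \<Longrightarrow> inner w v = 0"
  shows "(norm v)\<^sup>2 \<le> inner (T v) v"
proof (cases "v = 0")
  case False
  let ?P = "\<lambda>n. blinfun_apply T ^^ n"
  have "\<exists>u n. n > 0 \<and> u + ?P (n + n) u = v \<and> (norm u)\<^sup>2 < inverse (Suc j)" for j
    using damped_vector_small[OF T orth, of "inverse (Suc j)"]
    by (metis inverse_positive_iff_positive of_nat_0_less_iff zero_less_Suc)
  then obtain u n where n: "\<And>j. n j > 0" and u: "\<And>j. u j + ?P (n j + n j) (u j) = v"
    and small: "\<And>j. (norm (u j))\<^sup>2 < inverse (Suc j)"
    by metis
  have "(\<lambda>j. (norm (u j))\<^sup>2) \<longlonglongrightarrow> 0"
    by (rule tendsto_sandwich[OF _ _ tendsto_const LIMSEQ_inverse_real_of_nat])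
      (auto intro!: always_eventually less_imp_le small simp del: of_nat_Suc)
  then have "(\<lambda>j. sqrt ((norm (u j))\<^sup>2)) \<longlonglongrightarrow> sqrt 0"
    by (rule tendsto_real_sqrt)
  then have norm_u: "(\<lambda>j. norm (u j)) \<longlonglongrightarrow> 0"
    by simp
  then have lim: "u \<longlonglongrightarrow> 0"
    by (rule tendsto_norm_zero_cancel)
  \<comment> \<open>Half of \<open>norm v\<close> ensures
    \<open>norm (u j) \<le> norm (v - u j)\<close>.\<close>
  have "\<forall>\<^sub>F j in sequentially. norm (u j) < norm v / 2"
    using norm_u False by (intro order_tendstoD) auto
  then have "\<forall>\<^sub>F j in sequentially. (norm (v - u j))\<^sup>2 \<le> inner (T (v - u j)) (v - u j)"
  proof eventually_elim
    case (elim j)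
    let ?m = "n j + n j" and ?s = "\<lambda>k. inner (?P k (u j)) (u j)"
    have w: "v - u j = ?P ?m (u j)"
      using u[of j] by (simp add: algebra_simps)
    have s: "log_convex ?s"
      by (rule log_convex_inner_funpow[OF T pos])
    have even: "?s (?m + ?m) = (norm (v - u j))\<^sup>2"
      unfolding w by (simp add: funpow_add symmetric_funpow[OF T] power2_norm_eq_inner)
    have odd: "?s (Suc (?m + ?m)) = inner (T (v - u j)) (v - u j)"
      unfolding w using symmetric_funpow[OF T, of ?m "T (?P ?m (u j))" "u j"]
      by (simp add: funpow_add funpow_blinfun_commute[of T T])
    have "norm (u j) \<le> norm (v - u j)"
      using elim norm_triangle_ineq2[of v "u j"] by linarith
    then have "?s 0 \<le> ?s (?m + ?m)"
      unfolding even by (simp add: power2_norm_eq_inner[symmetric] power_mono)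
    then have "?s (?m + ?m) \<le> ?s (Suc (?m + ?m))"
      using n[of j] by (intro log_convex_le_Suc[OF s]) auto
    then show ?case by (simp only: even odd)
  qed
  moreover have "(\<lambda>j. (norm (v - u j))\<^sup>2) \<longlonglongrightarrow> (norm (v - 0))\<^sup>2"
    by (intro tendsto_intros lim)
  moreover have "(\<lambda>j. inner (T (v - u j)) (v - u j)) \<longlonglongrightarrow> inner (T (v - 0)) (v - 0)"
    by (intro tendsto_intros lim)
  ultimately show ?thesis
    by (simp add: tendsto_le[OF trivial_limit_sequentially])
qed simp

lemma spectral_subspace_orthogonal:
  fixes T :: "'a::{real_inner,complete_space} \<Rightarrow>\<^sub>L 'a"
  assumes T: "symmetric_op T" and pos: "\<And>x. 0 \<le> inner (T x) x"
    and orth: "\<And>w. w \<in> spectral_subspace T r \<Longrightarrow> inner w v = 0"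
  shows "r * (norm v)\<^sup>2 \<le> inner (T v) v"
proof (cases "r > 0")
  case True
  define S where "S = (1 / r) *\<^sub>R T"
  have S: "S x = (1 / r) *\<^sub>R T x" for x
    by (simp add: S_def blinfun.scaleR_left)
  have "(blinfun_apply S ^^ n) x = (1 / r) ^ n *\<^sub>R (blinfun_apply T ^^ n) x" for n x
    by (induction n) (simp_all add: S blinfun.scaleR_right)
  then have "spectral_subspace S 1 = spectral_subspace T r"
    using True by (simp add: spectral_subspace_def power_divide field_simps)
  moreover have "symmetric_op S"
    using T by (simp add: symmetric_op_def S)
  ultimately have "(norm v)\<^sup>2 \<le> inner (S v) v"
    using True pos orth by (intro spectral_subspace_one_orthogonal) (auto simp: S)
  then show ?thesis
    using True by (simp add: S field_simps)
next
  case False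
  then have "r * (norm v)\<^sup>2 \<le> 0"
    by (simp add: mult_le_0_iff)
  then show ?thesis using pos[of v] by linarith
qed


section \<open>Orthogonal projections\<close>

text \<open>A choice, so that the operator is defined for every set; for a closed subspace of a
  complete space the chosen vector exists and is unique.\<close>

definition orth_proj :: "'a::real_inner set \<Rightarrow> 'a \<Rightarrow>\<^sub>L 'a"
  where "orth_proj V = Blinfun (\<lambda>x. SOME y. y \<in> V \<and> (\<forall>z\<in>V. inner (x - y) z = 0))"

definition proj_op :: "('a::real_inner \<Rightarrow>\<^sub>L 'a) \<Rightarrow> bool"
  where "proj_op P \<longleftrightarrow> symmetric_op P \<and> (\<forall>x. P (P x) = P x)"

text \<open>For a projection this is its range. Fixed points form a closed subspace for any bounded
  operator, so these two facts come without reference to projections.\<close>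

definition fixed_space :: "('a::real_normed_vector \<Rightarrow>\<^sub>L 'a) \<Rightarrow> 'a set"
  where "fixed_space P = {x. P x = x}"

lemma fixed_space_iff: "x \<in> fixed_space P \<longleftrightarrow> P x = x"
  by (simp add: fixed_space_def)

lemma closed_fixed_space: "closed (fixed_space P)"
  unfolding fixed_space_def by (intro closed_Collect_eq continuous_intros)

lemma subspace_fixed_space: "subspace (fixed_space P)"
  by (simp add: subspace_def fixed_space_def blinfun.add_right blinfun.scaleR_right)

lemma orthogonal_part_unique:
  fixes V :: "'a::real_inner set"
  assumes "subspace V" "y \<in> V" "y' \<in> V"
    and "\<And>z. z \<in> V \<Longrightarrow> inner (x - y) z = 0" "\<And>z. z \<in> V \<Longrightarrow> inner (x - y') z = 0"
  shows "y = y'"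
proof -
  have d: "y - y' \<in> V"
    using assms by (simp add: subspace_diff)
  have "inner (y - y') (y - y') = inner (x - y') (y - y') - inner (x - y) (y - y')"
    by (simp add: inner_diff_left)
  then show ?thesis
    using assms(4,5)[OF d] by simp
qed

context
  fixes V :: "'a::{real_inner,complete_space} set"
  assumes V: "closed V" "subspace V"
begin

lemma orth_proj_aux:
  "orth_proj V x \<in> V \<and> (\<forall>z\<in>V. inner (x - orth_proj V x) z = 0)"
proof -
  let ?f = "\<lambda>x. SOME y. y \<in> V \<and> (\<forall>z\<in>V. inner (x - y) z = 0)"
  have f: "?f x \<in> V \<and> (\<forall>z\<in>V. inner (x - ?f x) z = 0)" for x
  proof (rule someI_ex)
    show "\<exists>y. y \<in> V \<and> (\<forall>z\<in>V. inner (x - y) z = 0)"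
      using orthogonal_decomposition[OF V] by metis
  qed
  have f_eq: "?f x = y" if "y \<in> V" "\<And>z. z \<in> V \<Longrightarrow> inner (x - y) z = 0" for x y
    using f[of x] that by (intro orthogonal_part_unique[OF V(2), of _ _ x]) auto
  have "bounded_linear ?f"
  proof (rule bounded_linear_intro)
    show "?f (x + y) = ?f x + ?f y" for x y
    proof (rule f_eq)
      show "?f x + ?f y \<in> V"
        using f V(2) by (simp add: subspace_add)
      show "inner (x + y - (?f x + ?f y)) z = 0" if "z \<in> V" for z
        using f[of x] f[of y] that by (simp add: add_diff_add inner_add_left)
    qed
    show "?f (c *\<^sub>R x) = c *\<^sub>R ?f x" for c x
    proof (rule f_eq)
      show "c *\<^sub>R ?f x \<in> V"
        using f V(2) by (simp add: subspace_scale)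
      show "inner (c *\<^sub>R x - c *\<^sub>R ?f x) z = 0" if "z \<in> V" for z
        using f[of x] that by (simp flip: scaleR_diff_right)
    qed
    show "norm (?f x) \<le> norm x * 1" for x
    proof -
      have "inner (x - ?f x) (?f x) = 0"
        using f[of x] by blast
      then have "(norm x)\<^sup>2 = (norm (?f x))\<^sup>2 + (norm (x - ?f x))\<^sup>2"
        by (simp add: power2_norm_eq_inner inner_diff_left inner_diff_right inner_commute)
      then have "(norm (?f x))\<^sup>2 \<le> (norm x)\<^sup>2"
        by simp
      then show ?thesis
        using power2_le_imp_le[of "norm (?f x)" "norm x"] by simp
    qed
  qed
  then show ?thesis
    using f[of x] by (simp add: orth_proj_def bounded_linear_Blinfun_apply)
qed

lemma orth_proj_in: "orth_proj V x \<in> V"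
  using orth_proj_aux by blast

lemma orth_proj_orthogonal: "z \<in> V \<Longrightarrow> inner (x - orth_proj V x) z = 0"
  using orth_proj_aux by blast

lemma orth_proj_eqI:
  assumes "y \<in> V" "\<And>z. z \<in> V \<Longrightarrow> inner (x - y) z = 0"
  shows "orth_proj V x = y"
  using orthogonal_part_unique[OF V(2) orth_proj_in assms(1) orth_proj_orthogonal assms(2)]
  by simp

lemma orth_proj_eq_self_iff: "orth_proj V x = x \<longleftrightarrow> x \<in> V"
  using orth_proj_in[of x] orth_proj_eqI[of x x] by auto

lemma fixed_space_orth_proj: "fixed_space (orth_proj V) = V"
  by (auto simp: fixed_space_iff orth_proj_eq_self_iff)

lemma proj_op_orth_proj: "proj_op (orth_proj V)"
  unfolding proj_op_def symmetric_op_def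
proof (intro conjI allI)
  fix x y
  show "orth_proj V (orth_proj V x) = orth_proj V x"
    by (simp add: orth_proj_eq_self_iff orth_proj_in)
  have "inner (orth_proj V x) (y - orth_proj V y) = 0"
    using orth_proj_orthogonal[OF orth_proj_in] by (simp add: inner_commute)
  moreover have "inner (x - orth_proj V x) (orth_proj V y) = 0"
    using orth_proj_orthogonal[OF orth_proj_in] .
  ultimately show "inner (orth_proj V x) y = inner x (orth_proj V y)"
    by (simp add: inner_diff_left inner_diff_right)
qed

lemma orth_proj_eq_0:
  assumes "orth_proj V x = 0" "z \<in> V"
  shows "inner z x = 0"
  using orth_proj_orthogonal[OF assms(2), of x] assms(1) by (simp add: inner_commute)

text \<open>\<open>S'\<close> is the adjoint of \<open>S\<close>: invariance of \<open>V\<close>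
  under it means invariance of the orthogonal complement under \<open>S\<close>, so \<open>S\<close>
  respects the decomposition.\<close>

lemma orth_proj_commute:
  assumes "\<And>x y. inner (blinfun_apply S x) y = inner x (blinfun_apply S' y)"
    and "\<And>x. x \<in> V \<Longrightarrow> S x \<in> V" "\<And>x. x \<in> V \<Longrightarrow> S' x \<in> V"
  shows "orth_proj V (S x) = S (orth_proj V x)"
proof (rule orth_proj_eqI)
  show "S (orth_proj V x) \<in> V"
    by (simp add: assms orth_proj_in)
  show "inner (S x - S (orth_proj V x)) z = 0" if "z \<in> V" for z
    using orth_proj_orthogonal[OF assms(3)[OF that], of x]
    by (simp add: assms(1) flip: blinfun.diff_right)
qed

end

lemma proj_opD:
  assumes "proj_op P"
  shows "symmetric_op P" "P (P x) = P x"
  using assms by (auto simp: proj_op_def)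

lemma proj_op_inner: "proj_op P \<Longrightarrow> inner (P x) x = (norm (P x))\<^sup>2"
  by (metis power2_norm_eq_inner proj_opD symmetric_opD)

lemma proj_op_norm_le:
  assumes "proj_op P"
  shows "norm (P x) \<le> norm x"
proof (cases "P x = 0")
  case False
  have "norm (P x) * norm (P x) \<le> norm (P x) * norm x"
    using proj_op_inner[OF assms, of x] norm_cauchy_schwarz[of "P x" x]
    by (simp add: power2_eq_square)
  then show ?thesis using False by simp
qed simp

lemma proj_op_eq_orth_proj:
  fixes P :: "'a::{real_inner,complete_space} \<Rightarrow>\<^sub>L 'a"
  assumes "proj_op P"
  shows "P = orth_proj (fixed_space P)"
proof (rule blinfun_eqI)
  fix x
  show "P x = orth_proj (fixed_space P) x"
  proof (rule sym, rule orth_proj_eqI[OF closed_fixed_space subspace_fixed_space])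
    show "P x \<in> fixed_space P"
      by (simp add: fixed_space_iff proj_opD[OF assms])
    show "inner (x - P x) z = 0" if "z \<in> fixed_space P" for z
    proof -
      have "inner (x - P x) z = inner (x - P x) (P z)"
        using that by (simp add: fixed_space_iff)
      also have "\<dots> = inner (P (x - P x)) z"
        by (simp add: symmetric_opD[OF proj_opD(1)[OF assms]])
      finally show ?thesis
        by (simp add: blinfun.diff_right proj_opD[OF assms])
    qed
  qed
qed

lemma proj_op_fixed_space_subset:
  assumes P: "proj_op P" and Q: "proj_op Q" and sub: "fixed_space P \<subseteq> fixed_space Q"
  shows "Q (P x) = P x" "P (Q x) = P x"
proof -
  show QP: "Q (P x) = P x" for x
    using sub proj_opD(2)[OF P, of x] by (auto simp: fixed_space_iff)
  show "P (Q x) = P x"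
  proof (rule vector_eq_rdot[THEN iffD1], rule allI)
    fix y
    show "inner (P (Q x)) y = inner (P x) y"
      using QP[of y] by (simp add: symmetric_opD[OF proj_opD(1)[OF P]] symmetric_opD[OF proj_opD(1)[OF Q]])
  qed
qed

text \<open>Left to right by Pythagoras, as \<open>norm x \<le> norm (Q x)\<close> forces
  \<open>Q x = x\<close>; right to left because \<open>P = P Q\<close> and \<open>P\<close> is a
  contraction.\<close>

lemma proj_op_le_iff:
  assumes P: "proj_op P" and Q: "proj_op Q"
  shows "(\<forall>x. 0 \<le> inner x ((Q - P) x)) \<longleftrightarrow> fixed_space P \<subseteq> fixed_space Q"
proof
  assume le: "\<forall>x. 0 \<le> inner x ((Q - P) x)"
  show "fixed_space P \<subseteq> fixed_space Q"
  proof
    fix x assume "x \<in> fixed_space P"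
    then have "(norm x)\<^sup>2 \<le> (norm (Q x))\<^sup>2"
      using le[rule_format, of x] proj_op_inner[OF Q, of x]
      by (simp add: fixed_space_iff blinfun.diff_left inner_diff_right inner_commute
          power2_norm_eq_inner)
    moreover have "(norm (x - Q x))\<^sup>2 = (norm x)\<^sup>2 - (norm (Q x))\<^sup>2"
      using proj_op_inner[OF Q, of x]
      by (simp add: power2_norm_eq_inner inner_diff_left inner_diff_right inner_commute)
    ultimately have "(norm (x - Q x))\<^sup>2 \<le> 0" by simp
    then show "x \<in> fixed_space Q" by (simp add: fixed_space_iff)
  qed
next
  assume "fixed_space P \<subseteq> fixed_space Q"
  then have PQ: "P (Q x) = P x" for x
    by (rule proj_op_fixed_space_subset[OF P Q])
  have "0 \<le> inner x ((Q - P) x)" for x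
  proof -
    have "(norm (P x))\<^sup>2 \<le> (norm (Q x))\<^sup>2"
      using proj_op_norm_le[OF P, of "Q x"] by (simp add: PQ power_mono)
    then show ?thesis
      using proj_op_inner[OF P, of x] proj_op_inner[OF Q, of x]
      by (simp add: blinfun.diff_left inner_diff_right inner_commute)
  qed
  then show "\<forall>x. 0 \<le> inner x ((Q - P) x)" by blast
qed

lemma proj_op_diff:
  assumes P: "proj_op P" and Q: "proj_op Q" and sub: "fixed_space P \<subseteq> fixed_space Q"
  shows "proj_op (Q - P)"
  using proj_op_fixed_space_subset[OF assms] proj_opD[OF P] proj_opD[OF Q]
  by (simp add: proj_op_def symmetric_op_def blinfun.diff_left blinfun.diff_right
      inner_diff_left inner_diff_right)


section \<open>Spectral families\<close>

text \<open>\<open>resolution_of_identity\<close> without complex linearity and in terms of ranges: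
  right continuity becomes an intersection of ranges instead of a statement about all projections.
  The link is \<open>resolution_of_identity_iff\<close>.\<close>

definition spectral_family :: "(real \<Rightarrow> ('a::real_inner \<Rightarrow>\<^sub>L 'a)) \<Rightarrow> bool"
  where "spectral_family e \<longleftrightarrow>
    (\<forall>x. proj_op (e x)) \<and>
    (\<forall>x y. x \<le> y \<longrightarrow> fixed_space (e x) \<subseteq> fixed_space (e y)) \<and>
    (\<forall>x. (\<Inter>y\<in>{x<..}. fixed_space (e y)) \<subseteq> fixed_space (e x)) \<and>
    (\<exists>K. (\<forall>x. x < - K \<longrightarrow> e x = 0) \<and> (\<forall>x\<ge>K. e x = id_blinfun))"

text \<open>An integral-free substitute for \<open>a = \<integral> x de\<close>. For symmetric
  \<open>a\<close> it implies the Stieltjes integral, and it determines the spectral family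
  \<open>e\<close>, which is how spectral resolutions are identified.\<close>

definition spectral_bounds :: "(real \<Rightarrow> ('a::real_inner \<Rightarrow>\<^sub>L 'a)) \<Rightarrow> ('a \<Rightarrow>\<^sub>L 'a) \<Rightarrow> bool"
  where "spectral_bounds e a \<longleftrightarrow>
    (\<forall>x v. e x (a v) = a (e x v) \<and>
       (e x v = v \<longrightarrow> inner (a v) v \<le> x * (norm v)\<^sup>2) \<and>
       (e x v = 0 \<longrightarrow> x * (norm v)\<^sup>2 \<le> inner (a v) v))"

lemma spectral_familyD:
  assumes "spectral_family e"
  shows "proj_op (e x)"
    and "x \<le> y \<Longrightarrow> fixed_space (e x) \<subseteq> fixed_space (e y)"
    and "(\<Inter>y\<in>{x<..}. fixed_space (e y)) \<subseteq> fixed_space (e x)"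
  using assms by (auto simp: spectral_family_def)

lemma spectral_boundsD:
  assumes "spectral_bounds e a"
  shows "e x (a v) = a (e x v)"
    and "e x v = v \<Longrightarrow> inner (a v) v \<le> x * (norm v)\<^sup>2"
    and "e x v = 0 \<Longrightarrow> x * (norm v)\<^sup>2 \<le> inner (a v) v"
  using assms by (auto simp: spectral_bounds_def)

lemma spectral_family_comp:
  assumes "spectral_family e" "x \<le> y"
  shows "e y (e x v) = e x v" "e x (e y v) = e x v"
  using proj_op_fixed_space_subset[of "e x" "e y"] assms by (auto simp: spectral_familyD)

lemma symmetric_op_add: "symmetric_op S \<Longrightarrow> symmetric_op T \<Longrightarrow> symmetric_op (S + T)"
  by (simp add: symmetric_op_def blinfun.add_left inner_add_left inner_add_right)

lemma symmetric_op_diff: "symmetric_op S \<Longrightarrow> symmetric_op T \<Longrightarrow> symmetric_op (S - T)"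
  by (simp add: symmetric_op_def blinfun.diff_left inner_diff_left inner_diff_right)

lemma symmetric_op_scaleR: "symmetric_op T \<Longrightarrow> symmetric_op (c *\<^sub>R T)"
  by (simp add: symmetric_op_def blinfun.scaleR_left)

lemma symmetric_op_id: "symmetric_op id_blinfun"
  by (simp add: symmetric_op_def)

lemma symmetric_op_sum: "(\<And>i. i \<in> I \<Longrightarrow> symmetric_op (T i)) \<Longrightarrow> symmetric_op (\<Sum>i\<in>I. T i)"
  by (simp add: symmetric_op_def blinfun.sum_left inner_sum_left inner_sum_right)

lemma symmetric_op_limit:
  assumes "\<And>n. symmetric_op (X n)" "X \<longlonglongrightarrow> T"
  shows "symmetric_op T"
  unfolding symmetric_op_def
proof (intro allI)
  fix x y
  have "(\<lambda>n. inner (X n x) y) \<longlonglongrightarrow> inner (T x) y" "(\<lambda>n. inner x (X n y)) \<longlonglongrightarrow> inner x (T y)"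
    by (intro tendsto_intros assms)+
  then show "inner (T x) y = inner x (T y)"
    using LIMSEQ_unique by (simp add: symmetric_opD[OF assms(1)])
qed

section \<open>The spectral family of a bounded symmetric operator: existence and uniqueness\<close>

definition nonneg_shift :: "('a::real_inner \<Rightarrow>\<^sub>L 'a) \<Rightarrow> ('a \<Rightarrow>\<^sub>L 'a)"
  where "nonneg_shift a = a + norm a *\<^sub>R id_blinfun"

lemma nonneg_shift_apply: "nonneg_shift a v = a v + norm a *\<^sub>R v"
  by (simp add: nonneg_shift_def blinfun.add_left blinfun.scaleR_left)

lemma symmetric_nonneg_shift: "symmetric_op a \<Longrightarrow> symmetric_op (nonneg_shift a)"
  unfolding nonneg_shift_def by (intro symmetric_op_add symmetric_op_scaleR symmetric_op_id)

lemma inner_nonneg_shift: "inner (nonneg_shift a v) v = inner (a v) v + norm a * (norm v)\<^sup>2"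
  by (simp add: nonneg_shift_apply inner_add_left power2_norm_eq_inner)

lemma abs_inner_blinfun_le: "\<bar>inner (blinfun_apply a v) v\<bar> \<le> norm a * (norm v)\<^sup>2"
proof -
  have "\<bar>inner (a v) v\<bar> \<le> norm (a v) * norm v"
    by (rule Cauchy_Schwarz_ineq2)
  also have "\<dots> \<le> norm a * norm v * norm v"
    by (intro mult_right_mono norm_blinfun) simp
  finally show ?thesis by (simp add: power2_eq_square mult.assoc)
qed

lemma nonneg_shift_nonneg: "0 \<le> inner (nonneg_shift a v) v"
  using abs_inner_blinfun_le[of a v] by (simp add: inner_nonneg_shift abs_le_iff)

lemma norm_nonneg_shift_le: "norm (nonneg_shift a) \<le> 2 * norm a"
proof (rule norm_blinfun_bound)
  show "norm (nonneg_shift a v) \<le> 2 * norm a * norm v" for v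
    using norm_triangle_ineq[of "a v" "norm a *\<^sub>R v"] norm_blinfun[of a v]
    by (simp add: nonneg_shift_apply)
qed simp

definition spectral_projection :: "('a::real_inner \<Rightarrow>\<^sub>L 'a) \<Rightarrow> real \<Rightarrow> ('a \<Rightarrow>\<^sub>L 'a)"
  where "spectral_projection a x = orth_proj (spectral_subspace (nonneg_shift a) (x + norm a))"

context
  fixes a :: "'a::{real_inner,complete_space} \<Rightarrow>\<^sub>L 'a"
  assumes a: "symmetric_op a"
begin

lemmas spectral_closed_subspace =
  closed_spectral_subspace[of "nonneg_shift a"]
  subspace_spectral_subspace[OF symmetric_nonneg_shift[OF a]]

lemma fixed_space_spectral_projection:
  "fixed_space (spectral_projection a x) = spectral_subspace (nonneg_shift a) (x + norm a)"
  unfolding spectral_projection_def by (rule fixed_space_orth_proj[OF spectral_closed_subspace])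

lemma spectral_projection_commute:
  assumes "\<And>v. blinfun_apply S (a v) = a (S v)" "\<And>v. blinfun_apply S' (a v) = a (S' v)"
    and "\<And>x y. inner (S x) y = inner x (S' y)"
  shows "spectral_projection a x (S v) = S (spectral_projection a x v)"
  unfolding spectral_projection_def
  by (rule orth_proj_commute[OF spectral_closed_subspace assms(3)];
      rule spectral_subspace_invariant[OF symmetric_nonneg_shift[OF a]])
    (simp_all add: nonneg_shift_apply blinfun.add_right blinfun.scaleR_right assms)

lemma spectral_projection_eq_0:
  assumes "x < - norm a"
  shows "spectral_projection a x = 0"
proof (rule blinfun_eqI)
  have "spectral_subspace (nonneg_shift a) (x + norm a) = {0}"
    using assms by (intro spectral_subspace_neg) simp
  then show "spectral_projection a x v = blinfun_apply 0 v" for v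
    using orth_proj_in[OF spectral_closed_subspace, of "x + norm a" v]
    by (simp add: spectral_projection_def)
qed

lemma spectral_projection_eq_id:
  assumes "x \<ge> norm a"
  shows "spectral_projection a x = id_blinfun"
proof (rule blinfun_eqI)
  fix v
  have "v \<in> spectral_subspace (nonneg_shift a) (x + norm a)"
  proof (rule spectral_subspaceI[OF symmetric_nonneg_shift[OF a]])
    show "0 \<le> x + norm a"
      using assms norm_ge_zero[of a] by linarith
    show "norm ((blinfun_apply (nonneg_shift a) ^^ n) v) \<le> norm v * (x + norm a) ^ n" for n
    proof (induction n)
      case (Suc n)
      have "norm (nonneg_shift a ((blinfun_apply (nonneg_shift a) ^^ n) v))
          \<le> norm (nonneg_shift a) * norm ((blinfun_apply (nonneg_shift a) ^^ n) v)"
        by (rule norm_blinfun)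
      also have "\<dots> \<le> (x + norm a) * (norm v * (x + norm a) ^ n)"
        using norm_nonneg_shift_le[of a] assms \<open>0 \<le> x + norm a\<close> Suc by (intro mult_mono) auto
      finally show ?case by (simp add: mult.left_commute)
    qed simp
  qed
  then show "spectral_projection a x v = id_blinfun v"
    by (simp flip: fixed_space_spectral_projection add: fixed_space_iff)
qed

lemma spectral_family_spectral_projection: "spectral_family (spectral_projection a)"
proof -
  let ?T = "nonneg_shift a"
  have "spectral_subspace ?T (x + norm a) \<subseteq> spectral_subspace ?T (y + norm a)" if "x \<le> y" for x y
  proof (cases "x + norm a < 0")
    case True
    then show ?thesis
      using subspace_0[OF spectral_closed_subspace(2), of "y + norm a"]
      by (simp add: spectral_subspace_neg)
  next
    case False
    then have "(x + norm a) ^ n * norm v \<le> (y + norm a) ^ n * norm v" for n and v :: 'a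
      using that by (intro mult_right_mono power_mono) auto
    then show ?thesis
      unfolding spectral_subspace_def by (blast intro: order_trans)
  qed
  \<comment> \<open>Right continuity: each defining inequality is continuous in the bound, so it
    survives \<open>y\<close> decreasing to \<open>x\<close>.\<close>
  moreover have "v \<in> spectral_subspace ?T (x + norm a)"
    if v: "\<And>y. y > x \<Longrightarrow> v \<in> spectral_subspace ?T (y + norm a)" for x v
    unfolding spectral_subspace_def
  proof (rule CollectI, rule allI)
    fix n
    have "((\<lambda>y. (y + norm a) ^ n * norm v) \<longlongrightarrow> (x + norm a) ^ n * norm v) (at_right x)"
      by (intro tendsto_intros)
    moreover have "\<forall>\<^sub>F y in at_right x. norm ((blinfun_apply ?T ^^ n) v) \<le> (y + norm a) ^ n * norm v"
      using eventually_at_right_less[of x]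
      by eventually_elim (rule spectral_subspaceD[OF v])
    ultimately show "norm ((blinfun_apply ?T ^^ n) v) \<le> (x + norm a) ^ n * norm v"
      by (intro tendsto_lowerbound) auto
  qed
  ultimately show ?thesis
    unfolding spectral_family_def fixed_space_spectral_projection
    using spectral_projection_eq_0 spectral_projection_eq_id
      proj_op_orth_proj[OF spectral_closed_subspace]
    by (auto simp: spectral_projection_def)
qed

text \<open>The upper bound comes from the first power of the shifted operator and Cauchy-Schwarz;
  the higher powers enter through \<open>spectral_subspace_orthogonal\<close>, which is the lower
  bound.\<close>

lemma spectral_bounds_spectral_projection: "spectral_bounds (spectral_projection a) a"
  unfolding spectral_bounds_def
proof (intro allI conjI impI)
  fix x v
  let ?T = "nonneg_shift a" and ?V = "spectral_subspace (nonneg_shift a) (x + norm a)"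
  show "spectral_projection a x (a v) = a (spectral_projection a x v)"
    by (rule spectral_projection_commute) (simp_all add: symmetric_opD[OF a])
  show "inner (a v) v \<le> x * (norm v)\<^sup>2" if "spectral_projection a x v = v"
  proof -
    have "v \<in> ?V"
      using that by (simp flip: fixed_space_spectral_projection add: fixed_space_iff)
    then have "norm (?T v) \<le> (x + norm a) * norm v"
      using spectral_subspaceD[of v ?T _ 1] by simp
    then have "norm (?T v) * norm v \<le> (x + norm a) * norm v * norm v"
      by (rule mult_right_mono) simp
    then have "inner (?T v) v \<le> (x + norm a) * (norm v)\<^sup>2"
      using norm_cauchy_schwarz[of "?T v" v] by (simp add: power2_eq_square mult.assoc)
    then show ?thesis
      by (simp add: inner_nonneg_shift distrib_right)
  qed
  show "x * (norm v)\<^sup>2 \<le> inner (a v) v" if "spectral_projection a x v = 0"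
  proof -
    have "(x + norm a) * (norm v)\<^sup>2 \<le> inner (?T v) v"
    proof (rule spectral_subspace_orthogonal[OF symmetric_nonneg_shift[OF a] nonneg_shift_nonneg])
      show "inner w v = 0" if "w \<in> ?V" for w
        using orth_proj_eq_0[OF spectral_closed_subspace _ that] \<open>_ = 0\<close>
        by (simp add: spectral_projection_def)
    qed
    then show ?thesis
      by (simp add: inner_nonneg_shift distrib_right)
  qed
qed

text \<open>Two inclusions of ranges. On the range of \<open>e y\<close>, which the shifted operator
  preserves, the form bound becomes a norm bound that can be iterated. Conversely, for
  \<open>y > x\<close> the part \<open>w\<close> of a spectral vector outside the range of
  \<open>e y\<close> would have its form both at most \<open>x\<close> and at least \<open>y\<close>
  times \<open>(norm w)\<^sup>2\<close>; right continuity then lowers \<open>y\<close> to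
  \<open>x\<close>.\<close>

lemma spectral_family_unique:
  assumes e: "spectral_family e" and bounds: "spectral_bounds e a"
  shows "e = spectral_projection a"
proof
  fix x
  let ?T = "nonneg_shift a"
  note T = symmetric_nonneg_shift[OF a]
  have comm: "e y (?T v) = ?T (e y v)" for y v
    by (simp add: nonneg_shift_apply blinfun.add_right blinfun.scaleR_right spectral_boundsD[OF bounds])
  have sub: "fixed_space (e y) \<subseteq> spectral_subspace ?T (y + norm a)" for y
  proof
    fix v assume v: "v \<in> fixed_space (e y)"
    have upper: "inner (?T w) w \<le> (y + norm a) * (norm w)\<^sup>2" if "w \<in> fixed_space (e y)" for w
      using spectral_boundsD(2)[OF bounds, of y w] that
      by (simp add: inner_nonneg_shift distrib_right fixed_space_iff)
    show "v \<in> spectral_subspace ?T (y + norm a)"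
    proof (cases "y + norm a < 0")
      case True
      have "0 \<le> (y + norm a) * (norm v)\<^sup>2"
        using upper[OF v] nonneg_shift_nonneg[of a v] by linarith
      then have "v = 0"
        using True by (simp add: zero_le_mult_iff)
      then show ?thesis
        using subspace_0[OF spectral_closed_subspace(2)] by simp
    next
      case False
      have inv: "?T w \<in> fixed_space (e y)" if "w \<in> fixed_space (e y)" for w
        using that by (simp add: fixed_space_iff comm)
      have step: "norm (?T w) \<le> (y + norm a) * norm w" if "w \<in> fixed_space (e y)" for w
        using upper nonneg_shift_nonneg[of a]
        by (intro norm_le_quadratic_form[OF T subspace_fixed_space inv _ that]) auto
      have "(blinfun_apply ?T ^^ n) v \<in> fixed_space (e y) \<and>
          norm ((blinfun_apply ?T ^^ n) v) \<le> norm v * (y + norm a) ^ n" for n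
      proof (induction n)
        case (Suc n)
        then have "norm (?T ((blinfun_apply ?T ^^ n) v)) \<le> (y + norm a) * (norm v * (y + norm a) ^ n)"
          using False by (intro order_trans[OF step] mult_left_mono) auto
        then show ?case
          using Suc inv by (simp add: mult.left_commute)
      qed (simp add: v)
      then show ?thesis
        using False by (intro spectral_subspaceI[OF T, of _ _ "norm v"]) auto
    qed
  qed
  have "spectral_subspace ?T (x + norm a) \<subseteq> fixed_space (e x)"
  proof (rule subsetI, rule subsetD[OF spectral_familyD(3)[OF e]], rule INT_I)
    fix v y assume v: "v \<in> spectral_subspace ?T (x + norm a)" and "y \<in> {x<..}"
    then have "x < y" by simp
    define w where "w = v - e y v"
    have "e y v \<in> spectral_subspace ?T (x + norm a)"
      by (rule spectral_subspace_invariant[OF T comm v])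
    then have "w \<in> fixed_space (spectral_projection a x)"
      unfolding w_def fixed_space_spectral_projection
      using v spectral_closed_subspace(2) by (simp add: subspace_diff)
    then have "inner (a w) w \<le> x * (norm w)\<^sup>2"
      by (intro spectral_boundsD[OF spectral_bounds_spectral_projection]) (simp add: fixed_space_iff)
    moreover have "y * (norm w)\<^sup>2 \<le> inner (a w) w"
      by (intro spectral_boundsD[OF bounds])
        (simp add: w_def blinfun.diff_right proj_opD[OF spectral_familyD(1)[OF e]])
    ultimately have "(y - x) * (norm w)\<^sup>2 \<le> 0"
      by (simp add: left_diff_distrib)
    then have "w = 0"
      using \<open>x < y\<close> by (simp add: mult_le_0_iff)
    then show "v \<in> fixed_space (e y)"
      by (simp add: w_def fixed_space_iff)
  qed
  with sub[of x] have "fixed_space (e x) = spectral_subspace ?T (x + norm a)" by blast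
  then show "e x = spectral_projection a x"
    using proj_op_eq_orth_proj[OF spectral_familyD(1)[OF e, of x]]
    by (simp add: spectral_projection_def)
qed

end

text \<open>
  Summation by parts turns the Riemann-Stieltjes sum of \<open>e\<close> over the partition of \<open>[-L, L]\<close>
  into \<open>2 ^ N\<close> parts into the following expression when \<open>e (-L) = 0\<close> and \<open>e L = 1\<close>.
\<close>

definition dyadic_sum :: "(real \<Rightarrow> ('a::real_normed_vector \<Rightarrow>\<^sub>L 'a)) \<Rightarrow> real \<Rightarrow> nat \<Rightarrow> ('a \<Rightarrow>\<^sub>L 'a)"
  where "dyadic_sum e L N = L *\<^sub>R id_blinfun -
    (2 * L / 2 ^ N) *\<^sub>R (\<Sum>i<2 ^ N. e (- L + real i * (2 * L / 2 ^ N)))"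

section \<open>Norm convergence of dyadic sums and the bounds for the limit\<close>

lemma sum_double:
  fixes f :: "nat \<Rightarrow> 'b::comm_monoid_add"
  shows "(\<Sum>i<2 * m. f i) = (\<Sum>i<m. f (2 * i)) + (\<Sum>i<m. f (Suc (2 * i)))"
  by (induction m) (simp_all add: add_ac)

text \<open>Halving the mesh keeps the even grid points; each odd point brings in the increment of
  \<open>e\<close> over half a cell.\<close>

lemma dyadic_sum_diff:
  fixes e :: "real \<Rightarrow> ('a::real_normed_vector \<Rightarrow>\<^sub>L 'a)" and L :: real and N :: nat
  defines "h \<equiv> 2 * L / 2 ^ Suc N"
  shows "dyadic_sum e L N - dyadic_sum e L (Suc N) =
    h *\<^sub>R (\<Sum>i<2 ^ N. e (- L + real (Suc (2 * i)) * h) - e (- L + real (2 * i) * h))"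
proof -
  have "2 * L / 2 ^ N = 2 * h"
    by (simp add: h_def)
  then have "dyadic_sum e L N = L *\<^sub>R id_blinfun - (2 * h) *\<^sub>R (\<Sum>i<2 ^ N. e (- L + real (2 * i) * h))"
    by (simp add: dyadic_sum_def mult.assoc mult.left_commute)
  moreover have "dyadic_sum e L (Suc N) = L *\<^sub>R id_blinfun -
      h *\<^sub>R ((\<Sum>i<2 ^ N. e (- L + real (2 * i) * h)) + (\<Sum>i<2 ^ N. e (- L + real (Suc (2 * i)) * h)))"
  proof -
    have "dyadic_sum e L (Suc N) = L *\<^sub>R id_blinfun - h *\<^sub>R (\<Sum>i<2 * 2 ^ N. e (- L + real i * h))"
      by (simp add: dyadic_sum_def h_def)
    then show ?thesis by (simp only: sum_double)
  qed
  moreover have "L *\<^sub>R id_blinfun - (2 * h) *\<^sub>R A - (L *\<^sub>R id_blinfun - h *\<^sub>R (A + B)) = h *\<^sub>R (B - A)"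
    for A B :: "'a \<Rightarrow>\<^sub>L 'a"
    unfolding mult_2 scaleR_add_left scaleR_add_right scaleR_diff_right by simp
  ultimately show ?thesis
    by (simp only: sum_subtractf)
qed

lemma spectral_family_mono:
  assumes "spectral_family e" "x \<le> y"
  shows "inner (e x v) v \<le> inner (e y v) v"
  using proj_op_le_iff[of "e x" "e y"] assms
  by (auto simp: spectral_familyD blinfun.diff_left inner_diff_right inner_commute)

text \<open>The increments belong to disjoint intervals, so their forms add up to at most that of
  the identity, and the difference lies between 0 and \<open>h\<close>.\<close>

lemma norm_dyadic_sum_diff:
  fixes e :: "real \<Rightarrow> ('a::real_inner \<Rightarrow>\<^sub>L 'a)"
  assumes e: "spectral_family e" and "L \<ge> 0"
  shows "norm (dyadic_sum e L N - dyadic_sum e L (Suc N)) \<le> L * (1/2) ^ N"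
proof -
  define h where "h = 2 * L / 2 ^ Suc N"
  have h: "h \<ge> 0" using \<open>L \<ge> 0\<close> by (simp add: h_def)
  define y where "y i = - L + real i * h" for i
  have y: "y i \<le> y j" if "i \<le> j" for i j
    using that h by (simp add: y_def mult_right_mono)
  let ?D = "dyadic_sum e L N - dyadic_sum e L (Suc N)"
  have D: "?D = h *\<^sub>R (\<Sum>i<2 ^ N. e (y (Suc (2 * i))) - e (y (2 * i)))"
    unfolding y_def h_def by (rule dyadic_sum_diff)
  have sym: "symmetric_op ?D"
    unfolding D by (intro symmetric_op_scaleR symmetric_op_sum symmetric_op_diff
        proj_opD(1)[OF spectral_familyD(1)[OF e]])
  have form: "\<bar>inner (?D v) v\<bar> \<le> h * (norm v)\<^sup>2" for v
  proof -
    let ?f = "\<lambda>i. inner (e (y i) v) v"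
    have f: "?f i \<le> ?f j" if "i \<le> j" for i j
      by (rule spectral_family_mono[OF e y[OF that]])
    have form: "inner (?D v) v = h * (\<Sum>i<2 ^ N. ?f (Suc (2 * i)) - ?f (2 * i))"
      by (simp add: D blinfun.scaleR_left blinfun.sum_left blinfun.diff_left inner_sum_left
          inner_diff_left)
    \<comment> \<open>Enlarging the half cells to full cells makes the sum telescope.\<close>
    have "(\<Sum>i<2 ^ N. ?f (Suc (2 * i)) - ?f (2 * i)) \<le> (\<Sum>i<2 ^ N. ?f (2 * Suc i) - ?f (2 * i))"
      using f by (intro sum_mono) auto
    also have "\<dots> = ?f (2 * 2 ^ N) - ?f (2 * 0)"
      by (rule sum_lessThan_telescope)
    also have "\<dots> \<le> (norm v)\<^sup>2"
    proof -
      have "?f k = (norm (e (y k) v))\<^sup>2" for k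
        by (rule proj_op_inner[OF spectral_familyD(1)[OF e]])
      moreover have "norm (e (y k) v) \<le> norm v" for k
        by (rule proj_op_norm_le[OF spectral_familyD(1)[OF e]])
      ultimately show ?thesis
        by (smt (verit) norm_ge_zero power_mono zero_le_power2)
    qed
    finally have "inner (?D v) v \<le> h * (norm v)\<^sup>2"
      unfolding form using h by (rule mult_left_mono)
    moreover have "0 \<le> inner (?D v) v"
      unfolding form using h f by (intro mult_nonneg_nonneg sum_nonneg) auto
    ultimately show ?thesis by simp
  qed
  have "norm (?D v) \<le> h * norm v" for v
    by (rule norm_le_quadratic_form[OF sym subspace_UNIV _ form]) auto
  then have "norm ?D \<le> h"
    by (intro norm_blinfun_bound h) (simp add: mult.commute)
  then show ?thesis
    by (simp add: h_def power_one_over field_simps)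
qed

lemma convergent_if_geometric_steps:
  fixes X :: "nat \<Rightarrow> 'b::banach"
  assumes "\<And>n. norm (X n - X (Suc n)) \<le> C * q ^ n" "0 \<le> q" "q < 1"
  shows "convergent X"
proof -
  have "summable (\<lambda>n. C * q ^ n)"
    using assms by (intro summable_mult summable_geometric) auto
  then have "summable (\<lambda>n. X (Suc n) - X n)"
    by (rule summable_comparison_test') (use assms(1) in \<open>simp add: norm_minus_commute\<close>)
  then have "(\<lambda>n. X 0 + (\<Sum>i<n. X (Suc i) - X i)) \<longlonglongrightarrow> X 0 + (\<Sum>i. X (Suc i) - X i)"
    by (intro tendsto_intros summable_LIMSEQ)
  then show ?thesis
    unfolding sum_lessThan_telescope by (auto simp: convergent_def)
qed

text \<open>Cells of width \<open>h\<close> that start at or above \<open>x\<close>, compared with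
  the length of \<open>[x, - L + m * h]\<close>: the first such cell may start almost
  \<open>h\<close> beyond \<open>x\<close>, hence the loss of one cell.\<close>

lemma count_grid_ge:
  fixes h x L :: real
  assumes "h \<ge> 0" "- L \<le> x"
  shows "- L + real m * h - x - h \<le> (\<Sum>i<m. if x \<le> - L + real i * h then h else 0)"
proof (induction m)
  case (Suc m)
  have "0 \<le> (\<Sum>i<m. if x \<le> - L + real i * h then h else 0)"
    using assms by (intro sum_nonneg) auto
  then show ?case
    using Suc by (auto simp: algebra_simps)
qed (use assms in simp)

text \<open>No loss in this direction: the cells that start beyond \<open>x\<close> are disjoint
  parts of \<open>[x, - L + m * h]\<close>. The maximum with 0 covers an \<open>x\<close> beyond the
  grid.\<close>

lemma count_grid_le:
  fixes h x L :: real
  assumes "h \<ge> 0"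
  shows "(\<Sum>i<m. if x < - L + real i * h then h else 0) \<le> max 0 (- L + real m * h - x)"
proof (induction m)
  case (Suc m)
  then show ?case
    using assms by (auto simp: algebra_simps)
qed simp

text \<open>For \<open>v\<close> in the range of \<open>e x\<close> all summands from
  \<open>x\<close> upwards equal \<open>(norm v)\<^sup>2\<close>; for \<open>v\<close> in the kernel
  all summands up to \<open>x\<close> vanish. Counting grid points bounds the sums, in the first
  case up to one mesh width, which tends to 0.\<close>

lemma spectral_bounds_of_limit:
  fixes e :: "real \<Rightarrow> ('a::{real_inner,complete_space} \<Rightarrow>\<^sub>L 'a)"
  assumes e: "spectral_family e" and "L \<ge> 0"
    and L: "\<And>x. x < - L \<Longrightarrow> e x = 0" "\<And>x. x \<ge> L \<Longrightarrow> e x = id_blinfun"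
    and lim: "dyadic_sum e L \<longlonglongrightarrow> d"
  shows "spectral_bounds e d"
  unfolding spectral_bounds_def
proof (intro allI conjI impI)
  fix x v
  define h where "h N = 2 * L / 2 ^ N" for N :: nat
  have h: "h N \<ge> 0" for N
    using \<open>L \<ge> 0\<close> by (simp add: h_def)
  have "(\<lambda>N. 2 * L * (1/2) ^ N) \<longlonglongrightarrow> 2 * L * 0"
    by (intro tendsto_intros LIMSEQ_power_zero) simp
  moreover have "h = (\<lambda>N. 2 * L * (1/2) ^ N)"
    by (simp add: fun_eq_iff h_def power_one_over)
  ultimately have h_lim: "h \<longlonglongrightarrow> 0"
    by simp
  note P = spectral_familyD(1)[OF e]
  have comp: "e x (e y v) = e y (e x v)" for y
    using spectral_family_comp[OF e] by (metis linorder_linear)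
  have "e x (dyadic_sum e L N v) = dyadic_sum e L N (e x v)" for N
    by (simp add: dyadic_sum_def blinfun.diff_left blinfun.scaleR_left blinfun.sum_left
        blinfun.diff_right blinfun.scaleR_right blinfun.sum_right comp)
  moreover have "(\<lambda>N. e x (dyadic_sum e L N v)) \<longlonglongrightarrow> e x (d v)"
    "(\<lambda>N. dyadic_sum e L N (e x v)) \<longlonglongrightarrow> d (e x v)"
    by (intro tendsto_intros lim)+
  ultimately show "e x (d v) = d (e x v)"
    using LIMSEQ_unique by simp
  let ?S = "\<lambda>N. inner (dyadic_sum e L N v) v"
  let ?f = "\<lambda>N i. inner (e (- L + real i * h N) v) v"
  have S: "?S N = L * (norm v)\<^sup>2 - h N * (\<Sum>i<2 ^ N. ?f N i)" for N
    by (simp add: dyadic_sum_def h_def blinfun.diff_left blinfun.scaleR_left blinfun.sum_left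
        inner_diff_left inner_sum_left power2_norm_eq_inner)
  have S_lim: "?S \<longlonglongrightarrow> inner (d v) v"
    by (intro tendsto_intros lim)
  have top: "- L + real (2 ^ N) * h N = L" for N
    by (simp add: h_def)
  have f_nonneg: "0 \<le> ?f N i" for N i
    by (simp add: proj_op_inner[OF P])
  show "inner (d v) v \<le> x * (norm v)\<^sup>2" if fixed: "e x v = v"
  proof (cases "x < - L")
    case True
    then have "v = 0" using fixed L by simp
    then show ?thesis by simp
  next
    case False
    have "?S N \<le> (x + h N) * (norm v)\<^sup>2" for N
    proof -
      have "(L - x - h N) * (norm v)\<^sup>2
          \<le> (\<Sum>i<2 ^ N. if x \<le> - L + real i * h N then h N else 0) * (norm v)\<^sup>2"
        using count_grid_ge[OF h, of L x "2 ^ N" N] False unfolding top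
        by (intro mult_right_mono) auto
      also have "\<dots> \<le> h N * (\<Sum>i<2 ^ N. ?f N i)"
        unfolding sum_distrib_left sum_distrib_right
      proof (rule sum_mono)
        fix i
        show "(if x \<le> - L + real i * h N then h N else 0) * (norm v)\<^sup>2 \<le> h N * ?f N i"
        proof (cases "x \<le> - L + real i * h N")
          case True
          then have "e (- L + real i * h N) v = v"
            using spectral_family_comp(1)[OF e True, of v] fixed by simp
          then show ?thesis using True by (simp add: power2_norm_eq_inner)
        qed (use f_nonneg h in simp)
      qed
      finally show ?thesis
        unfolding S by (simp add: algebra_simps)
    qed
    moreover have "(\<lambda>N. (x + h N) * (norm v)\<^sup>2) \<longlonglongrightarrow> (x + 0) * (norm v)\<^sup>2"
      by (intro tendsto_intros h_lim)
    ultimately show ?thesis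
      using LIMSEQ_le[OF S_lim] by simp
  qed
  show "x * (norm v)\<^sup>2 \<le> inner (d v) v" if zero: "e x v = 0"
  proof (cases "x > L")
    case True
    then have "v = 0" using zero L(2)[of x] by simp
    then show ?thesis by simp
  next
    case False
    have "x * (norm v)\<^sup>2 \<le> ?S N" for N
    proof -
      have "h N * (\<Sum>i<2 ^ N. ?f N i)
          \<le> (\<Sum>i<2 ^ N. if x < - L + real i * h N then h N else 0) * (norm v)\<^sup>2"
        unfolding sum_distrib_left sum_distrib_right
      proof (rule sum_mono)
        fix i
        show "h N * ?f N i \<le> (if x < - L + real i * h N then h N else 0) * (norm v)\<^sup>2"
        proof (cases "x < - L + real i * h N")
          case True
          have "?f N i \<le> (norm v)\<^sup>2"
            using proj_op_norm_le[OF P, of "- L + real i * h N" v]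
            by (simp add: proj_op_inner[OF P] power_mono)
          then show ?thesis using True h by (simp add: mult_left_mono)
        next
          case False
          then have "e (- L + real i * h N) v = e (- L + real i * h N) (e x v)"
            by (simp add: spectral_family_comp(2)[OF e])
          then show ?thesis using False zero by simp
        qed
      qed
      also have "\<dots> \<le> (L - x) * (norm v)\<^sup>2"
        using count_grid_le[OF h, where x = x and L = L and m = "2 ^ N", of N] False unfolding top
        by (intro mult_right_mono) auto
      finally show ?thesis
        unfolding S by (simp add: algebra_simps)
    qed
    then show ?thesis
      using LIMSEQ_le_const[OF S_lim] by blast
  qed
qed

lemma spectral_family_bound:
  assumes "spectral_family e"
  obtains L where "L \<ge> 0" "\<And>x. x < - L \<Longrightarrow> e x = 0" "\<And>x. x \<ge> L \<Longrightarrow> e x = id_blinfun"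
proof -
  obtain K where "\<And>x. x < - K \<Longrightarrow> e x = 0" "\<And>x. x \<ge> K \<Longrightarrow> e x = id_blinfun"
    using assms by (auto simp: spectral_family_def)
  then show thesis
    using that[of "max K 0"] by simp
qed

lemma convergent_dyadic_sum:
  fixes e :: "real \<Rightarrow> ('a::{real_inner,banach} \<Rightarrow>\<^sub>L 'a)"
  assumes "spectral_family e" "L \<ge> 0"
  shows "convergent (dyadic_sum e L)"
  using convergent_if_geometric_steps[of "dyadic_sum e L" L "1/2"] norm_dyadic_sum_diff[OF assms]
  by simp

lemma symmetric_dyadic_sum:
  assumes "spectral_family e"
  shows "symmetric_op (dyadic_sum e L N)"
  unfolding dyadic_sum_def
  by (intro symmetric_op_diff symmetric_op_scaleR symmetric_op_id symmetric_op_sum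
      proj_opD(1)[OF spectral_familyD(1)[OF assms]])

text \<open>On the range of \<open>e y - e x\<close>, both \<open>a\<close> and the Riemann-Stieltjes sum lie between \<open>x\<close> and \<open>y\<close>.\<close>

lemma stieltjes_integral_id_if_spectral_bounds:
  fixes a :: "'h::complex_hilbert_space \<Rightarrow>\<^sub>L 'h"
  assumes e: "spectral_family e" and a: "symmetric_op a" and bounds: "spectral_bounds e a"
  shows "stieltjes_integral_id e a"
  unfolding stieltjes_integral_id_def
proof (intro allI impI, rule exI, intro conjI allI impI)
  fix \<epsilon> :: real assume "\<epsilon> > 0"
  \<comment> \<open>Half of \<open>\<epsilon>\<close>, since summation yields only a weak inequality
    with the mesh.\<close>
  then show "\<epsilon> / 2 > 0" by simp
  fix n and x t :: "nat \<Rightarrow> real"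
  assume "e (x 0) = 0 \<and> e (x n) = id_blinfun \<and>
    (\<forall>i<n. x i \<le> t i \<and> t i \<le> x (Suc i) \<and> x (Suc i) - x i < \<epsilon> / 2)"
  then have ends: "e (x 0) = 0" "e (x n) = id_blinfun"
    and t: "\<And>i. i < n \<Longrightarrow> x i \<le> t i \<and> t i \<le> x (Suc i) \<and> x (Suc i) - x i < \<epsilon> / 2"
    by auto
  note P = spectral_familyD(1)[OF e]
  define E where "E i = e (x (Suc i)) - e (x i)" for i
  let ?D = "a - (\<Sum>i<n. t i *\<^sub>R E i)"
  have E: "proj_op (E i)" if "i < n" for i
    unfolding E_def using t[OF that] by (intro proj_op_diff spectral_familyD[OF e]) auto
  have sum_E: "(\<Sum>i<n. E i) = id_blinfun"
    using sum_lessThan_telescope[of "\<lambda>i. e (x i)" n] by (simp add: E_def ends)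
  have sym: "symmetric_op ?D"
    using a proj_opD(1)[OF E]
    by (intro symmetric_op_diff symmetric_op_sum symmetric_op_scaleR) auto
  have form: "\<bar>inner (?D v) v\<bar> \<le> \<epsilon> / 2 * (norm v)\<^sup>2" for v
  proof -
    have sum_v: "(\<Sum>i<n. E i v) = v"
      using sum_E by (simp flip: blinfun.sum_left)
    have "inner (?D v) v = inner (a (\<Sum>i<n. E i v)) v - (\<Sum>i<n. t i * inner (E i v) v)"
      by (simp add: sum_v blinfun.diff_left blinfun.sum_left blinfun.scaleR_left inner_diff_left
          inner_sum_left)
    also have "\<dots> = (\<Sum>i<n. inner (a (E i v)) v - t i * inner (E i v) v)"
      by (simp add: blinfun.sum_right inner_sum_left sum_subtractf)
    finally have "\<bar>inner (?D v) v\<bar> \<le> (\<Sum>i<n. \<bar>inner (a (E i v)) v - t i * inner (E i v) v\<bar>)"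
      by simp
    also have "\<dots> \<le> (\<Sum>i<n. \<epsilon> / 2 * inner (E i v) v)"
    proof (rule sum_mono)
      fix i assume "i \<in> {..<n}"
      then have "i < n" by simp
      note ti = t[OF this]
      have le: "x i \<le> x (Suc i)" using ti by linarith
      let ?w = "E i v"
      have norm_w: "inner ?w v = (norm ?w)\<^sup>2"
        by (rule proj_op_inner[OF E[OF \<open>i < n\<close>]])
      have "E i (a z) = a (E i z)" for z
        by (simp add: E_def blinfun.diff_left blinfun.diff_right spectral_boundsD(1)[OF bounds])
      then have "E i (a ?w) = a ?w"
        by (simp add: proj_opD(2)[OF E[OF \<open>i < n\<close>]])
      then have "inner (a ?w) v = inner (a ?w) ?w"
        using symmetric_opD[OF proj_opD(1)[OF E[OF \<open>i < n\<close>]], of "a ?w" v] by simp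
      moreover have "inner (a ?w) ?w \<le> x (Suc i) * (norm ?w)\<^sup>2"
        by (rule spectral_boundsD(2)[OF bounds])
          (simp add: E_def blinfun.diff_left blinfun.diff_right spectral_family_comp[OF e le]
            proj_opD(2)[OF P])
      moreover have "x i * (norm ?w)\<^sup>2 \<le> inner (a ?w) ?w"
        by (rule spectral_boundsD(3)[OF bounds])
          (simp add: E_def blinfun.diff_left blinfun.diff_right spectral_family_comp[OF e le]
            proj_opD(2)[OF P])
      moreover have "t i * (norm ?w)\<^sup>2 - \<epsilon> / 2 * (norm ?w)\<^sup>2 \<le> x i * (norm ?w)\<^sup>2"
        using ti unfolding left_diff_distrib[symmetric] by (intro mult_right_mono) auto
      moreover have "x (Suc i) * (norm ?w)\<^sup>2 \<le> t i * (norm ?w)\<^sup>2 + \<epsilon> / 2 * (norm ?w)\<^sup>2"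
        using ti unfolding distrib_right[symmetric] by (intro mult_right_mono) auto
      ultimately show "\<bar>inner (a ?w) v - t i * inner ?w v\<bar> \<le> \<epsilon> / 2 * inner ?w v"
        unfolding norm_w by (simp only: abs_le_iff) linarith
    qed
    also have "\<dots> = \<epsilon> / 2 * inner (\<Sum>i<n. E i v) v"
      by (simp add: inner_sum_left sum_distrib_left)
    finally show ?thesis
      by (simp add: sum_v power2_norm_eq_inner)
  qed
  have "norm (?D v) \<le> \<epsilon> / 2 * norm v" for v
    by (rule norm_le_quadratic_form[OF sym subspace_UNIV _ form]) auto
  then have "norm ?D \<le> \<epsilon> / 2"
    using \<open>\<epsilon> > 0\<close> by (intro norm_blinfun_bound) auto
  then show "norm (a - (\<Sum>i<n. t i *\<^sub>R (e (x (Suc i)) - e (x i)))) < \<epsilon>"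
    using \<open>\<epsilon> > 0\<close> by (simp add: E_def)
qed

text \<open>A single equidistant partition, tagged at left end points, is fine enough for both
  integrals at once.\<close>

lemma stieltjes_integral_id_unique:
  fixes a d :: "'h::complex_hilbert_space \<Rightarrow>\<^sub>L 'h"
  assumes e: "spectral_family e"
    and a: "stieltjes_integral_id e a" and d: "stieltjes_integral_id e d"
  shows "a = d"
proof -
  obtain L where L: "L \<ge> 0" "\<And>x. x < - L \<Longrightarrow> e x = 0" "\<And>x. x \<ge> L \<Longrightarrow> e x = id_blinfun"
    using spectral_family_bound[OF e] by blast
  have "norm (a - d) \<le> 0 + \<epsilon>" if "\<epsilon> > 0" for \<epsilon>
  proof -
    have \<epsilon>: "\<epsilon> / 2 > 0" using that by simp
    let ?P = "\<lambda>\<delta> n x t. e (x 0) = 0 \<and> e (x n) = id_blinfun \<and>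
       (\<forall>i<n. x i \<le> t i \<and> t i \<le> x (Suc i) \<and> x (Suc i) - x i < \<delta>)"
    let ?S = "\<lambda>n x t. \<Sum>i<n. t i *\<^sub>R (e (x (Suc i)) - e (x i))"
    obtain \<delta>1 where \<delta>1: "\<delta>1 > 0" "\<And>n x t. ?P \<delta>1 n x t \<Longrightarrow> norm (a - ?S n x t) < \<epsilon> / 2"
      using a \<epsilon> unfolding stieltjes_integral_id_def by meson
    obtain \<delta>2 where \<delta>2: "\<delta>2 > 0" "\<And>n x t. ?P \<delta>2 n x t \<Longrightarrow> norm (d - ?S n x t) < \<epsilon> / 2"
      using d \<epsilon> unfolding stieltjes_integral_id_def by meson
    define \<delta> where "\<delta> = min \<delta>1 \<delta>2"
    have \<delta>: "0 < \<delta>" "\<delta> \<le> \<delta>1" "\<delta> \<le> \<delta>2"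
      using \<delta>1(1) \<delta>2(1) by (simp_all add: \<delta>_def)
    \<comment> \<open>The family is known to vanish only strictly below \<open>- L\<close>, so the
      grid starts one unit further out; this also keeps \<open>M\<close> positive.\<close>
    define M where "M = L + 1"
    obtain n :: nat where n: "2 * M / \<delta> < real n"
      using reals_Archimedean2 by blast
    have "0 < 2 * M / \<delta>"
      using \<delta>(1) L(1) by (simp add: M_def)
    then have "n > 0" using n by linarith
    define h where "h = 2 * M / real n"
    define x where "x i = - M + real i * h" for i
    have h: "0 \<le> h" "h < \<delta>"
      using n \<open>n > 0\<close> \<delta>(1) L(1)
      by (simp_all add: h_def M_def pos_divide_less_eq mult.commute)
    have step: "x (Suc i) = x i + h" for i
      by (simp add: x_def algebra_simps)
    have ends: "x 0 = - M" "x n = M"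
      using \<open>n > 0\<close> by (simp_all add: x_def h_def)
    have P: "?P \<delta>1 n x x" "?P \<delta>2 n x x"
      using h L \<delta> by (auto simp: step ends M_def)
    have "norm (a - d) \<le> norm (a - ?S n x x) + norm (d - ?S n x x)"
      using norm_triangle_ineq4[of "a - ?S n x x" "d - ?S n x x"] by simp
    then show ?thesis
      using \<delta>1(2)[OF P(1)] \<delta>2(2)[OF P(2)] by linarith
  qed
  then have "norm (a - d) \<le> 0"
    by (rule field_le_epsilon)
  then show ?thesis by simp
qed


section \<open>Complex Hilbert spaces\<close>

instance complex_hilbert_space \<subseteq> banach ..

lemma cinner_scaleC_left: "cinner (c *\<^sub>C x) y = cnj c * cinner x y"
  using cinner_commute[of "c *\<^sub>C x" y] cinner_commute[of x y] by (simp add: cinner_scaleC_right)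

lemma inner_scaleC_left: "inner (c *\<^sub>C x) y = inner x (cnj c *\<^sub>C y)"
  by (simp add: inner_cinner cinner_scaleC_left cinner_scaleC_right)

text \<open>Recovers the complex inner product from its real part, so that real identities for
  complex-linear operators lift to complex ones.\<close>

lemma cinner_eq_Complex: "cinner x y = Complex (inner x y) (- inner x (\<i> *\<^sub>C y))"
  by (simp add: complex_eq_iff inner_cinner cinner_scaleC_right)

lemma norm_scaleC: "norm (c *\<^sub>C x) = cmod c * norm x" for x :: "'h::complex_hilbert_space"
proof -
  have "cinner (c *\<^sub>C x) (c *\<^sub>C x) = of_real ((cmod c)\<^sup>2) * cinner x x"
    unfolding complex_norm_square by (simp add: cinner_scaleC_left cinner_scaleC_right)
  then have "(norm (c *\<^sub>C x))\<^sup>2 = (cmod c * norm x)\<^sup>2"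
    by (simp add: power2_norm_eq_inner inner_cinner power_mult_distrib)
  then show ?thesis
    by (rule power2_eq_imp_eq) simp_all
qed

lemma scalar_op_apply: "scalar_op c x = c *\<^sub>C x"
proof -
  have "bounded_linear (scaleC c :: 'a \<Rightarrow> 'a)"
  proof (rule bounded_linear_intro)
    show "c *\<^sub>C r *\<^sub>R x = r *\<^sub>R c *\<^sub>C x" for r and x :: 'a
      by (simp add: scaleR_scaleC scaleC_scaleC mult.commute)
    show "norm (c *\<^sub>C x) \<le> norm x * cmod c" for x :: 'a
      by (simp add: norm_scaleC)
  qed (rule scaleC_add_right)
  then show ?thesis
    by (simp add: scalar_op_def bounded_linear_Blinfun_apply)
qed

lemma scalar_op_of_real: "scalar_op (of_real r) o\<^sub>L T = r *\<^sub>R T"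
  by (rule blinfun_eqI) (simp add: scalar_op_apply blinfun.scaleR_left scaleR_scaleC)

lemma cblinopsD: "T \<in> cblinops \<Longrightarrow> T (c *\<^sub>C x) = c *\<^sub>C T x"
  by (simp add: cblinops_def)

lemma cblinops_commute_scalar: "T \<in> cblinops \<Longrightarrow> T (scalar_op c x) = scalar_op c (T x)"
  by (simp add: scalar_op_apply cblinopsD)

lemma cinner_adjoint:
  assumes "T \<in> cblinops" "\<And>x y. inner (blinfun_apply S x) y = inner x (blinfun_apply T y)"
  shows "cinner (S x) y = cinner x (T y)"
  by (simp add: cinner_eq_Complex assms flip: cblinopsD)

lemma adjoint_op_eqI:
  assumes T: "T \<in> cblinops" and S: "\<And>x y. inner (blinfun_apply S x) y = inner x (blinfun_apply T y)"
  shows "adjoint_op T = S"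
  unfolding adjoint_op_def
proof (rule the_equality)
  show "\<forall>x y. cinner (S x) y = cinner x (T y)"
    using cinner_adjoint[OF assms] by blast
  fix S' assume S': "\<forall>x y. cinner (blinfun_apply S' x) y = cinner x (T y)"
  show "S' = S"
  proof (rule blinfun_eqI, rule vector_eq_rdot[THEN iffD1], rule allI)
    show "inner (S' x) y = inner (S x) y" for x y
      using S'[rule_format, of x y] S[of x y] by (simp add: inner_cinner)
  qed
qed

lemma inner_adjoint_op:
  assumes "T \<in> cblinops"
  shows "inner (adjoint_op T x) y = inner x (T y)"
  using adjoint_exists[of T] adjoint_op_eqI[OF assms] by metis

lemma adjoint_op_eq_self_iff:
  assumes "T \<in> cblinops"
  shows "adjoint_op T = T \<longleftrightarrow> symmetric_op T"
  using inner_adjoint_op[OF assms] adjoint_op_eqI[OF assms, of T]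
  by (metis symmetric_op_def)

lemma self_adjoints_iff:
  assumes "M \<subseteq> cblinops"
  shows "T \<in> self_adjoints M \<longleftrightarrow> T \<in> M \<and> symmetric_op T"
  using adjoint_op_eq_self_iff[of T] assms by (auto simp: self_adjoints_def)

lemma projections_iff: "P \<in> projections \<longleftrightarrow> P \<in> cblinops \<and> proj_op P"
proof -
  have "P o\<^sub>L P = P \<longleftrightarrow> (\<forall>x. P (P x) = P x)"
    by (metis blinfun_apply_blinfun_compose blinfun_eqI)
  then show ?thesis
    by (auto simp: projections_def self_adjoints_iff proj_op_def)
qed

text \<open>\<open>op_le\<close> asks the complex form to be real as well as nonnegative; symmetry
  and complex linearity of the difference provide the former.\<close>

lemma op_le_projections_iff:
  assumes "P \<in> projections" "Q \<in> projections"
  shows "op_le P Q \<longleftrightarrow> fixed_space P \<subseteq> fixed_space Q"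
proof -
  have D: "Q - P \<in> cblinops"
    using assms by (simp add: projections_iff cblinops_def blinfun.diff_left)
      (metis scaleC_add_right add_diff_cancel diff_add_cancel)
  have "symmetric_op (Q - P)"
    using assms by (intro symmetric_op_diff) (auto simp: projections_iff proj_opD)
  then have "cnj (cinner x ((Q - P) x)) = cinner x ((Q - P) x)" for x
    using cinner_adjoint[OF D, of "Q - P" x x] cinner_commute[of "(Q - P) x" x]
    by (simp add: symmetric_opD)
  then have "Im (cinner x ((Q - P) x)) = 0" for x
    by (metis Reals_cnj_iff complex_is_Real_iff)
  then have "op_le P Q \<longleftrightarrow> (\<forall>x. 0 \<le> inner x ((Q - P) x))"
    by (simp add: op_le_def complex_nonneg_Reals_iff inner_cinner)
  also have "\<dots> \<longleftrightarrow> fixed_space P \<subseteq> fixed_space Q"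
    using assms by (intro proj_op_le_iff) (auto simp: projections_iff)
  finally show ?thesis .
qed

lemma orth_proj_in_projections:
  assumes V: "closed V" "subspace V" and "\<And>c x. x \<in> V \<Longrightarrow> c *\<^sub>C x \<in> V"
  shows "orth_proj V \<in> projections"
proof -
  have "orth_proj V (scalar_op c x) = scalar_op c (orth_proj V x)" for c x
    by (rule orth_proj_commute[OF V, where S' = "scalar_op (cnj c)"])
      (simp_all add: scalar_op_apply inner_scaleC_left assms)
  then show ?thesis
    by (simp add: projections_iff cblinops_def scalar_op_apply proj_op_orth_proj[OF V])
qed

text \<open>The two forms of right continuity agree because the projection onto the intersection of
  the ranges of \<open>e y\<close> for \<open>y > x\<close> is complex linear, hence an admissible
  \<open>P\<close>.\<close>

lemma resolution_of_identity_iff: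
  "resolution_of_identity e \<longleftrightarrow> (\<forall>x. e x \<in> cblinops) \<and> spectral_family e"
proof
  assume e: "resolution_of_identity e"
  then have P: "e x \<in> projections" for x
    by (simp add: resolution_of_identity_def)
  have "(\<Inter>y\<in>{x<..}. fixed_space (e y)) \<subseteq> fixed_space (e x)" for x
  proof -
    let ?W = "\<Inter>y\<in>{x<..}. fixed_space (e y)"
    have W: "closed ?W" "subspace ?W"
      by (auto intro!: closed_INT subspace_Inter closed_fixed_space subspace_fixed_space)
    have "orth_proj ?W \<in> projections"
      using P by (intro orth_proj_in_projections W)
        (auto simp: fixed_space_iff projections_iff cblinopsD)
    moreover have "op_le (orth_proj ?W) (e y)" if "y > x" for y
      using that unfolding op_le_projections_iff[OF calculation P] fixed_space_orth_proj[OF W]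
      by auto
    ultimately have "op_le (orth_proj ?W) (e x)"
      using e by (auto simp: resolution_of_identity_def)
    then show ?thesis
      unfolding op_le_projections_iff[OF \<open>orth_proj ?W \<in> projections\<close> P] fixed_space_orth_proj[OF W] .
  qed
  moreover have "fixed_space (e x) \<subseteq> fixed_space (e y)" if "x \<le> y" for x y
    using e that unfolding resolution_of_identity_def op_le_projections_iff[OF P P] by blast
  moreover have "\<exists>K. (\<forall>x. x < - K \<longrightarrow> e x = 0) \<and> (\<forall>x\<ge>K. e x = id_blinfun)"
    using e by (simp add: resolution_of_identity_def)
  ultimately show "(\<forall>x. e x \<in> cblinops) \<and> spectral_family e"
    using P unfolding spectral_family_def projections_iff by blast
next
  assume e: "(\<forall>x. e x \<in> cblinops) \<and> spectral_family e"
  then have P: "e x \<in> projections" for x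
    by (simp add: projections_iff spectral_familyD)
  have "op_le P (e x)" if "P \<in> projections" "\<And>y. y > x \<Longrightarrow> op_le P (e y)" for P x
    using that(2) spectral_familyD(3)[OF conjunct2[OF e], of x]
    unfolding op_le_projections_iff[OF that(1) P] by blast
  moreover have "op_le (e x) (e y)" if "x \<le> y" for x y
    using e that unfolding op_le_projections_iff[OF P P] by (blast dest: spectral_familyD(2))
  moreover have "\<exists>K. (\<forall>x. x < - K \<longrightarrow> e x = 0) \<and> (\<forall>x\<ge>K. e x = id_blinfun)"
    using e by (simp add: spectral_family_def)
  ultimately show "resolution_of_identity e"
    using P unfolding resolution_of_identity_def by blast
qed


section \<open>The spectral theorem\<close>

text \<open>A priori the limit depends on \<open>L\<close>, but every limit is a Stieltjes integral
  of \<open>e\<close>, and that integral is unique. The freedom in \<open>L\<close> later puts two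
  operators on one grid.\<close>

lemma spectral_family_integral:
  fixes e :: "real \<Rightarrow> ('h::complex_hilbert_space \<Rightarrow>\<^sub>L 'h)"
  assumes e: "spectral_family e"
  obtains d where "symmetric_op d" "spectral_bounds e d" "stieltjes_integral_id e d"
    "\<And>L. L \<ge> 0 \<Longrightarrow> (\<And>x. x < - L \<Longrightarrow> e x = 0) \<Longrightarrow> (\<And>x. x \<ge> L \<Longrightarrow> e x = id_blinfun) \<Longrightarrow>
      dyadic_sum e L \<longlonglongrightarrow> d"
proof -
  have lim: "\<exists>d. dyadic_sum e L \<longlonglongrightarrow> d \<and> symmetric_op d \<and> spectral_bounds e d \<and> stieltjes_integral_id e d"
    if L: "L \<ge> 0" "\<And>x. x < - L \<Longrightarrow> e x = 0" "\<And>x. x \<ge> L \<Longrightarrow> e x = id_blinfun" for L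
  proof -
    obtain d where d: "dyadic_sum e L \<longlonglongrightarrow> d"
      using convergent_dyadic_sum[OF e L(1)] by (auto simp: convergent_def)
    moreover have "symmetric_op d"
      using symmetric_dyadic_sum[OF e] d by (rule symmetric_op_limit)
    moreover have "spectral_bounds e d"
      by (rule spectral_bounds_of_limit[OF e L d])
    ultimately show ?thesis
      using stieltjes_integral_id_if_spectral_bounds[OF e] by blast
  qed
  obtain L where L: "L \<ge> 0" "\<And>x. x < - L \<Longrightarrow> e x = 0" "\<And>x. x \<ge> L \<Longrightarrow> e x = id_blinfun"
    using spectral_family_bound[OF e] by blast
  obtain d where d: "symmetric_op d" "spectral_bounds e d" "stieltjes_integral_id e d"
    using lim[OF L] by blast
  have "dyadic_sum e L' \<longlonglongrightarrow> d"
    if "L' \<ge> 0" "\<And>x. x < - L' \<Longrightarrow> e x = 0" "\<And>x. x \<ge> L' \<Longrightarrow> e x = id_blinfun" for L'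
    using lim[OF that] stieltjes_integral_id_unique[OF e _ d(3)] by blast
  with d show thesis using that by blast
qed

text \<open>Any family \<open>f\<close> with integral \<open>a\<close> also has an integral
  satisfying \<open>spectral_bounds\<close>; the two coincide, so \<open>f\<close> is
  \<open>spectral_projection a\<close>.\<close>

lemma spectral_resolution_eq:
  assumes e: "spectral_family e" "\<And>x. e x \<in> cblinops" and a: "stieltjes_integral_id e a"
  shows "spectral_resolution a = e" "symmetric_op a" "e = spectral_projection a"
proof -
  have *: "symmetric_op a \<and> f = spectral_projection a"
    if f: "spectral_family f" "stieltjes_integral_id f a" for f
  proof -
    obtain d where d: "symmetric_op d" "spectral_bounds f d" "stieltjes_integral_id f d"
      using spectral_family_integral[OF f(1)] by blast
    then have "a = d"
      using stieltjes_integral_id_unique[OF f] by blast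
    then show ?thesis
      using d spectral_family_unique[OF d(1) f(1) d(2)] by simp
  qed
  show "symmetric_op a" "e = spectral_projection a"
    using *[OF e(1) a] by auto
  show "spectral_resolution a = e"
    unfolding spectral_resolution_def
  proof (rule the_equality)
    show "resolution_of_identity e \<and> stieltjes_integral_id e a"
      using e a by (simp add: resolution_of_identity_iff)
    show "f = e" if "resolution_of_identity f \<and> stieltjes_integral_id f a" for f
      using *[of f] *[OF e(1) a] that by (simp add: resolution_of_identity_iff)
  qed
qed

context
  fixes a :: "'h::complex_hilbert_space \<Rightarrow>\<^sub>L 'h"
  assumes a: "symmetric_op a" "a \<in> cblinops"
begin

lemma spectral_projection_in_projections: "spectral_projection a x \<in> projections"
proof -
  have "spectral_projection a x (scalar_op c v) = scalar_op c (spectral_projection a x v)" for c v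
    by (rule spectral_projection_commute[OF a(1), where S' = "scalar_op (cnj c)"])
      (simp_all add: scalar_op_apply inner_scaleC_left cblinopsD[OF a(2)])
  then show ?thesis
    using spectral_familyD(1)[OF spectral_family_spectral_projection[OF a(1)]]
    by (simp add: projections_iff cblinops_def scalar_op_apply)
qed

lemma stieltjes_integral_spectral_projection: "stieltjes_integral_id (spectral_projection a) a"
  by (rule stieltjes_integral_id_if_spectral_bounds[OF
        spectral_family_spectral_projection[OF a(1)] a(1) spectral_bounds_spectral_projection[OF a(1)]])

lemma spectral_resolution_eq_spectral_projection: "spectral_resolution a = spectral_projection a"
  using spectral_projection_in_projections
  by (intro spectral_resolution_eq(1)[OF spectral_family_spectral_projection[OF a(1)] _
        stieltjes_integral_spectral_projection]) (simp add: projections_iff)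

lemma dyadic_sum_spectral_projection:
  assumes "L \<ge> norm a"
  shows "dyadic_sum (spectral_projection a) L \<longlonglongrightarrow> a"
proof -
  note e = spectral_family_spectral_projection[OF a(1)]
  obtain d where d: "stieltjes_integral_id (spectral_projection a) d"
    and lim: "\<And>L. L \<ge> 0 \<Longrightarrow> (\<And>x. x < - L \<Longrightarrow> spectral_projection a x = 0) \<Longrightarrow>
      (\<And>x. x \<ge> L \<Longrightarrow> spectral_projection a x = id_blinfun) \<Longrightarrow>
      dyadic_sum (spectral_projection a) L \<longlonglongrightarrow> d"
    using spectral_family_integral[OF e] by blast
  have "dyadic_sum (spectral_projection a) L \<longlonglongrightarrow> d"
  proof (rule lim)
    show "0 \<le> L" using assms norm_ge_zero[of a] by linarith
  qed (use assms in \<open>auto intro: spectral_projection_eq_0[OF a(1)] spectral_projection_eq_id[OF a(1)]\<close>)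
  moreover have "d = a"
    by (rule stieltjes_integral_id_unique[OF e d stieltjes_integral_spectral_projection])
  ultimately show ?thesis by simp
qed

end

lemma spectral_le_iff:
  assumes "symmetric_op a" "a \<in> cblinops" "symmetric_op b" "b \<in> cblinops"
  shows "spectral_le a b \<longleftrightarrow>
    (\<forall>x. fixed_space (spectral_projection b x) \<subseteq> fixed_space (spectral_projection a x))"
  using assms by (simp add: spectral_le_def spectral_resolution_eq_spectral_projection
      op_le_projections_iff spectral_projection_in_projections)

lemma spectral_le_antisym:
  assumes a: "symmetric_op a" "a \<in> cblinops" and b: "symmetric_op b" "b \<in> cblinops"
    and "spectral_le a b" "spectral_le b a"
  shows "a = b"
proof -
  note fam = spectral_family_spectral_projection
  have "fixed_space (spectral_projection a x) = fixed_space (spectral_projection b x)" for x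
    using assms by (simp add: spectral_le_iff set_eq_subset)
  then have "spectral_projection a = spectral_projection b"
    using proj_op_eq_orth_proj[OF spectral_familyD(1)[OF fam[OF a(1)]]]
      proj_op_eq_orth_proj[OF spectral_familyD(1)[OF fam[OF b(1)]]]
    by (metis ext)
  then show ?thesis
    using stieltjes_integral_id_unique[OF fam[OF a(1)] stieltjes_integral_spectral_projection[OF a]]
      stieltjes_integral_spectral_projection[OF b] by simp
qed


section \<open>Outer daseinisation\<close>

lemma von_neumann_algebraD:
  assumes "von_neumann_algebra M"
  shows "M \<subseteq> cblinops" "id_blinfun \<in> M"
    and "S \<in> M \<Longrightarrow> T \<in> M \<Longrightarrow> S + T \<in> M" "S \<in> M \<Longrightarrow> T \<in> M \<Longrightarrow> S o\<^sub>L T \<in> M"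
    and "T \<in> M \<Longrightarrow> scalar_op c o\<^sub>L T \<in> M" "T \<in> M \<Longrightarrow> adjoint_op T \<in> M"
  using assms by (auto simp: von_neumann_algebra_def unital_star_algebra_def)

lemma commutantD:
  assumes "T \<in> commutant M"
  shows "T \<in> cblinops" and "S \<in> M \<Longrightarrow> T (S x) = S (T x)"
  using assms unfolding commutant_def by (auto simp flip: blinfun_apply_blinfun_compose)

lemma commutantI:
  assumes "T \<in> cblinops" "\<And>S x. S \<in> M \<Longrightarrow> blinfun_apply T (blinfun_apply S x) = S (T x)"
  shows "T \<in> commutant M"
  using assms unfolding commutant_def by (auto intro!: blinfun_eqI)

lemma von_neumann_algebra_memI:
  assumes "von_neumann_algebra M" "T \<in> cblinops"
    and "\<And>S x. S \<in> commutant M \<Longrightarrow> blinfun_apply T (blinfun_apply S x) = S (T x)"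
  shows "T \<in> M"
proof -
  have "T \<in> commutant (commutant M)"
    using assms(2,3) by (rule commutantI)
  then show ?thesis
    using assms(1) by (simp add: von_neumann_algebra_def)
qed

text \<open>Since \<open>M\<close> is closed under adjoints, so is its commutant;
  \<open>orth_proj_commute\<close> needs the operator and its adjoint.\<close>

lemma commutant_adjoint:
  assumes M: "von_neumann_algebra M" and T: "T \<in> commutant M"
  obtains T' where "T' \<in> commutant M" "\<And>x y. inner (blinfun_apply T x) y = inner x (blinfun_apply T' y)"
proof -
  obtain T' :: "'a \<Rightarrow>\<^sub>L 'a" where T': "\<And>x y. inner (T' x) y = inner x (T y)"
    using adjoint_exists by blast
  have "T' \<in> commutant M"
  proof (rule commutantI)
    have "inner (T' (c *\<^sub>C x)) y = inner (c *\<^sub>C T' x) y" for c x y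
      by (simp add: T' inner_scaleC_left cblinopsD[OF commutantD(1)[OF T]])
    then show "T' \<in> cblinops"
      unfolding cblinops_def by (blast intro: vector_eq_rdot[THEN iffD1])
    fix S x assume S: "S \<in> M"
    have S': "inner (S u) v = inner u (adjoint_op S v)" for u v
      using inner_adjoint_op[of S v u] von_neumann_algebraD(1)[OF M] S
      by (auto simp: inner_commute)
    have "inner (T' (S x)) y = inner (S (T' x)) y" for y
      by (simp add: T' S' commutantD(2)[OF T von_neumann_algebraD(6)[OF M S]])
    then show "T' (S x) = S (T' x)"
      by (blast intro: vector_eq_rdot[THEN iffD1])
  qed
  moreover have "inner (T x) y = inner x (T' y)" for x y
    using T'[of y x] by (simp add: inner_commute)
  ultimately show thesis by (rule that)
qed

lemma orth_proj_mem:
  assumes M: "von_neumann_algebra M" and V: "closed V" "subspace V"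
    and inv: "\<And>T x. T \<in> commutant M \<Longrightarrow> x \<in> V \<Longrightarrow> blinfun_apply T x \<in> V"
  shows "orth_proj V \<in> M"
proof (rule von_neumann_algebra_memI[OF M])
  \<comment> \<open>Scalars lie in the commutant, so \<open>V\<close> is automatically a complex
    subspace.\<close>
  have "scalar_op c \<in> commutant M" for c
    using von_neumann_algebraD(1)[OF M]
    by (intro commutantI) (auto simp: cblinops_def scalar_op_apply scaleC_scaleC mult.commute)
  then have "c *\<^sub>C x \<in> V" if "x \<in> V" for c x
    using inv[of "scalar_op c" x] that by (simp add: scalar_op_apply)
  then show "orth_proj V \<in> cblinops"
    using orth_proj_in_projections[OF V] by (simp add: projections_iff)
  fix T x assume T: "T \<in> commutant M"
  then obtain T' where T': "T' \<in> commutant M" "\<And>x y. inner (T x) y = inner x (T' y)"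
    using commutant_adjoint[OF M] by blast
  show "orth_proj V (T x) = T (orth_proj V x)"
    by (rule orth_proj_commute[OF V T'(2) inv[OF T] inv[OF T'(1)]])
qed

lemma spectral_projection_mem:
  assumes M: "von_neumann_algebra M" and a: "a \<in> M" "symmetric_op a"
  shows "spectral_projection a x \<in> M"
  unfolding spectral_projection_def
proof (rule orth_proj_mem[OF M spectral_closed_subspace[OF a(2)]])
  fix T v assume T: "T \<in> commutant M" and v: "v \<in> spectral_subspace (nonneg_shift a) (x + norm a)"
  show "T v \<in> spectral_subspace (nonneg_shift a) (x + norm a)"
    by (rule spectral_subspace_invariant[OF symmetric_nonneg_shift[OF a(2)] _ v])
      (simp add: nonneg_shift_apply blinfun.add_right blinfun.scaleR_right commutantD(2)[OF T a(1)])
qed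

text \<open>Commutation with all \<open>e y\<close> passes to sums and limits. Applied to scalars it
  gives complex linearity, applied to the commutant it gives membership.\<close>

lemma dyadic_sum_limit_mem:
  assumes M: "von_neumann_algebra M" and e: "\<And>x. e x \<in> M" and lim: "dyadic_sum e L \<longlonglongrightarrow> d"
  shows "d \<in> M"
proof -
  have comm: "d (S x) = S (d x)" if S: "\<And>y x. e y (blinfun_apply S x) = S (e y x)" for S x
  proof -
    have "dyadic_sum e L N (S x) = S (dyadic_sum e L N x)" for N
      by (simp add: dyadic_sum_def blinfun.diff_left blinfun.scaleR_left blinfun.sum_left
          blinfun.diff_right blinfun.scaleR_right blinfun.sum_right S)
    moreover have "(\<lambda>N. dyadic_sum e L N (S x)) \<longlonglongrightarrow> d (S x)"
      "(\<lambda>N. S (dyadic_sum e L N x)) \<longlonglongrightarrow> S (d x)"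
      by (intro tendsto_intros lim)+
    ultimately show ?thesis
      using LIMSEQ_unique by simp
  qed
  show ?thesis
  proof (rule von_neumann_algebra_memI[OF M])
    have "d (scalar_op c x) = scalar_op c (d x)" for c x
      using e von_neumann_algebraD(1)[OF M] by (intro comm cblinops_commute_scalar) blast
    then show "d \<in> cblinops"
      by (simp add: cblinops_def scalar_op_apply)
    show "d (S x) = S (d x)" if "S \<in> commutant M" for S x
      by (rule comm) (simp add: commutantD(2)[OF that e])
  qed
qed

text \<open>Defined vector by vector, hence monotone in \<open>V\<close> and compatible with
  intersections; this transports monotonicity and right continuity of a family of ranges.\<close>

definition invariant_part :: "('h::complex_hilbert_space \<Rightarrow>\<^sub>L 'h) set \<Rightarrow> 'h set \<Rightarrow> 'h set"
  where "invariant_part M V = {v. \<forall>T\<in>commutant M. T v \<in> V}"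

lemma commutant_id: "id_blinfun \<in> commutant M"
  by (rule commutantI) (auto simp: cblinops_def)

lemma commutant_compose:
  assumes "S \<in> commutant M" "T \<in> commutant M"
  shows "S o\<^sub>L T \<in> commutant M"
  by (rule commutantI) (simp_all add: cblinops_def commutantD[OF assms(1)] commutantD[OF assms(2)]
      cblinopsD[OF commutantD(1)[OF assms(1)]] cblinopsD[OF commutantD(1)[OF assms(2)]])

lemma closed_invariant_part:
  assumes "closed V"
  shows "closed (invariant_part M V)"
proof -
  have "invariant_part M V = (\<Inter>T\<in>commutant M. blinfun_apply T -` V)"
    by (auto simp: invariant_part_def)
  then show ?thesis
    by (auto intro!: closed_INT continuous_closed_vimage[OF assms]
        linear_continuous_at[OF blinfun.bounded_linear_right])
qed

lemma subspace_invariant_part: "subspace V \<Longrightarrow> subspace (invariant_part M V)"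
  by (simp add: subspace_def invariant_part_def blinfun.add_right blinfun.scaleR_right)

lemma invariant_part_subset: "invariant_part M V \<subseteq> V"
  using commutant_id by (force simp: invariant_part_def)

lemma commutant_invariant_part:
  assumes "T \<in> commutant M" "v \<in> invariant_part M V"
  shows "T v \<in> invariant_part M V"
  using assms(2) commutant_compose[OF _ assms(1)] by (force simp: invariant_part_def)

text \<open>The operator \<open>d\<close> constructed here itself lies in \<open>M\<close> and above
  \<open>a\<close>, so the infimum is a minimum; antisymmetry of the spectral order makes the
  description in \<open>outer_das\<close> unique.\<close>

lemma outer_das_least:
  assumes M: "von_neumann_algebra M" and a: "symmetric_op a" "a \<in> cblinops"
  shows "outer_das a M \<in> self_adjoints M" "spectral_le a (outer_das a M)"
    and "\<And>b. b \<in> self_adjoints M \<Longrightarrow> spectral_le a b \<Longrightarrow> spectral_le (outer_das a M) b"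
proof -
  note Mc = von_neumann_algebraD(1)[OF M]
  note fam = spectral_family_spectral_projection[OF a(1)]
  let ?V = "\<lambda>x. invariant_part M (fixed_space (spectral_projection a x))"
  have V: "closed (?V x)" "subspace (?V x)" for x
    by (simp_all add: closed_invariant_part subspace_invariant_part closed_fixed_space subspace_fixed_space)
  define e where "e x = orth_proj (?V x)" for x
  have fixed_e: "fixed_space (e x) = ?V x" for x
    unfolding e_def by (rule fixed_space_orth_proj[OF V])
  have eM: "e x \<in> M" for x
    unfolding e_def by (rule orth_proj_mem[OF M V]) (rule commutant_invariant_part)
  have e_proj: "proj_op (e x)" for x
    unfolding e_def by (rule proj_op_orth_proj[OF V])
  have "?V x \<subseteq> ?V y" if "x \<le> y" for x y
    using spectral_familyD(2)[OF fam that] by (auto simp: invariant_part_def)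
  moreover have "(\<Inter>y\<in>{x<..}. ?V y) \<subseteq> ?V x" for x
    using spectral_familyD(3)[OF fam, of x] by (auto simp: invariant_part_def)
  moreover have "e x = 0" if "x < - norm a" for x
  proof (rule blinfun_eqI)
    fix v
    have "e x v \<in> fixed_space (e x)"
      using proj_opD(2)[OF e_proj] by (simp add: fixed_space_iff)
    then have "e x v \<in> fixed_space (spectral_projection a x)"
      unfolding fixed_e using invariant_part_subset by blast
    then show "e x v = blinfun_apply 0 v"
      by (simp add: spectral_projection_eq_0[OF a(1) that] fixed_space_iff)
  qed
  moreover have "e x = id_blinfun" if "x \<ge> norm a" for x
  proof (rule blinfun_eqI)
    have "?V x = UNIV"
      using spectral_projection_eq_id[OF a(1) that] by (auto simp: invariant_part_def fixed_space_iff)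
    then show "e x v = id_blinfun v" for v
      using fixed_e[of x] by (auto simp: fixed_space_iff)
  qed
  ultimately have e: "spectral_family e"
    unfolding spectral_family_def fixed_e using e_proj by blast
  obtain d where d: "symmetric_op d" "stieltjes_integral_id e d"
    and lim: "\<And>L. L \<ge> 0 \<Longrightarrow> (\<And>x. x < - L \<Longrightarrow> e x = 0) \<Longrightarrow> (\<And>x. x \<ge> L \<Longrightarrow> e x = id_blinfun) \<Longrightarrow>
      dyadic_sum e L \<longlonglongrightarrow> d"
    using spectral_family_integral[OF e] by blast
  obtain L where "dyadic_sum e L \<longlonglongrightarrow> d"
    using spectral_family_bound[OF e] lim by metis
  then have dM: "d \<in> M"
    by (rule dyadic_sum_limit_mem[OF M eM])
  then have dc: "d \<in> cblinops" using Mc by blast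
  \<comment> \<open>Uniqueness of the spectral family turns comparisons with \<open>d\<close> into
    inclusions for the ranges of \<open>e\<close>.\<close>
  have res_d: "spectral_projection d = e"
    using spectral_resolution_eq(3)[OF e _ d(2)] eM Mc by blast
  have sa: "b \<in> self_adjoints M \<longleftrightarrow> b \<in> M \<and> symmetric_op b" for b
    by (rule self_adjoints_iff[OF Mc])
  have d_sa: "d \<in> self_adjoints M"
    using d dM by (simp add: sa)
  have a_le_d: "spectral_le a d"
    unfolding spectral_le_iff[OF a d(1) dc] res_d fixed_e using invariant_part_subset by blast
  have d_least: "spectral_le d b" if b: "b \<in> self_adjoints M" "spectral_le a b" for b
  proof -
    have b': "symmetric_op b" "b \<in> M" "b \<in> cblinops"
      using b(1) Mc by (auto simp: sa)
    have sub: "fixed_space (spectral_projection b x) \<subseteq> fixed_space (spectral_projection a x)" for x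
      using b(2) by (simp add: spectral_le_iff[OF a b'(1,3)])
    \<comment> \<open>The spectral projections of \<open>b\<close> lie in \<open>M\<close>, so the
      commutant preserves their ranges, which are therefore contained in the invariant part.\<close>
    have "T v \<in> fixed_space (spectral_projection b x)"
      if "T \<in> commutant M" "v \<in> fixed_space (spectral_projection b x)" for T v x
      using commutantD(2)[OF that(1) spectral_projection_mem[OF M b'(2,1)], of x v] that(2)
      by (simp add: fixed_space_iff)
    then show ?thesis
      unfolding spectral_le_iff[OF d(1) dc b'(1,3)] res_d fixed_e
      unfolding invariant_part_def using sub by blast
  qed
  have "outer_das a M = d"
    unfolding outer_das_def Let_def
  proof (rule the_equality)
    show "d \<in> self_adjoints M \<and> (\<forall>b\<in>{b \<in> self_adjoints M. spectral_le a b}. spectral_le d b) \<and>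
        (\<forall>c\<in>self_adjoints M. (\<forall>b\<in>{b \<in> self_adjoints M. spectral_le a b}. spectral_le c b) \<longrightarrow>
          spectral_le c d)"
      using d_sa a_le_d d_least by blast
    fix d' assume d': "d' \<in> self_adjoints M \<and> (\<forall>b\<in>{b \<in> self_adjoints M. spectral_le a b}. spectral_le d' b) \<and>
        (\<forall>c\<in>self_adjoints M. (\<forall>b\<in>{b \<in> self_adjoints M. spectral_le a b}. spectral_le c b) \<longrightarrow>
          spectral_le c d')"
    have "spectral_le d' d" "spectral_le d d'"
      using d' d_sa a_le_d d_least by blast+
    moreover have "symmetric_op d'" "d' \<in> cblinops"
      using d' Mc by (auto simp: sa)
    ultimately show "d' = d"
      using d(1) dc by (intro spectral_le_antisym)
  qed
  with d_sa a_le_d d_least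
  show "outer_das a M \<in> self_adjoints M" "spectral_le a (outer_das a M)"
    and "\<And>b. b \<in> self_adjoints M \<Longrightarrow> spectral_le a b \<Longrightarrow> spectral_le (outer_das a M) b"
    by auto
qed


section \<open>Characters\<close>

context
  fixes C :: "('h::complex_hilbert_space \<Rightarrow>\<^sub>L 'h) set"
  assumes C: "von_neumann_algebra C"
begin

lemma scaleR_mem: "T \<in> C \<Longrightarrow> r *\<^sub>R T \<in> C"
  using von_neumann_algebraD(5)[OF C, of T "of_real r"] by (simp add: scalar_op_of_real)

lemma zero_mem: "0 \<in> C"
  using scaleR_mem[OF von_neumann_algebraD(2)[OF C], of 0] by simp

lemma diff_mem: "S \<in> C \<Longrightarrow> T \<in> C \<Longrightarrow> S - T \<in> C"
  using von_neumann_algebraD(3)[OF C, of S "(- 1) *\<^sub>R T"] scaleR_mem[of T "- 1"] by simp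

lemma sum_mem: "(\<And>i. i \<in> I \<Longrightarrow> f i \<in> C) \<Longrightarrow> sum f I \<in> C"
  by (induction I rule: infinite_finite_induct) (auto simp: zero_mem von_neumann_algebraD(3)[OF C])

lemma dyadic_sum_mem:
  assumes "\<And>x. e x \<in> C"
  shows "dyadic_sum e L N \<in> C"
  unfolding dyadic_sum_def
  by (intro diff_mem scaleR_mem sum_mem von_neumann_algebraD(2)[OF C] assms)

context
  fixes \<omega> :: "('h \<Rightarrow>\<^sub>L 'h) \<Rightarrow> complex"
  assumes \<omega>: "\<omega> \<in> gelfand_spectrum C"
begin

lemma character_add: "S \<in> C \<Longrightarrow> T \<in> C \<Longrightarrow> \<omega> (S + T) = \<omega> S + \<omega> T"
  and character_mult: "S \<in> C \<Longrightarrow> T \<in> C \<Longrightarrow> \<omega> (S o\<^sub>L T) = \<omega> S * \<omega> T"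
  and character_scalar: "T \<in> C \<Longrightarrow> \<omega> (scalar_op c o\<^sub>L T) = c * \<omega> T"
  using \<omega> by (auto simp: gelfand_spectrum_def)

lemma character_id: "\<omega> id_blinfun = 1"
proof -
  obtain T where T: "T \<in> C" "\<omega> T \<noteq> 0"
    using \<omega> by (auto simp: gelfand_spectrum_def)
  have "\<omega> id_blinfun * \<omega> T = \<omega> (id_blinfun o\<^sub>L T)"
    using T by (simp add: character_mult von_neumann_algebraD[OF C])
  also have "id_blinfun o\<^sub>L T = T"
    by (rule blinfun_eqI) simp
  finally show ?thesis using T by simp
qed

lemma character_scaleR: "T \<in> C \<Longrightarrow> \<omega> (r *\<^sub>R T) = of_real r * \<omega> T"
  using character_scalar[of T "of_real r"] by (simp add: scalar_op_of_real)

lemma character_zero: "\<omega> 0 = 0"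
  using character_scaleR[OF von_neumann_algebraD(2)[OF C], of 0] by simp

lemma character_diff: "S \<in> C \<Longrightarrow> T \<in> C \<Longrightarrow> \<omega> (S - T) = \<omega> S - \<omega> T"
  using character_add[of S "(- 1) *\<^sub>R T"] character_scaleR[of T "- 1"] scaleR_mem[of T "- 1"] by simp

lemma character_sum: "(\<And>i. i \<in> I \<Longrightarrow> f i \<in> C) \<Longrightarrow> \<omega> (sum f I) = (\<Sum>i\<in>I. \<omega> (f i))"
  by (induction I rule: infinite_finite_induct) (auto simp: character_zero character_add sum_mem)

text \<open>If \<open>\<bar>\<omega> T\<bar> > norm T\<close>, then \<open>1 - T / \<omega> T\<close> is invertible in \<open>C\<close> although \<open>\<omega>\<close> vanishes on it.\<close>

lemma character_norm_le:
  assumes T: "T \<in> C"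
  shows "cmod (\<omega> T) \<le> norm T"
proof (rule ccontr)
  assume "\<not> ?thesis"
  then have less: "norm T < cmod (\<omega> T)" by simp
  then have nz: "\<omega> T \<noteq> 0"
    using norm_ge_zero[of T] by auto
  let ?K = "scalar_op (1 / \<omega> T) o\<^sub>L T"
  define R where "R = id_blinfun - ?K"
  have K: "?K \<in> C"
    using T by (rule von_neumann_algebraD(5)[OF C])
  then have R: "R \<in> C"
    unfolding R_def using von_neumann_algebraD(2)[OF C] by (intro diff_mem)
  have "\<omega> R = 0"
    using nz by (simp add: R_def character_diff K von_neumann_algebraD(2)[OF C] character_scalar T
        character_id)
  have "(1 - norm T / cmod (\<omega> T)) * (norm x)\<^sup>2 \<le> inner x (R x)" for x
  proof -
    have "inner x (?K x) \<le> norm x * norm (?K x)"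
      by (rule norm_cauchy_schwarz)
    also have "\<dots> \<le> norm x * (norm T / cmod (\<omega> T) * norm x)"
      using nz norm_blinfun[of T x]
      by (intro mult_left_mono) (simp_all add: scalar_op_apply norm_scaleC norm_divide divide_right_mono)
    finally show ?thesis
      by (simp add: R_def blinfun.diff_left inner_diff_right power2_norm_eq_inner[symmetric]
          power2_eq_square algebra_simps)
  qed
  moreover have "0 < 1 - norm T / cmod (\<omega> T)"
    using less nz by simp
  ultimately obtain Q :: "'h \<Rightarrow>\<^sub>L 'h" where Q: "\<And>x. Q (R x) = x" "\<And>x. R (Q x) = x"
    using coercive_inverse by metis
  \<comment> \<open>An inverse commutes with everything that \<open>R\<close> commutes with, so the
    bicommutant property keeps it in \<open>C\<close>.\<close>
  have "Q \<in> C"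
  proof (rule von_neumann_algebra_memI[OF C])
    have Rc: "R (c *\<^sub>C x) = c *\<^sub>C R x" for c x
      using R von_neumann_algebraD(1)[OF C] by (intro cblinopsD) blast
    have "Q (c *\<^sub>C x) = Q (R (c *\<^sub>C Q x))" for c x
      by (simp add: Rc Q(2))
    then show "Q \<in> cblinops"
      by (simp add: cblinops_def Q(1))
    fix S x assume S: "S \<in> commutant C"
    have "Q (S x) = Q (S (R (Q x)))"
      by (simp add: Q(2))
    also have "\<dots> = Q (R (S (Q x)))"
      by (simp add: commutantD(2)[OF S R])
    finally show "Q (S x) = S (Q x)"
      by (simp add: Q(1))
  qed
  moreover have "R o\<^sub>L Q = id_blinfun"
    by (rule blinfun_eqI) (simp add: Q(2))
  ultimately have "1 = \<omega> R * \<omega> Q"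
    using R by (simp add: character_id flip: character_mult)
  then show False
    using \<open>\<omega> R = 0\<close> by simp
qed

text \<open>Characters are defined algebraically; their continuity comes from
  \<open>character_norm_le\<close>.\<close>

lemma character_tendsto:
  assumes "\<And>n. X n \<in> C" "T \<in> C" "X \<longlonglongrightarrow> T"
  shows "(\<lambda>n. \<omega> (X n)) \<longlonglongrightarrow> \<omega> T"
proof (rule LIM_zero_cancel, rule Lim_null_comparison)
  show "\<forall>\<^sub>F n in sequentially. norm (\<omega> (X n) - \<omega> T) \<le> norm (X n - T)"
    using character_norm_le[OF diff_mem[OF assms(1,2)]]
    by (simp add: character_diff[OF assms(1,2)])
  show "(\<lambda>n. norm (X n - T)) \<longlonglongrightarrow> 0"
    by (intro tendsto_norm_zero LIM_zero assms(3))
qed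

lemma character_projection:
  assumes "P \<in> C" "proj_op P"
  shows "\<omega> P = 0 \<or> \<omega> P = 1"
proof -
  have "P o\<^sub>L P = P"
    by (rule blinfun_eqI) (simp add: proj_opD[OF assms(2)])
  then have "\<omega> P * \<omega> P = \<omega> P"
    using character_mult[OF assms(1,1)] by simp
  then show ?thesis by auto
qed

text \<open>From \<open>\<omega> Q * \<omega> P = \<omega> P\<close>: the value 1 at
  \<open>P\<close> forces the value 1 at \<open>Q\<close>.\<close>

lemma character_projection_mono:
  assumes P: "P \<in> C" "proj_op P" and Q: "Q \<in> C" "proj_op Q" and "fixed_space P \<subseteq> fixed_space Q"
  shows "Re (\<omega> P) \<le> Re (\<omega> Q)"
proof -
  have "Q o\<^sub>L P = P"
    using proj_op_fixed_space_subset(1)[OF P(2) Q(2)] assms(5) by (intro blinfun_eqI) simp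
  then have "\<omega> Q * \<omega> P = \<omega> P"
    using character_mult[OF Q(1) P(1)] by simp
  then show ?thesis
    using character_projection[OF P] character_projection[OF Q] by auto
qed

lemma character_dyadic_sum:
  assumes "\<And>x. e x \<in> C"
  shows "\<omega> (dyadic_sum e L N) =
    of_real L - of_real (2 * L / 2 ^ N) * (\<Sum>i<2 ^ N. \<omega> (e (- L + real i * (2 * L / 2 ^ N))))"
  unfolding dyadic_sum_def
  by (simp only: character_diff character_scaleR character_sum character_id scaleR_mem sum_mem
      von_neumann_algebraD(2)[OF C] assms mult_1_right)

lemma Re_character_dyadic_sum:
  assumes "\<And>x. e x \<in> C"
  shows "Re (\<omega> (dyadic_sum e L N)) =
    L - 2 * L / 2 ^ N * (\<Sum>i<2 ^ N. Re (\<omega> (e (- L + real i * (2 * L / 2 ^ N)))))"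
  unfolding character_dyadic_sum[OF assms]
  by (simp only: minus_complex.sel Re_complex_of_real times_complex.sel Im_complex_of_real
      mult_zero_left diff_zero Re_sum)

lemma character_self_adjoint_dyadic:
  assumes "a \<in> C" "symmetric_op a" "L \<ge> norm a"
  shows "(\<lambda>N. \<omega> (dyadic_sum (spectral_projection a) L N)) \<longlonglongrightarrow> \<omega> a"
  using assms von_neumann_algebraD(1)[OF C]
  by (intro character_tendsto dyadic_sum_mem spectral_projection_mem[OF C] dyadic_sum_spectral_projection)
    auto

lemma character_self_adjoint_real:
  assumes "a \<in> C" "symmetric_op a"
  shows "\<omega> a \<in> \<real>"
proof (rule closed_sequentially[OF closed_complex_Reals _ character_self_adjoint_dyadic[OF assms order_refl]])
  have "\<omega> (spectral_projection a x) \<in> \<real>" for x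
    using character_projection[OF spectral_projection_mem[OF C assms]
        spectral_familyD(1)[OF spectral_family_spectral_projection[OF assms(2)]]] by (metis Reals_0 Reals_1)
  then show "\<omega> (dyadic_sum (spectral_projection a) (norm a) N) \<in> \<real>" for N
    unfolding character_dyadic_sum[OF spectral_projection_mem[OF C assms]]
    by (intro Reals_diff Reals_mult Reals_of_real sum_in_Reals)
qed

text \<open>The spectrally larger operator has the smaller spectral projections, and dyadic sums
  subtract them, so the two reversals cancel.\<close>

lemma character_mono:
  assumes a: "a \<in> C" "symmetric_op a" and b: "b \<in> C" "symmetric_op b" and "spectral_le a b"
  shows "Re (\<omega> a) \<le> Re (\<omega> b)"
proof (rule LIMSEQ_le)
  \<comment> \<open>A common \<open>L\<close> puts both dyadic sums on the same grid.\<close>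
  define L where "L = max (norm a) (norm b)"
  have L: "L \<ge> norm a" "L \<ge> norm b" "L \<ge> 0"
    by (simp_all add: L_def le_max_iff_disj)
  show "(\<lambda>N. Re (\<omega> (dyadic_sum (spectral_projection a) L N))) \<longlonglongrightarrow> Re (\<omega> a)"
    "(\<lambda>N. Re (\<omega> (dyadic_sum (spectral_projection b) L N))) \<longlonglongrightarrow> Re (\<omega> b)"
    by (intro tendsto_Re character_self_adjoint_dyadic a b L)+
  have "Re (\<omega> (spectral_projection b x)) \<le> Re (\<omega> (spectral_projection a x))" for x
  proof (rule character_projection_mono)
    show "fixed_space (spectral_projection b x) \<subseteq> fixed_space (spectral_projection a x)"
      using assms von_neumann_algebraD(1)[OF C] by (simp add: spectral_le_iff subset_iff)
  qed (use a b in \<open>auto intro: spectral_projection_mem[OF C]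
        spectral_familyD(1)[OF spectral_family_spectral_projection]\<close>)
  then have "2 * L / 2 ^ N * (\<Sum>i<2 ^ N. Re (\<omega> (spectral_projection b (- L + real i * (2 * L / 2 ^ N)))))
      \<le> 2 * L / 2 ^ N * (\<Sum>i<2 ^ N. Re (\<omega> (spectral_projection a (- L + real i * (2 * L / 2 ^ N)))))" for N
    using L(3) by (intro mult_left_mono sum_mono) auto
  then have "Re (\<omega> (dyadic_sum (spectral_projection a) L N)) \<le> Re (\<omega> (dyadic_sum (spectral_projection b) L N))" for N
    unfolding Re_character_dyadic_sum[OF spectral_projection_mem[OF C a]]
      Re_character_dyadic_sum[OF spectral_projection_mem[OF C b]]
    by (simp only: diff_left_mono)
  then show "\<exists>N0. \<forall>N\<ge>N0. Re (\<omega> (dyadic_sum (spectral_projection a) L N))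
      \<le> Re (\<omega> (dyadic_sum (spectral_projection b) L N))"
    by blast
qed

text \<open>Nonvanishing is the condition that restriction could destroy; it survives because
  \<open>D\<close> contains the identity, where \<open>\<omega>\<close> is 1.\<close>

lemma restrict_character:
  assumes "von_neumann_algebra D" "D \<subseteq> C"
  shows "restrict \<omega> D \<in> gelfand_spectrum D"
proof -
  note D = von_neumann_algebraD[OF assms(1)]
  have "restrict \<omega> D id_blinfun \<noteq> 0"
    using D(2) by (simp add: character_id)
  moreover have "S \<in> C" if "S \<in> D" for S
    using that assms(2) by blast
  ultimately show ?thesis
    unfolding gelfand_spectrum_def
    using D by (auto simp: character_add character_mult character_scalar intro!: bexI[of _ id_blinfun])
qed

end

end


section \<open>The internal topologies\<close>

lemma contextsD:
  assumes "C \<in> contexts A"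
  shows "von_neumann_algebra C" "C \<subseteq> A"
  using assms by (auto simp: contexts_def)

lemma down_iff: "D \<in> down A C \<longleftrightarrow> D \<in> contexts A \<and> D \<subseteq> C"
  by (simp add: down_def)

lemma spectral_presheaf_simps [simp]:
  "sections spectral_presheaf C = gelfand_spectrum C"
  "restr spectral_presheaf C D \<omega> = restrict \<omega> D"
  by (simp_all add: spectral_presheaf_def)

lemma lower_reals_simps [simp]:
  "sections (lower_reals A) C = order_reversing (down A C)"
  "restr (lower_reals A) C D s = restrict s (down A D)"
  by (simp_all add: lower_reals_def)

lemma is_presheaf_spectral_presheaf: "is_presheaf (contexts A) spectral_presheaf"
  unfolding is_presheaf_def
proof (intro conjI ballI impI)
  show "restr spectral_presheaf C D ` sections spectral_presheaf C \<subseteq> sections spectral_presheaf D"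
    if "C \<in> contexts A" "D \<in> contexts A" "D \<le> C" for C D
    using that by (auto intro: restrict_character contextsD)
  show "restr spectral_presheaf C C \<omega> = \<omega>" if "\<omega> \<in> sections spectral_presheaf C" for C \<omega>
    using that by (simp add: gelfand_spectrum_def extensional_restrict)
  show "restr spectral_presheaf D E (restr spectral_presheaf C D \<omega>) = restr spectral_presheaf C E \<omega>"
    if "E \<le> D \<and> D \<le> C" for C D E :: "('a \<Rightarrow>\<^sub>L 'a) set" and \<omega>
    using that by (simp add: restrict_restrict Int_absorb1)
qed

lemma order_reversing_le:
  assumes "s \<in> order_reversing (down A C)" "D \<in> down A C" "E \<in> down A C" "E \<subseteq> D"
  shows "s D \<le> s E"
  using assms by (auto simp: order_reversing_def monotone_on_def)

lemma down_mono: "D \<subseteq> C \<Longrightarrow> down A D \<subseteq> down A C"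
  by (auto simp: down_def)

lemma restrict_order_reversing:
  assumes "s \<in> order_reversing (down A C)" "D \<subseteq> C"
  shows "restrict s (down A D) \<in> order_reversing (down A D)"
  using assms(1) down_mono[OF assms(2), of A] by (auto simp: order_reversing_def monotone_on_def)

lemma is_presheaf_lower_reals: "is_presheaf (contexts A) (lower_reals A)"
  unfolding is_presheaf_def
proof (intro conjI ballI impI)
  show "restr (lower_reals A) C D ` sections (lower_reals A) C \<subseteq> sections (lower_reals A) D"
    if "D \<le> C" for C D
    using that by (auto intro: restrict_order_reversing)
  show "restr (lower_reals A) C C s = s" if "s \<in> sections (lower_reals A) C" for C s
    using that by (simp add: order_reversing_def extensional_restrict)
  show "restr (lower_reals A) D E (restr (lower_reals A) C D s) = restr (lower_reals A) C E s"
    if "E \<le> D \<and> D \<le> C" for C D E s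
    using that down_mono[of E D A] by (simp add: restrict_restrict Int_absorb1)
qed

section \<open>Topologies on the total spaces of the two presheaves\<close>

lemma openin_downset_topology:
  "openin (downset_topology P) U \<longleftrightarrow> U \<subseteq> P \<and> (\<forall>C\<in>U. \<forall>D\<in>P. D \<le> C \<longrightarrow> D \<in> U)"
  unfolding downset_topology_def topology_inverse'[OF istopology_downset] ..

lemma topspace_downset_topology: "topspace (downset_topology P) = P"
  unfolding topspace_def openin_downset_topology by blast

lemma openin_spectral_topology:
  "openin (spectral_topology A) U \<longleftrightarrow> etale_open (contexts A) spectral_presheaf U \<and>
    (\<forall>C\<in>contexts A. openin (gelfand_topology C) {\<omega>. (C, \<omega>) \<in> U})"
  unfolding spectral_topology_def topology_inverse'[OF istopology_spectral] ..

lemma topspace_gelfand_topology: "topspace (gelfand_topology C) = gelfand_spectrum C"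
  by (auto simp: gelfand_topology_def gelfand_spectrum_def PiE_def)

lemma openin_gelfand_halfspace:
  assumes "T \<in> C"
  shows "openin (gelfand_topology C) {\<omega> \<in> gelfand_spectrum C. Re (\<omega> T) > x}"
proof -
  have "continuous_map (gelfand_topology C) euclidean (\<lambda>\<omega>. \<omega> T)"
    unfolding gelfand_topology_def
    by (intro continuous_map_from_subtopology continuous_map_product_projection assms)
  moreover have "open {z. Re z > x}"
    by (rule open_halfspace_Re_gt)
  ultimately have "openin (gelfand_topology C) {\<omega> \<in> topspace (gelfand_topology C). \<omega> T \<in> {z. Re z > x}}"
    by (intro openin_continuous_map_preimage) auto
  then show ?thesis by (simp add: topspace_gelfand_topology)
qed

lemma etale_openI:
  assumes "U \<subseteq> total_space P F"
    and "\<And>C x D. (C, x) \<in> U \<Longrightarrow> D \<in> P \<Longrightarrow> D \<le> C \<Longrightarrow> (D, restr F C D x) \<in> U"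
  shows "etale_open P F U"
  using assms by (auto simp: etale_open_def)

text \<open>Each fibre of this set is everything or nothing, so the weak-* condition is automatic.
  With \<open>V\<close> the whole poset it shows that the total space is open.\<close>

lemma openin_spectral_topology_over_downset:
  assumes V: "openin (downset_topology (contexts A)) V"
  shows "openin (spectral_topology A) {p \<in> total_space (contexts A) spectral_presheaf. fst p \<in> V}"
  unfolding openin_spectral_topology
proof (intro conjI ballI)
  show "etale_open (contexts A) spectral_presheaf {p \<in> total_space (contexts A) spectral_presheaf. fst p \<in> V}"
    using V[unfolded openin_downset_topology]
    by (intro etale_openI) (auto simp: total_space_def intro: restrict_character contextsD)
  fix C assume "C \<in> contexts A"
  then have "{\<omega>. (C, \<omega>) \<in> {p \<in> total_space (contexts A) spectral_presheaf. fst p \<in> V}} =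
      (if C \<in> V then topspace (gelfand_topology C) else {})"
    by (auto simp: total_space_def topspace_gelfand_topology)
  then show "openin (gelfand_topology C)
      {\<omega>. (C, \<omega>) \<in> {p \<in> total_space (contexts A) spectral_presheaf. fst p \<in> V}}"
    by simp
qed

lemma topspace_spectral_topology:
  "topspace (spectral_topology A) = total_space (contexts A) spectral_presheaf"
proof
  show "topspace (spectral_topology A) \<subseteq> total_space (contexts A) spectral_presheaf"
    unfolding topspace_def openin_spectral_topology etale_open_def by blast
  have "openin (downset_topology (contexts A)) (contexts A)"
    by (simp add: openin_downset_topology)
  from openin_subset[OF openin_spectral_topology_over_downset[OF this]]
  show "total_space (contexts A) spectral_presheaf \<subseteq> topspace (spectral_topology A)"
    by (auto simp: total_space_def)
qed

lemma internal_topology_spectral: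
  "internal_topology (contexts A) spectral_presheaf (spectral_topology A)"
  unfolding internal_topology_def continuous_map topspace_spectral_topology topspace_downset_topology
  using openin_spectral_topology_over_downset
  by (auto simp: openin_spectral_topology total_space_def)

abbreviation lower_generator ::
    "('h::complex_hilbert_space \<Rightarrow>\<^sub>L 'h) set \<Rightarrow> real \<Rightarrow> ('h \<Rightarrow>\<^sub>L 'h) set \<Rightarrow>
     (('h \<Rightarrow>\<^sub>L 'h) set \<times> (('h \<Rightarrow>\<^sub>L 'h) set \<Rightarrow> real)) set"
  where "lower_generator A x C \<equiv>
    {(D, s). D \<in> down A C \<and> s \<in> order_reversing (down A D) \<and> s D > x}"

lemma openin_lower_generator: "C \<in> contexts A \<Longrightarrow> openin (lower_topology A) (lower_generator A x C)"
  unfolding lower_topology_def by (rule topology_generated_by_Basis) blast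

text \<open>Any number below \<open>s C\<close> would do in place of \<open>s C - 1\<close>. Each
  point thus has a generator around it that lies over the down-set of \<open>C\<close>; this serves
  both to cover the total space and to make the bundle projection continuous.\<close>

lemma mem_lower_generator:
  assumes "(C, s) \<in> total_space (contexts A) (lower_reals A)"
  shows "(C, s) \<in> lower_generator A (s C - 1) C"
  using assms by (simp add: total_space_def down_iff)

lemma topspace_lower_topology: "topspace (lower_topology A) = total_space (contexts A) (lower_reals A)"
proof
  show "topspace (lower_topology A) \<subseteq> total_space (contexts A) (lower_reals A)"
    unfolding lower_topology_def topology_generated_by_topspace by (auto simp: total_space_def down_iff)
  show "total_space (contexts A) (lower_reals A) \<subseteq> topspace (lower_topology A)"
  proof
    fix p assume p: "p \<in> total_space (contexts A) (lower_reals A)"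
    then obtain C s where "p = (C, s)" "C \<in> contexts A"
      by (auto simp: total_space_def)
    then show "p \<in> topspace (lower_topology A)"
      using mem_lower_generator[of C s A] p openin_subset[OF openin_lower_generator[of C A "s C - 1"]]
      by blast
  qed
qed

text \<open>Order reversal is what carries the bound at \<open>D\<close> to smaller
  contexts.\<close>

lemma etale_open_lower_generator:
  "etale_open (contexts A) (lower_reals A) (lower_generator A x C)"
proof (rule etale_openI)
  show "lower_generator A x C \<subseteq> total_space (contexts A) (lower_reals A)"
    by (auto simp: total_space_def down_iff)
  fix D s E assume D: "(D, s) \<in> lower_generator A x C" and E: "E \<in> contexts A" "E \<le> D"
  then have "s D \<le> s E"
    by (intro order_reversing_le[of s A D]) (auto simp: down_iff)
  then show "(E, restr (lower_reals A) D E s) \<in> lower_generator A x C"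
    using D E by (auto simp: down_iff intro: restrict_order_reversing)
qed

lemma etale_open_lower_topology:
  assumes "openin (lower_topology A) U"
  shows "etale_open (contexts A) (lower_reals A) U"
  using openin_topology_generated_by[OF assms[unfolded lower_topology_def]]
proof induction
  case Empty
  show ?case by (simp add: etale_open_def)
next
  case (Int U V)
  then show ?case by (intro etale_open_Int)
next
  case (UN \<U>)
  then show ?case by (intro etale_open_Union)
next
  case (Basis U)
  then show ?case using etale_open_lower_generator by blast
qed

lemma internal_topology_lower: "internal_topology (contexts A) (lower_reals A) (lower_topology A)"
  unfolding internal_topology_def continuous_map topspace_lower_topology topspace_downset_topology
proof (intro conjI allI impI)
  show "etale_open (contexts A) (lower_reals A) U" if "openin (lower_topology A) U" for U
    using that by (rule etale_open_lower_topology)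
  show "fst ` total_space (contexts A) (lower_reals A) \<subseteq> contexts A"
    by (auto simp: total_space_def)
  fix V assume V: "openin (downset_topology (contexts A)) V"
  show "openin (lower_topology A) {p \<in> total_space (contexts A) (lower_reals A). fst p \<in> V}"
  proof (subst openin_subopen, intro ballI)
    fix p assume p: "p \<in> {p \<in> total_space (contexts A) (lower_reals A). fst p \<in> V}"
    then obtain C s where C: "p = (C, s)" "C \<in> contexts A" "C \<in> V"
      by (auto simp: total_space_def)
    have "lower_generator A (s C - 1) C \<subseteq> {p \<in> total_space (contexts A) (lower_reals A). fst p \<in> V}"
      using V C(3) unfolding openin_downset_topology by (auto simp: total_space_def down_iff)
    then show "\<exists>T. openin (lower_topology A) T \<and> p \<in> T \<and>
        T \<subseteq> {p \<in> total_space (contexts A) (lower_reals A). fst p \<in> V}"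
      using mem_lower_generator[of C s A] openin_lower_generator[OF C(2)] p C(1) by blast
  qed
qed simp

section \<open>The daseinisation transformation: values, naturality, continuity\<close>

context
  fixes A :: "('h::complex_hilbert_space \<Rightarrow>\<^sub>L 'h) set" and a :: "'h \<Rightarrow>\<^sub>L 'h"
  assumes A: "von_neumann_algebra A" and a: "a \<in> self_adjoints A"
begin

lemma symmetric_a: "symmetric_op a" "a \<in> cblinops"
  using a von_neumann_algebraD(1)[OF A] by (auto simp: self_adjoints_iff)

lemma outer_das_mem:
  assumes "D \<in> contexts A"
  shows "outer_das a D \<in> D" "symmetric_op (outer_das a D)"
  using outer_das_least(1)[OF contextsD(1)[OF assms] symmetric_a]
    self_adjoints_iff[OF von_neumann_algebraD(1)[OF contextsD(1)[OF assms]]] by auto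

text \<open>The approximation of \<open>a\<close> from \<open>E\<close> is also a competitor in the
  larger algebra \<open>D\<close>, where \<open>outer_das a D\<close> is least.\<close>

lemma outer_das_antimono:
  assumes "D \<in> contexts A" "E \<in> contexts A" "E \<subseteq> D"
  shows "spectral_le (outer_das a D) (outer_das a E)"
proof (rule outer_das_least(3)[OF contextsD(1)[OF assms(1)] symmetric_a])
  show "outer_das a E \<in> self_adjoints D"
    using outer_das_mem[OF assms(2)] assms(3)
    by (auto simp: self_adjoints_iff[OF von_neumann_algebraD(1)[OF contextsD(1)[OF assms(1)]]])
  show "spectral_le a (outer_das a E)"
    by (rule outer_das_least(2)[OF contextsD(1)[OF assms(2)] symmetric_a])
qed

text \<open>Justifies \<open>Re\<close> in \<open>das_transformation\<close>: no imaginary part is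
  discarded.\<close>

lemma das_transformation_real:
  assumes "C \<in> contexts A" "\<omega> \<in> gelfand_spectrum C" "D \<in> down A C"
  shows "complex_of_real (das_transformation A a C \<omega> D) = \<omega> (outer_das a D)"
proof -
  have "outer_das a D \<in> C" "symmetric_op (outer_das a D)"
    using outer_das_mem[of D] assms(3) by (auto simp: down_iff)
  then have "\<omega> (outer_das a D) \<in> \<real>"
    by (rule character_self_adjoint_real[OF contextsD(1)[OF assms(1)] assms(2)])
  then show ?thesis
    using assms(3) by (simp add: das_transformation_def)
qed

lemma das_transformation_order_reversing:
  assumes C: "C \<in> contexts A" "\<omega> \<in> gelfand_spectrum C"
  shows "das_transformation A a C \<omega> \<in> order_reversing (down A C)"
proof -
  have "Re (\<omega> (outer_das a D)) \<le> Re (\<omega> (outer_das a E))"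
    if "D \<in> down A C" "E \<in> down A C" "E \<subseteq> D" for D E
    using that outer_das_mem[of D] outer_das_mem[of E] outer_das_antimono[of D E]
    by (intro character_mono[OF contextsD(1)[OF C(1)] C(2)]) (auto simp: down_iff)
  then show ?thesis
    by (auto simp: order_reversing_def das_transformation_def monotone_on_def)
qed

lemma das_transformation_restrict:
  assumes "D \<subseteq> C"
  shows "das_transformation A a D (restrict \<omega> D) = restrict (das_transformation A a C \<omega>) (down A D)"
proof
  fix E
  show "das_transformation A a D (restrict \<omega> D) E = restrict (das_transformation A a C \<omega>) (down A D) E"
  proof (cases "E \<in> down A D")
    case True
    then have "outer_das a E \<in> D" "E \<in> down A C"
      using outer_das_mem(1)[of E] assms by (auto simp: down_iff)
    then show ?thesis
      using True by (simp add: das_transformation_def)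
  qed (simp add: das_transformation_def)
qed

lemma natural_transformation_das:
  "natural_transformation (contexts A) spectral_presheaf (lower_reals A) (das_transformation A a)"
  unfolding natural_transformation_def
  by (auto simp: is_presheaf_spectral_presheaf is_presheaf_lower_reals das_transformation_restrict
      intro: das_transformation_order_reversing)

text \<open>This set is the preimage of a generator. A point is tested at its own base
  \<open>D\<close>, so stability under restriction to \<open>E\<close> combines two facts: the value
  grows from \<open>D\<close> to \<open>E\<close>, and \<open>outer_das a E\<close> lies in
  \<open>E\<close>, where the restricted character agrees with \<open>\<omega>\<close>.\<close>

lemma openin_das_preimage:
  assumes C: "C \<in> contexts A"
  shows "openin (spectral_topology A)
    {(D, \<omega>). D \<in> down A C \<and> \<omega> \<in> gelfand_spectrum D \<and> Re (\<omega> (outer_das a D)) > x}" (is "openin _ ?W")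
  unfolding openin_spectral_topology
proof (intro conjI ballI)
  show "etale_open (contexts A) spectral_presheaf ?W"
  proof (rule etale_openI)
    show "?W \<subseteq> total_space (contexts A) spectral_presheaf"
      by (auto simp: total_space_def down_iff)
    fix D \<omega> E assume D: "(D, \<omega>) \<in> ?W" and E: "E \<in> contexts A" "E \<le> D"
    then have D': "D \<in> contexts A" "\<omega> \<in> gelfand_spectrum D"
      by (auto simp: down_iff)
    have "das_transformation A a D \<omega> D \<le> das_transformation A a D \<omega> E"
      using D' E by (intro order_reversing_le[OF das_transformation_order_reversing]) (auto simp: down_iff)
    then have "Re (\<omega> (outer_das a D)) \<le> Re (\<omega> (outer_das a E))"
      using D' E by (simp add: das_transformation_def down_iff)
    moreover have "restrict \<omega> E \<in> gelfand_spectrum E"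
      using D' E by (intro restrict_character[of D]) (auto intro: contextsD)
    ultimately show "(E, restr spectral_presheaf D E \<omega>) \<in> ?W"
      using D E outer_das_mem(1)[OF E(1)] by (auto simp: down_iff)
  qed
  fix D assume D: "D \<in> contexts A"
  have "{\<omega>. (D, \<omega>) \<in> ?W} =
      (if D \<subseteq> C then {\<omega> \<in> gelfand_spectrum D. Re (\<omega> (outer_das a D)) > x} else {})"
    using D by (auto simp: down_iff)
  then show "openin (gelfand_topology D) {\<omega>. (D, \<omega>) \<in> ?W}"
    using openin_gelfand_halfspace[OF outer_das_mem(1)[OF D]] by simp
qed

lemma continuous_map_das:
  "continuous_map (spectral_topology A) (lower_topology A) (\<lambda>(C, \<omega>). (C, das_transformation A a C \<omega>))"
  (is "continuous_map _ _ ?f")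
proof -
  \<comment> \<open>Checking continuity on generators also requires that the image lies in their
    union.\<close>
  have into: "?f ` topspace (spectral_topology A) \<subseteq> topspace (lower_topology A)"
    using das_transformation_order_reversing
    by (auto simp: topspace_spectral_topology topspace_lower_topology total_space_def)
  have "openin (spectral_topology A) (?f -` lower_generator A x C \<inter> topspace (spectral_topology A))"
    if C: "C \<in> contexts A" for x C
  proof -
    have "?f -` lower_generator A x C \<inter> topspace (spectral_topology A) =
        {(D, \<omega>). D \<in> down A C \<and> \<omega> \<in> gelfand_spectrum D \<and> Re (\<omega> (outer_das a D)) > x}"
      using das_transformation_order_reversing
      by (auto simp: topspace_spectral_topology total_space_def down_iff das_transformation_def)
    then show ?thesis
      by (simp only: openin_das_preimage[OF C])
  qed
  then show ?thesis
    using into unfolding lower_topology_def continuous_on_generated_topo_iff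
      topology_generated_by_topspace by blast
qed

end

theorem proposition3p10:
  fixes A :: "('h::complex_hilbert_space \<Rightarrow>\<^sub>L 'h) set" and a :: "'h \<Rightarrow>\<^sub>L 'h"
  assumes "von_neumann_algebra A" and "a \<in> self_adjoints A"
  shows "(\<forall>C\<in>contexts A. \<forall>\<omega>\<in>gelfand_spectrum C. \<forall>D\<in>down A C.
            complex_of_real (das_transformation A a C \<omega> D) = \<omega> (outer_das a D)) \<and>
         internally_continuous (contexts A)
           spectral_presheaf (spectral_topology A)
           (lower_reals A) (lower_topology A)
           (das_transformation A a)"
  using das_transformation_real[OF assms] natural_transformation_das[OF assms]
    continuous_map_das[OF assms] internal_topology_spectral internal_topology_lower
  unfolding internally_continuous_def by blast

end
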